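(* Let $X$ and $Y$ be uniformly locally finite metric spaces, and assume $Y$ has property A. Suppose there are an embedding $\Phi:\mathrm{C}^*_u(X)\to\mathrm{C}^*_u(Y)$ and a hereditary $\mathrm{C}^*$-subalgebra $A$ of $\mathrm{C}^*_u(Y)$ such that $(A,\Phi(\ell_\infty(X)))$ is a Roe Cartan pair and $\Phi(\mathrm{C}^*_u(X))$ is strongly-cobounded in $A$. Then there are $Z\subset Y$ and a bijective coarse quotient map $X\to Z$.
   Context: U.l.f.: for every $r$, balls of radius $r$ have uniformly bounded cardinality. $\mathrm{C}^*_u(X)$: norm closure in $\mathcal B(\ell_2(X))$ of finite-propagation operators, $\mathrm{propg}(a)=\sup\{d(x,y):\langle a\delta_x,\delta_y\rangle\ne0\}$; $\ell_\infty(X)$ diagonal subalgebra. Embedding = injective $*$-homomorphism. Property A (for u.l.f. spaces) is equivalent to: every ghost in $\mathrm{C}^*_u(Y)$ is compact, where $a$ is a ghost if for all $\varepsilon>0$ there is a finite $F$ with $|\langle a\delta_x,\delta_y\rangle|\le\varepsilon$ for $x,y\notin F$. Cartan subalgebra $B\subset A$: maximal abelian self-adjoint, contains an approximate unit for $A$, normalizer $\{a: aBa^*\subset B,a^*Ba\subset B\}$ generates $A$, and there is a faithful conditional expectation $A\to B$. For a unital $\mathrm{C}^*$-algebra $A$ and Cartan subalgebra $B$, $(A,B)$ is a Roe Cartan pair if $A$ contains the compact operators on an infinite-dimensional Hilbert space as an essential ideal, $B\cong\ell_\infty(\mathbb N)$, and $B$ is coseparable in $A$ (there is a countable $S\subset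 A$ with $A=\mathrm{C}^*(B,S)$). For $A_1\subset A_2\subset\mathrm{C}^*_u(Y)$, $A_1$ is strongly-cobounded in $A_2$ if there is $k\in\mathbb N$ such that for every $\varepsilon>0$ and contraction $b\in A_2$ there are $a_1,\dots,a_k\in A_1$ with $\|a_i\|\le k$ and $c_1,\dots,c_k\in A_2$ with $\mathrm{propg}(c_i)\le k$, $\|c_i\|\le k$, and $\|b-\sum c_ia_i\|\le\varepsilon$. Coarse quotient: coarse map $f$ with some $K>0$ such that for every $\varepsilon>0$ there is $\delta>0$ with $B(f(x),\varepsilon)\subset f(B(x,\delta))^K$ for all $x$ (closed balls, $A^K$ closed $K$-neighborhood). *)

theory Defs
  imports "HOL-Analysis.Analysis"
begin

text \<open>Vectors of l2(X) are square-summable functions X -> complex. Operators are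
represented as maps on all functions X -> complex which are linear and bounded on l2(X),
map l2(X) into l2(X), and vanish outside l2(X) (so that equality of operators is plain
function equality).\<close>

type_synonym 'a op = "('a \<Rightarrow> complex) \<Rightarrow> ('a \<Rightarrow> complex)"

definition l2 :: "('a \<Rightarrow> complex) set" where
  "l2 = {v. (\<lambda>x. (cmod (v x))^2) summable_on UNIV}"

definition l2norm :: "('a \<Rightarrow> complex) \<Rightarrow> real" where
  "l2norm v = sqrt (\<Sum>\<^sub>\<infinity>x. (cmod (v x))^2)"

definition l2inner :: "('a \<Rightarrow> complex) \<Rightarrow> ('a \<Rightarrow> complex) \<Rightarrow> complex" where
  "l2inner v w = (\<Sum>\<^sub>\<infinity>x. v x * cnj (w x))"

definition bounded_op :: "'a op \<Rightarrow> bool" where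
  "bounded_op a \<longleftrightarrow>
     (\<forall>v\<in>l2. a v \<in> l2) \<and>
     (\<forall>v\<in>l2. \<forall>w\<in>l2. a (\<lambda>x. v x + w x) = (\<lambda>x. a v x + a w x)) \<and>
     (\<forall>v\<in>l2. \<forall>c. a (\<lambda>x. c * v x) = (\<lambda>x. c * a v x)) \<and>
     (\<forall>v. v \<notin> l2 \<longrightarrow> a v = (\<lambda>x. 0)) \<and>
     (\<exists>C. \<forall>v\<in>l2. l2norm (a v) \<le> C * l2norm v)"

definition opnorm :: "'a op \<Rightarrow> real" where
  "opnorm a = Sup {l2norm (a v) | v. v \<in> l2 \<and> l2norm v \<le> 1}"

definition op_zero :: "'a op" where "op_zero = (\<lambda>v x. 0)"
definition op_add :: "'a op \<Rightarrow> 'a op \<Rightarrow> 'a op" where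
  "op_add a b = (\<lambda>v x. a v x + b v x)"
definition op_minus :: "'a op \<Rightarrow> 'a op \<Rightarrow> 'a op" where
  "op_minus a b = (\<lambda>v x. a v x - b v x)"
definition op_scale :: "complex \<Rightarrow> 'a op \<Rightarrow> 'a op" where
  "op_scale c a = (\<lambda>v x. c * a v x)"
definition op_mult :: "'a op \<Rightarrow> 'a op \<Rightarrow> 'a op" where
  "op_mult a b = a \<circ> b"
definition op_adj :: "'a op \<Rightarrow> 'a op" where
  "op_adj a = (THE b. bounded_op b \<and>
       (\<forall>v\<in>l2. \<forall>w\<in>l2. l2inner (a v) w = l2inner v (b w)))"

definition delta :: "'a \<Rightarrow> ('a \<Rightarrow> complex)" where
  "delta x = (\<lambda>z. if z = x then 1 else 0)"

definition entry :: "'a op \<Rightarrow> 'a \<Rightarrow> 'a \<Rightarrow> complex" where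
  "entry a x y = l2inner (a (delta x)) (delta y)"

definition positive_op :: "'a op \<Rightarrow> bool" where
  "positive_op a \<longleftrightarrow> bounded_op a \<and>
     (\<forall>v\<in>l2. Im (l2inner (a v) v) = 0 \<and> Re (l2inner (a v) v) \<ge> 0)"

definition propg_le :: "('a::metric_space) op \<Rightarrow> real \<Rightarrow> bool" where
  "propg_le a r \<longleftrightarrow> (\<forall>x y. entry a x y \<noteq> 0 \<longrightarrow> dist x y \<le> r)"

definition finite_prop :: "('a::metric_space) op \<Rightarrow> bool" where
  "finite_prop a \<longleftrightarrow> (\<exists>r. propg_le a r)"

definition roe_alg :: "('a::metric_space) op set" where
  "roe_alg = {a. bounded_op a \<and>
      (\<forall>\<epsilon>>0. \<exists>b. bounded_op b \<and> finite_prop b \<and> opnorm (op_minus a b) \<le> \<epsilon>)}"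

definition linf_diag :: "'a op set" where
  "linf_diag = {a. bounded_op a \<and>
      (\<exists>f :: 'a \<Rightarrow> complex. bounded (range f) \<and> (\<forall>v\<in>l2. a v = (\<lambda>x. f x * v x)))}"

definition finite_rank :: "'a op \<Rightarrow> bool" where
  "finite_rank b \<longleftrightarrow> (\<exists>(n::nat) us ws. (\<forall>i<n. us i \<in> l2 \<and> ws i \<in> l2) \<and>
      (\<forall>v\<in>l2. b v = (\<lambda>x. \<Sum>i<n. l2inner v (ws i) * us i x)))"

definition compacts :: "'a op set" where
  "compacts = {a. bounded_op a \<and>
      (\<forall>\<epsilon>>0. \<exists>b. bounded_op b \<and> finite_rank b \<and> opnorm (op_minus a b) \<le> \<epsilon>)}"

definition cstar_subalg :: "'a op set \<Rightarrow> bool" where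
  "cstar_subalg S \<longleftrightarrow> (\<forall>a\<in>S. bounded_op a) \<and> op_zero \<in> S \<and>
     (\<forall>a\<in>S. \<forall>b\<in>S. op_add a b \<in> S \<and> op_mult a b \<in> S) \<and>
     (\<forall>a\<in>S. \<forall>c. op_scale c a \<in> S) \<and>
     (\<forall>a\<in>S. op_adj a \<in> S) \<and>
     (\<forall>a. bounded_op a \<and> (\<forall>\<epsilon>>0. \<exists>b\<in>S. opnorm (op_minus a b) \<le> \<epsilon>) \<longrightarrow> a \<in> S)"

definition cstar_gen :: "'a op set \<Rightarrow> 'a op set" where
  "cstar_gen S = \<Inter>{C. cstar_subalg C \<and> S \<subseteq> C}"

definition hereditary :: "'a op set \<Rightarrow> 'a op set \<Rightarrow> bool" where
  "hereditary A C \<longleftrightarrow> cstar_subalg A \<and> A \<subseteq> C \<and>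
     (\<forall>a\<in>A. \<forall>b\<in>C. positive_op b \<and> positive_op (op_minus a b) \<longrightarrow> b \<in> A)"

definition star_hom :: "('a op \<Rightarrow> 'b op) \<Rightarrow> 'a op set \<Rightarrow> bool" where
  "star_hom h S \<longleftrightarrow>
     (\<forall>a\<in>S. \<forall>b\<in>S. h (op_add a b) = op_add (h a) (h b) \<and>
                    h (op_mult a b) = op_mult (h a) (h b)) \<and>
     (\<forall>a\<in>S. \<forall>c. h (op_scale c a) = op_scale c (h a)) \<and>
     (\<forall>a\<in>S. h (op_adj a) = op_adj (h a))"

definition embedding :: "('a op \<Rightarrow> 'b op) \<Rightarrow> 'a op set \<Rightarrow> 'b op set \<Rightarrow> bool" where
  "embedding h S T \<longleftrightarrow> star_hom h S \<and> h ` S \<subseteq> T \<and> inj_on h S"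

definition star_iso :: "('a op \<Rightarrow> 'b op) \<Rightarrow> 'a op set \<Rightarrow> 'b op set \<Rightarrow> bool" where
  "star_iso h S T \<longleftrightarrow> star_hom h S \<and> bij_betw h S T"

definition closed_ideal :: "'a op set \<Rightarrow> 'a op set \<Rightarrow> bool" where
  "closed_ideal J A \<longleftrightarrow> cstar_subalg J \<and> J \<subseteq> A \<and>
     (\<forall>a\<in>A. \<forall>j\<in>J. op_mult a j \<in> J \<and> op_mult j a \<in> J)"

definition essential_ideal :: "'a op set \<Rightarrow> 'a op set \<Rightarrow> bool" where
  "essential_ideal J A \<longleftrightarrow> closed_ideal J A \<and>
     (\<forall>a\<in>A. (\<forall>j\<in>J. op_mult a j = op_zero) \<longrightarrow> a = op_zero)"

definition unital :: "'a op set \<Rightarrow> bool" where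
  "unital A \<longleftrightarrow> (\<exists>e\<in>A. \<forall>a\<in>A. op_mult e a = a \<and> op_mult a e = a)"

definition normalizer :: "'a op set \<Rightarrow> 'a op set \<Rightarrow> 'a op set" where
  "normalizer B A = {a\<in>A. \<forall>b\<in>B. op_mult (op_mult a b) (op_adj a) \<in> B \<and>
                                 op_mult (op_mult (op_adj a) b) a \<in> B}"

definition approx_unit_in :: "'a op set \<Rightarrow> 'a op set \<Rightarrow> bool" where
  "approx_unit_in B A \<longleftrightarrow> (\<forall>F. finite F \<and> F \<subseteq> A \<longrightarrow> (\<forall>\<epsilon>>0. \<exists>e\<in>B.
      positive_op e \<and> opnorm e \<le> 1 \<and>
      (\<forall>a\<in>F. opnorm (op_minus (op_mult e a) a) \<le> \<epsilon> \<and>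
              opnorm (op_minus (op_mult a e) a) \<le> \<epsilon>)))"

definition faithful_cond_exp :: "('a op \<Rightarrow> 'a op) \<Rightarrow> 'a op set \<Rightarrow> 'a op set \<Rightarrow> bool" where
  "faithful_cond_exp E A B \<longleftrightarrow>
     (\<forall>a\<in>A. E a \<in> B) \<and>
     (\<forall>a\<in>A. \<forall>b\<in>A. E (op_add a b) = op_add (E a) (E b)) \<and>
     (\<forall>a\<in>A. \<forall>c. E (op_scale c a) = op_scale c (E a)) \<and>
     (\<forall>b\<in>B. E b = b) \<and>
     (\<forall>a\<in>A. positive_op a \<longrightarrow> positive_op (E a)) \<and>
     (\<forall>a\<in>A. opnorm (E a) \<le> opnorm a) \<and>
     (\<forall>a\<in>A. \<forall>b1\<in>B. \<forall>b2\<in>B. E (op_mult (op_mult b1 a) b2) = op_mult (op_mult b1 (E a)) b2) \<and>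
     (\<forall>a\<in>A. positive_op a \<and> E a = op_zero \<longrightarrow> a = op_zero)"

definition cartan :: "'a op set \<Rightarrow> 'a op set \<Rightarrow> bool" where
  "cartan B A \<longleftrightarrow> cstar_subalg A \<and> cstar_subalg B \<and> B \<subseteq> A \<and>
     (\<forall>a\<in>B. \<forall>b\<in>B. op_mult a b = op_mult b a) \<and>
     (\<forall>a\<in>A. (\<forall>b\<in>B. op_mult a b = op_mult b a) \<longrightarrow> a \<in> B) \<and>
     approx_unit_in B A \<and>
     cstar_gen (normalizer B A) = A \<and>
     (\<exists>E. faithful_cond_exp E A B)"

definition roe_cartan :: "'a op set \<Rightarrow> 'a op set \<Rightarrow> bool" where
  "roe_cartan A B \<longleftrightarrow> cstar_subalg A \<and> unital A \<and> cartan B A \<and>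
     (\<exists>J h. essential_ideal J A \<and> star_iso h (compacts :: nat op set) J) \<and>
     (\<exists>h. star_iso h (linf_diag :: nat op set) B) \<and>
     (\<exists>S. countable S \<and> S \<subseteq> A \<and> A = cstar_gen (B \<union> S))"

definition strongly_cobounded :: "('a::metric_space) op set \<Rightarrow> 'a op set \<Rightarrow> bool" where
  "strongly_cobounded A1 A2 \<longleftrightarrow> A1 \<subseteq> A2 \<and> (\<exists>k::nat. \<forall>\<epsilon>>0. \<forall>b\<in>A2. opnorm b \<le> 1 \<longrightarrow>
     (\<exists>a c. (\<forall>i<k. a i \<in> A1 \<and> opnorm (a i) \<le> real k \<and>
                   c i \<in> A2 \<and> propg_le (c i) (real k) \<and> opnorm (c i) \<le> real k) \<and>
            opnorm (op_minus b (\<lambda>v y. \<Sum>i<k. c i (a i v) y)) \<le> \<epsilon>))"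

definition ulf :: "('a::metric_space) set \<Rightarrow> bool" where
  "ulf X \<longleftrightarrow> (\<forall>r. \<exists>N::nat. \<forall>x\<in>X. finite (cball x r \<inter> X) \<and> card (cball x r \<inter> X) \<le> N)"

text \<open>Property A (Higson--Roe formulation for u.l.f. spaces)\<close>
definition property_A :: "('a::metric_space) set \<Rightarrow> bool" where
  "property_A X \<longleftrightarrow> (\<forall>R>0. \<forall>\<epsilon>>0. \<exists>S. \<exists>\<xi> :: 'a \<Rightarrow> 'a \<Rightarrow> real.
      (\<forall>x\<in>X. (\<forall>z. \<xi> x z \<ge> 0) \<and> {z. \<xi> x z \<noteq> 0} \<subseteq> cball x S \<inter> X \<and>
              finite {z. \<xi> x z \<noteq> 0} \<and> (\<Sum>z\<in>{z. \<xi> x z \<noteq> 0}. \<xi> x z) = 1) \<and>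
      (\<forall>x\<in>X. \<forall>y\<in>X. dist x y \<le> R \<longrightarrow>
          (\<Sum>z\<in>{z. \<xi> x z \<noteq> 0} \<union> {z. \<xi> y z \<noteq> 0}. \<bar>\<xi> x z - \<xi> y z\<bar>) \<le> \<epsilon>))"

definition coarse_map :: "('a::metric_space \<Rightarrow> 'b::metric_space) \<Rightarrow> bool" where
  "coarse_map f \<longleftrightarrow> (\<forall>r. \<exists>s. \<forall>x x'. dist x x' \<le> r \<longrightarrow> dist (f x) (f x') \<le> s)"

definition coarse_quotient :: "('a::metric_space \<Rightarrow> 'b::metric_space) \<Rightarrow> 'b set \<Rightarrow> bool" where
  "coarse_quotient f Z \<longleftrightarrow> f ` UNIV \<subseteq> Z \<and> coarse_map f \<and>
     (\<exists>K>0. \<forall>\<epsilon>>0. \<exists>\<delta>>0. \<forall>x. \<forall>z\<in>Z. dist z (f x) \<le> \<epsilon> \<longrightarrow>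
        (\<exists>x'. dist x' x \<le> \<delta> \<and> dist z (f x') \<le> K))"

end

theory Submission
  imports Defs
begin

text \<open>
  Since \<open>A\<close> contains the projection \<open>p = \<Phi>(1)\<close>, heredity gives \<open>p C\<^sup>*\<^sub>u(Y) p \<subseteq> A\<close>, and the images of the
  minimal projections of \<open>l\<^sub>\<infinity>(X)\<close> are minimal in \<open>A\<close> by maximality of the abelian subalgebra, hence of rank
  one. The faithful conditional expectation shows that the corresponding unit vectors \<open>\<xi> x\<close> form a basis of the range of \<open>p\<close>, so
  \<open>\<Phi>\<close> is implemented by the isometry \<open>delta x \<mapsto> \<xi> x\<close>.

  Property A provides positive definite kernels of finite propagation, whose Schur multipliers
  approximate the identity on \<open>C\<^sup>*\<^sub>u(Y)\<close>. A Baire category argument makes this approximation uniform over all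
  images of subsets of a partial translation of \<open>X\<close>. A sign-averaging argument then shows that a point \<open>y\<close> at which all
  \<open>\<xi> x\<close>, \<open>x \<in> M\<close>, are small carries little mass of the projection onto the span of \<open>\<xi> x\<close>, \<open>x \<in> M\<close>. Together
  with the localisation of norms by the kernels this yields Hall's condition for the finite sets
  \<open>{y. d \<le> |\<xi> x y|}\<close>, so there is an injection \<open>f\<close> with \<open>|\<xi> x (f x)| \<ge> d\<close>.

  Uniform approximability of images of partial translations makes \<open>f\<close> coarse. If \<open>f\<close> were not a coarse quotient, a sequence of
  bad pairs would define a partial translation \<open>W\<close> of \<open>Y\<close>, and writing \<open>p W p\<close> approximately as \<open>\<Sum> c\<^sub>i a\<^sub>i\<close> by strong
  coboundedness would contradict the smallness estimate, because the \<open>c\<^sub>i\<close> have propagation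
  bounded in advance.
\<close>

section \<open>Square-summable functions\<close>

type_synonym 'a vec = "'a \<Rightarrow> complex"

text \<open>The obstacle is that \<Phi> is only known to be norm continuous, whereas the families of
  basis vectors and the partial translations that occur are infinite. Completeness of the vectors
  \<open>\<xi> x\<close> in the range of \<open>p\<close> repairs this: every matrix entry of the
  image of a partial translation becomes an absolutely convergent sum over its graph, and this sum
  may be restricted to any subset of the graph. The Baire argument then exchanges quantifiers, from
  one \<open>n\<close> per subset to one \<open>n\<close> for all subsets. That uniformity is what
  the sign average consumes, since a choice of signs splits an index set into two uncontrolled
  subsets. In the last step the propagation of approximants of the \<open>a i\<close> cannot be
  bounded before the operator to be approximated is known. Therefore infinitely many bad pairs are
  put into one operator, and the pair that yields the contradiction is selected only after the
  approximants are fixed.\<close>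

abbreviation mass :: "'a set \<Rightarrow> 'a vec \<Rightarrow> real" where
  "mass D v \<equiv> \<Sum>x\<in>D. (cmod (v x))^2"

lemma sum_norm_mult_le:
  fixes v w :: "'a vec"
  shows "(\<Sum>x\<in>F. cmod (v x) * cmod (w x)) \<le> sqrt (mass F v) * sqrt (mass F w)"
  using L2_set_mult_ineq[of "\<lambda>x. cmod (v x)" "\<lambda>x. cmod (w x)" F] by (simp add: L2_set_def)

lemma norm_sum_mult_le:
  fixes v w :: "'a vec"
  shows "cmod (\<Sum>x\<in>F. v x * w x) \<le> sqrt (mass F v) * sqrt (mass F w)"
proof -
  have "cmod (\<Sum>x\<in>F. v x * w x) \<le> (\<Sum>x\<in>F. cmod (v x) * cmod (w x))"
    by (intro order_trans[OF norm_sum]) (simp add: norm_mult)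
  then show ?thesis using sum_norm_mult_le[of v w F] by linarith
qed

lemma l2norm_nonneg [simp]: "0 \<le> l2norm v"
  by (simp add: l2norm_def infsum_nonneg)

lemma l2norm_sq: "(l2norm v)^2 = (\<Sum>\<^sub>\<infinity>x. (cmod (v x))^2)"
  by (simp add: l2norm_def infsum_nonneg)

lemma l2_sum_le:
  assumes "v \<in> l2" "finite F" shows "mass F v \<le> (l2norm v)^2"
  unfolding l2norm_sq using assms by (intro finite_sum_le_infsum) (auto simp: l2_def)

lemma l2_sqrt_sum_le:
  assumes "v \<in> l2" "finite F" shows "sqrt (mass F v) \<le> l2norm v"
  using l2_sum_le[OF assms] by (simp add: real_le_lsqrt sum_nonneg)

text \<open>The bound has the form \<open>C^2\<close> so that the same estimate on finite sets gives
  membership here and a norm bound in \<open>l2norm_leI\<close>.\<close>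

lemma l2I:
  assumes "\<And>F. finite F \<Longrightarrow> mass F v \<le> C^2" shows "v \<in> l2"
  unfolding l2_def mem_Collect_eq
  by (intro nonneg_bdd_above_summable_on) (auto intro!: bdd_aboveI2[where M="C^2"] assms)

lemma l2norm_leI:
  assumes "v \<in> l2" "0 \<le> C" "\<And>F. finite F \<Longrightarrow> mass F v \<le> C^2" shows "l2norm v \<le> C"
proof -
  have "(l2norm v)^2 \<le> C^2"
    unfolding l2norm_sq using assms by (intro infsum_le_finite_sums) (auto simp: l2_def)
  then show ?thesis using assms(2) by (simp add: power2_le_iff_abs_le)
qed

lemma l2_norm_coord_le: assumes "v \<in> l2" shows "cmod (v x) \<le> l2norm v"
  using l2_sqrt_sum_le[OF assms, of "{x}"] by simp

lemma l2_zero [simp]: "(\<lambda>x. 0) \<in> l2" by (simp add: l2_def)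
lemma l2norm_zero [simp]: "l2norm (\<lambda>x. 0) = 0" by (simp add: l2norm_def)

lemma l2norm_eq_0: assumes "v \<in> l2" "l2norm v = 0" shows "v = (\<lambda>x. 0)"
  using l2_norm_coord_le[OF assms(1)] assms(2) by fastforce

lemma sqrt_sum_add_le:
  fixes v w :: "'a vec"
  shows "sqrt (\<Sum>x\<in>F. (cmod (v x + w x))^2) \<le> sqrt (mass F v) + sqrt (mass F w)"
proof -
  have "sqrt (\<Sum>x\<in>F. (cmod (v x + w x))^2) \<le> sqrt (\<Sum>x\<in>F. (cmod (v x) + cmod (w x))^2)"
    by (intro real_sqrt_le_mono sum_mono power_mono norm_triangle_ineq) auto
  also have "\<dots> \<le> sqrt (mass F v) + sqrt (mass F w)"
    using L2_set_triangle_ineq[of "\<lambda>x. cmod (v x)" "\<lambda>x. cmod (w x)" F] by (simp add: L2_set_def)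
  finally show ?thesis .
qed

lemma l2_add_aux:
  assumes "v \<in> l2" "w \<in> l2" "finite F"
  shows "(\<Sum>x\<in>F. (cmod (v x + w x))^2) \<le> (l2norm v + l2norm w)^2"
proof -
  have "sqrt (\<Sum>x\<in>F. (cmod (v x + w x))^2) \<le> l2norm v + l2norm w"
    using sqrt_sum_add_le[of v w F] l2_sqrt_sum_le[OF assms(1,3)] l2_sqrt_sum_le[OF assms(2,3)] by linarith
  then show ?thesis by (simp add: sqrt_le_D)
qed

lemma l2_add: assumes "v \<in> l2" "w \<in> l2" shows "(\<lambda>x. v x + w x) \<in> l2"
  by (rule l2I[OF l2_add_aux[OF assms]])

lemma l2norm_triangle:
  assumes "v \<in> l2" "w \<in> l2" shows "l2norm (\<lambda>x. v x + w x) \<le> l2norm v + l2norm w"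
  by (rule l2norm_leI[OF l2_add[OF assms] _ l2_add_aux[OF assms]]) auto

lemma l2_scale: assumes "v \<in> l2" shows "(\<lambda>x. c * v x) \<in> l2"
  using summable_on_cmult_right[of "\<lambda>x. (cmod (v x))^2" UNIV "(cmod c)^2"] assms
  by (simp add: l2_def norm_mult power_mult_distrib)

lemma l2norm_scale: "l2norm (\<lambda>x. c * v x) = cmod c * l2norm v"
  by (simp add: l2norm_def norm_mult power_mult_distrib infsum_cmult_right' real_sqrt_mult)

lemma l2_minus: assumes "v \<in> l2" "w \<in> l2" shows "(\<lambda>x. v x - w x) \<in> l2"
  using l2_add[OF assms(1) l2_scale[OF assms(2), of "-1"]] by simp

lemma l2_sum: assumes "\<And>i. i \<in> F \<Longrightarrow> v i \<in> l2" shows "(\<lambda>x. \<Sum>i\<in>F. v i x) \<in> l2"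
  using assms by (induction F rule: infinite_finite_induct) (auto intro: l2_add)

lemma l2_mono:
  assumes "v \<in> l2" "\<And>x. cmod (w x) \<le> cmod (v x)" shows "w \<in> l2" "l2norm w \<le> l2norm v"
proof -
  have *: "mass F w \<le> (l2norm v)^2" if "finite F" for F
    using l2_sum_le[OF assms(1) that] assms(2) by (meson norm_ge_zero order_trans power_mono sum_mono)
  then show "w \<in> l2" by (rule l2I)
  then show "l2norm w \<le> l2norm v" using * by (intro l2norm_leI) auto
qed

lemma l2_mult_bound:
  assumes "v \<in> l2" "w \<in> l2" "finite F"
  shows "(\<Sum>x\<in>F. cmod (v x * w x)) \<le> l2norm v * l2norm w"
proof -
  have "(\<Sum>x\<in>F. cmod (v x * w x)) \<le> sqrt (mass F v) * sqrt (mass F w)"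
    using sum_norm_mult_le[of v w F] by (simp add: norm_mult)
  also have "\<dots> \<le> l2norm v * l2norm w"
    using assms by (intro mult_mono l2_sqrt_sum_le) (auto simp: sum_nonneg)
  finally show ?thesis .
qed

lemma l2_mult_abs_summable:
  assumes "v \<in> l2" "w \<in> l2" shows "(\<lambda>x. cmod (v x * w x)) summable_on S"
  by (intro nonneg_bdd_above_summable_on)
    (auto intro!: bdd_aboveI2[where M="l2norm v * l2norm w"] l2_mult_bound assms)

lemma l2_cnj: assumes "v \<in> l2" shows "(\<lambda>x. cnj (v x)) \<in> l2"
  using assms by (simp add: l2_def)

lemma l2norm_cnj [simp]: "l2norm (\<lambda>x. cnj (v x)) = l2norm v"
  by (simp add: l2norm_def)

lemma l2_inner_summable:
  assumes "v \<in> l2" "w \<in> l2" shows "(\<lambda>x. v x * cnj (w x)) summable_on S"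
  using l2_mult_abs_summable[OF assms(1) l2_cnj[OF assms(2)]] by (rule abs_summable_summable)

lemma l2_CS: assumes "v \<in> l2" "w \<in> l2" shows "cmod (l2inner v w) \<le> l2norm v * l2norm w"
proof -
  have "cmod (l2inner v w) \<le> (\<Sum>\<^sub>\<infinity>x. cmod (v x * cnj (w x)))"
    unfolding l2inner_def by (intro norm_infsum_bound l2_mult_abs_summable assms l2_cnj)
  also have "\<dots> \<le> l2norm v * l2norm w"
    using l2_mult_bound[OF assms(1) l2_cnj[OF assms(2)]] l2_mult_abs_summable[OF assms(1) l2_cnj[OF assms(2)]]
    by (intro infsum_le_finite_sums) auto
  finally show ?thesis .
qed

lemma l2inner_add_left:
  assumes "u \<in> l2" "v \<in> l2" "w \<in> l2"
  shows "l2inner (\<lambda>x. u x + v x) w = l2inner u w + l2inner v w"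
  unfolding l2inner_def using infsum_add[OF l2_inner_summable[OF assms(1,3)] l2_inner_summable[OF assms(2,3)]]
  by (simp add: distrib_right)

lemma l2inner_scale_left: "l2inner (\<lambda>x. c * v x) w = c * l2inner v w"
  by (simp add: l2inner_def infsum_cmult_right' mult.assoc)

lemma l2inner_cnj: "cnj (l2inner v w) = l2inner w v"
  unfolding l2inner_def infsum_cnj[symmetric] by (simp add: mult.commute)

lemma l2inner_add_right:
  assumes "u \<in> l2" "v \<in> l2" "w \<in> l2"
  shows "l2inner w (\<lambda>x. u x + v x) = l2inner w u + l2inner w v"
  by (metis l2inner_add_left[OF assms] complex_cnj_add l2inner_cnj)

lemma l2inner_scale_right: "l2inner v (\<lambda>x. c * w x) = cnj c * l2inner v w"
  by (metis l2inner_scale_left complex_cnj_mult l2inner_cnj)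

lemma l2inner_minus_left:
  assumes "u \<in> l2" "v \<in> l2" "w \<in> l2"
  shows "l2inner (\<lambda>x. u x - v x) w = l2inner u w - l2inner v w"
  using l2inner_add_left[OF assms(1) l2_scale[OF assms(2), of "-1"] assms(3)] l2inner_scale_left[of "-1" v w]
  by simp

lemma l2inner_minus_right:
  assumes "u \<in> l2" "v \<in> l2" "w \<in> l2"
  shows "l2inner w (\<lambda>x. u x - v x) = l2inner w u - l2inner w v"
  by (metis l2inner_minus_left[OF assms] complex_cnj_diff l2inner_cnj)

lemma l2inner_zero [simp]: "l2inner (\<lambda>x. 0) w = 0" "l2inner v (\<lambda>x. 0) = 0"
  by (auto simp: l2inner_def)

lemma l2inner_sum_left:
  assumes "finite F" "\<And>i. i \<in> F \<Longrightarrow> v i \<in> l2" "w \<in> l2"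
  shows "l2inner (\<lambda>x. \<Sum>i\<in>F. v i x) w = (\<Sum>i\<in>F. l2inner (v i) w)"
  using assms(1,2) by (induction) (auto simp: l2inner_add_left l2_sum assms(3))

lemma l2inner_sum_right:
  assumes "finite F" "\<And>i. i \<in> F \<Longrightarrow> v i \<in> l2" "w \<in> l2"
  shows "l2inner w (\<lambda>x. \<Sum>i\<in>F. v i x) = (\<Sum>i\<in>F. l2inner w (v i))"
  using assms(1,2) by (induction) (auto simp: l2inner_add_right l2_sum assms(3))

lemma l2inner_self: "l2inner v v = of_real ((l2norm v)^2)"
proof -
  have "l2inner v v = (\<Sum>\<^sub>\<infinity>x. complex_of_real ((cmod (v x))^2))"
    by (simp only: l2inner_def complex_norm_square)
  also have "\<dots> = of_real (\<Sum>\<^sub>\<infinity>x. (cmod (v x))^2)"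
    by (rule infsum_bounded_linear_strong[OF summable_on_bounded_linear_iff[OF bounded_linear_of_real bounded_linear_Re] bounded_linear_of_real]) simp
  finally show ?thesis by (simp add: l2norm_sq)
qed

lemma l2_finite_support:
  assumes "finite F" "\<And>x. x \<notin> F \<Longrightarrow> v x = 0"
  shows "v \<in> l2" and "(l2norm v)^2 = mass F v"
    and "l2inner v w = (\<Sum>x\<in>F. v x * cnj (w x))" and "l2inner w v = (\<Sum>x\<in>F. w x * cnj (v x))"
proof -
  have "(\<lambda>x. (cmod (v x))^2) summable_on UNIV \<longleftrightarrow> (\<lambda>x. (cmod (v x))^2) summable_on F"
    by (rule summable_on_cong_neutral) (auto simp: assms)
  then show "v \<in> l2" by (simp add: l2_def assms)
  have "(\<Sum>\<^sub>\<infinity>x. (cmod (v x))^2) = (\<Sum>\<^sub>\<infinity>x\<in>F. (cmod (v x))^2)"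
    by (rule infsum_cong_neutral) (auto simp: assms)
  then show "(l2norm v)^2 = mass F v" by (simp add: assms l2norm_sq)
  have "(\<Sum>\<^sub>\<infinity>x. v x * cnj (w x)) = (\<Sum>\<^sub>\<infinity>x\<in>F. v x * cnj (w x))"
    by (rule infsum_cong_neutral) (auto simp: assms)
  then show "l2inner v w = (\<Sum>x\<in>F. v x * cnj (w x))" by (simp add: assms l2inner_def)
  have "(\<Sum>\<^sub>\<infinity>x. w x * cnj (v x)) = (\<Sum>\<^sub>\<infinity>x\<in>F. w x * cnj (v x))"
    by (rule infsum_cong_neutral) (auto simp: assms)
  then show "l2inner w v = (\<Sum>x\<in>F. w x * cnj (v x))" by (simp add: assms l2inner_def)
qed

lemma l2norm_finite_support:
  assumes "finite F" "\<And>x. x \<notin> F \<Longrightarrow> v x = 0"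
  shows "l2norm v = sqrt (mass F v)"
  by (subst l2_finite_support(2)[OF assms, symmetric]) simp_all

lemma delta_l2 [simp]: "delta x \<in> l2"
  by (rule l2_finite_support(1)[of "{x}"]) (auto simp: delta_def)

lemma l2norm_delta [simp]: "l2norm (delta x) = 1"
  by (subst l2norm_finite_support[of "{x}"]) (auto simp: delta_def)

lemma l2inner_delta [simp]: "l2inner v (delta x) = v x" "l2inner (delta x) v = cnj (v x)"
  using l2_finite_support(3,4)[of "{x}" "delta x" v] by (auto simp: delta_def)

lemma entry_eq: "entry a x y = a (delta x) y"
  by (simp add: entry_def)

lemma l2_truncate_le:
  assumes "v \<in> l2" shows "(\<lambda>x. if x \<in> D then v x else 0) \<in> l2"
    "l2norm (\<lambda>x. if x \<in> D then v x else 0) \<le> l2norm v"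
  by (rule l2_mono[OF assms]; simp)+

lemma l2_approx_sq:
  assumes "v \<in> l2" "0 < e"
  obtains D where "finite D" "\<And>D'. finite D' \<Longrightarrow> D \<subseteq> D' \<Longrightarrow> (l2norm v)^2 - (mass D' v) \<le> e"
proof -
  have "(\<lambda>x. (cmod (v x))^2) summable_on UNIV" using assms(1) by (simp add: l2_def)
  from infsum_finite_approximation[OF this assms(2)] obtain D where
    D: "finite D" "dist (mass D v) (\<Sum>\<^sub>\<infinity>x. (cmod (v x))^2) \<le> e" by auto
  have "(l2norm v)^2 - (mass D' v) \<le> e" if "finite D'" "D \<subseteq> D'" for D'
  proof -
    have "mass D v \<le> mass D' v" using that by (intro sum_mono2) auto
    moreover have "(l2norm v)^2 - (mass D v) \<le> e"
      using D(2) unfolding l2norm_sq dist_real_def by linarith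
    ultimately show ?thesis by linarith
  qed
  with D(1) that show ?thesis by blast
qed

lemma l2norm_restrict_compl:
  assumes "v \<in> l2" "finite D"
  shows "(l2norm (\<lambda>x. v x - (if x \<in> D then v x else 0)))^2 = (l2norm v)^2 - (mass D v)"
proof -
  have s: "(\<lambda>x. (cmod (v x))^2) summable_on UNIV" using assms(1) by (simp add: l2_def)
  have "(\<Sum>\<^sub>\<infinity>x. (cmod (v x))^2) = (\<Sum>\<^sub>\<infinity>x\<in>D \<union> -D. (cmod (v x))^2)" by simp
  also have "\<dots> = (\<Sum>\<^sub>\<infinity>x\<in>D. (cmod (v x))^2) + (\<Sum>\<^sub>\<infinity>x\<in>-D. (cmod (v x))^2)"
    by (rule infsum_Un_disjoint) (auto intro: summable_on_subset_banach[OF s])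
  also have "(\<Sum>\<^sub>\<infinity>x\<in>-D. (cmod (v x))^2) = (\<Sum>\<^sub>\<infinity>x. (cmod (v x - (if x \<in> D then v x else 0)))^2)"
    by (rule infsum_cong_neutral) auto
  finally show ?thesis using assms(2) by (simp add: l2norm_sq)
qed

lemma l2_approx:
  assumes "v \<in> l2" "0 < e"
  obtains D where "finite D" "l2norm (\<lambda>x. v x - (if x \<in> D then v x else 0)) \<le> e"
proof -
  obtain D where D: "finite D" "(l2norm v)^2 - (mass D v) \<le> e^2"
    using l2_approx_sq[OF assms(1), of "e^2"] assms(2) by (metis order_refl zero_less_power)
  then have "l2norm (\<lambda>x. v x - (if x \<in> D then v x else 0)) \<le> e"
    unfolding l2norm_restrict_compl[OF assms(1) D(1), symmetric]
    using assms(2) by (metis less_imp_le power2_le_imp_le)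
  then show ?thesis using D(1) that by blast
qed

section \<open>Bounded operators\<close>

lemma bounded_opI:
  assumes "\<And>v. v \<in> l2 \<Longrightarrow> a v \<in> l2"
    and "\<And>v w. v \<in> l2 \<Longrightarrow> w \<in> l2 \<Longrightarrow> a (\<lambda>x. v x + w x) = (\<lambda>x. a v x + a w x)"
    and "\<And>v c. v \<in> l2 \<Longrightarrow> a (\<lambda>x. c * v x) = (\<lambda>x. c * a v x)"
    and "\<And>v. v \<notin> l2 \<Longrightarrow> a v = (\<lambda>x. 0)"
    and "\<And>v. v \<in> l2 \<Longrightarrow> l2norm (a v) \<le> C * l2norm v"
  shows "bounded_op a"
  unfolding bounded_op_def using assms by blast

lemma bop_l2 [simp]: "bounded_op a \<Longrightarrow> a v \<in> l2"
  unfolding bounded_op_def by (metis l2_zero)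

lemma bop_outside: "bounded_op a \<Longrightarrow> v \<notin> l2 \<Longrightarrow> a v = (\<lambda>x. 0)"
  unfolding bounded_op_def by blast

lemma bop_add:
  "bounded_op a \<Longrightarrow> v \<in> l2 \<Longrightarrow> w \<in> l2 \<Longrightarrow> a (\<lambda>x. v x + w x) = (\<lambda>x. a v x + a w x)"
  unfolding bounded_op_def by blast

lemma bop_scale: "bounded_op a \<Longrightarrow> v \<in> l2 \<Longrightarrow> a (\<lambda>x. c * v x) = (\<lambda>x. c * a v x)"
  unfolding bounded_op_def by blast

lemma bop_zero [simp]: "bounded_op a \<Longrightarrow> a (\<lambda>x. 0) = (\<lambda>x. 0)"
  using bop_scale[of a "\<lambda>x. 0" 0] by simp

lemma bop_minus:
  "bounded_op a \<Longrightarrow> v \<in> l2 \<Longrightarrow> w \<in> l2 \<Longrightarrow> a (\<lambda>x. v x - w x) = (\<lambda>x. a v x - a w x)"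
  using bop_add[of a v "\<lambda>x. -1 * w x"] bop_scale[of a w "-1"] l2_scale[of w "-1"] by simp

lemma bop_bound: assumes "bounded_op a"
  obtains C where "0 \<le> C" "\<And>v. v \<in> l2 \<Longrightarrow> l2norm (a v) \<le> C * l2norm v"
proof -
  obtain C where C: "\<forall>v\<in>l2. l2norm (a v) \<le> C * l2norm v" using assms unfolding bounded_op_def by blast
  have "l2norm (a v) \<le> max C 0 * l2norm v" if "v \<in> l2" for v
  proof -
    have "C * l2norm v \<le> max C 0 * l2norm v" by (intro mult_right_mono) auto
    then show ?thesis using C that by fastforce
  qed
  then show ?thesis using that[of "max C 0"] by simp
qed

lemma opnorm_ge:
  assumes "bounded_op a" "v \<in> l2" "l2norm v \<le> 1" shows "l2norm (a v) \<le> opnorm a"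
proof -
  obtain C where C: "0 \<le> C" "\<And>v. v \<in> l2 \<Longrightarrow> l2norm (a v) \<le> C * l2norm v" using bop_bound[OF assms(1)] by metis
  have "l2norm (a u) \<le> C" if "u \<in> l2" "l2norm u \<le> 1" for u
    using C(2)[OF that(1)] mult_left_mono[OF that(2) C(1)] by simp
  then have "bdd_above {l2norm (a v) | v. v \<in> l2 \<and> l2norm v \<le> 1}" by (intro bdd_aboveI[of _ C]) auto
  then show ?thesis unfolding opnorm_def using assms by (intro cSup_upper) auto
qed

lemma opnorm_nonneg: assumes "bounded_op a" shows "0 \<le> opnorm a"
  using opnorm_ge[OF assms l2_zero] assms by simp

lemma opnorm_bound:
  assumes "bounded_op a" "v \<in> l2" shows "l2norm (a v) \<le> opnorm a * l2norm v"
proof (cases "l2norm v = 0")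
  case True
  then have "v = (\<lambda>x. 0)" using l2norm_eq_0 assms(2) by blast
  then show ?thesis using assms(1) by simp
next
  case False
  then have pos: "0 < l2norm v" using l2norm_nonneg[of v] by linarith
  define c where "c = complex_of_real (1 / l2norm v)"
  have c: "cmod c = 1 / l2norm v" using pos by (simp add: c_def norm_divide)
  define u where "u = (\<lambda>x. c * v x)"
  have u: "u \<in> l2" "l2norm u = 1" unfolding u_def using assms(2) pos c by (auto simp only: l2_scale l2norm_scale) simp
  have "l2norm (a u) \<le> opnorm a" using opnorm_ge[OF assms(1) u(1)] u(2) by simp
  moreover have "l2norm (a u) = l2norm (a v) / l2norm v"
    unfolding u_def bop_scale[OF assms(1,2)] l2norm_scale c by simp
  ultimately show ?thesis using pos by (simp add: field_simps)
qed

lemma opnorm_leI: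
  assumes "0 \<le> C" "\<And>v. v \<in> l2 \<Longrightarrow> l2norm (a v) \<le> C * l2norm v" shows "opnorm a \<le> C"
  unfolding opnorm_def
proof (rule cSup_least)
  show "{l2norm (a v) |v. v \<in> l2 \<and> l2norm v \<le> 1} \<noteq> {}"
    using l2_zero l2norm_zero by (metis (mono_tags, lifting) empty_Collect_eq zero_le_one)
next
  fix r assume "r \<in> {l2norm (a v) |v. v \<in> l2 \<and> l2norm v \<le> 1}"
  then obtain v where v: "v \<in> l2" "l2norm v \<le> 1" "r = l2norm (a v)" by blast
  then show "r \<le> C" using assms(2)[OF v(1)] mult_left_mono[OF v(2) assms(1)] by simp
qed

lemma bounded_op_zero [simp]: "bounded_op op_zero"
  by (rule bounded_opI[where C=0]) (auto simp: op_zero_def)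

lemma op_add_norm:
  assumes "bounded_op a" "bounded_op b" "v \<in> l2"
  shows "l2norm (op_add a b v) \<le> (opnorm a + opnorm b) * l2norm v"
  using l2norm_triangle[of "a v" "b v"] opnorm_bound[OF assms(1,3)] opnorm_bound[OF assms(2,3)] assms
  by (simp add: op_add_def distrib_right)

lemma op_scale_norm:
  assumes "bounded_op a" "v \<in> l2" shows "l2norm (op_scale c a v) \<le> (cmod c * opnorm a) * l2norm v"
  using mult_left_mono[OF opnorm_bound[OF assms], of "cmod c"] by (simp add: op_scale_def l2norm_scale mult.assoc)

lemma op_mult_norm:
  assumes "bounded_op a" "bounded_op b" "v \<in> l2"
  shows "l2norm (op_mult a b v) \<le> (opnorm a * opnorm b) * l2norm v"
  using opnorm_bound[OF assms(1), of "b v"] assms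
    mult_left_mono[OF opnorm_bound[OF assms(2,3)] opnorm_nonneg[OF assms(1)]]
  by (simp add: op_mult_def mult.assoc)

lemma bounded_op_add [simp]: assumes "bounded_op a" "bounded_op b" shows "bounded_op (op_add a b)"
  by (rule bounded_opI[OF _ _ _ _ op_add_norm[OF assms]])
    (use assms in \<open>auto simp: op_add_def l2_add bop_add bop_scale bop_outside algebra_simps\<close>)

lemma bounded_op_scale [simp]: assumes "bounded_op a" shows "bounded_op (op_scale c a)"
  by (rule bounded_opI[OF _ _ _ _ op_scale_norm[OF assms]])
    (use assms in \<open>auto simp: op_scale_def l2_scale bop_add bop_scale bop_outside algebra_simps\<close>)

lemma op_minus_eq: "op_minus a b = op_add a (op_scale (-1) b)"
  by (simp add: op_minus_def op_add_def op_scale_def)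

lemma bounded_op_minus [simp]: "bounded_op a \<Longrightarrow> bounded_op b \<Longrightarrow> bounded_op (op_minus a b)"
  by (simp add: op_minus_eq)

lemma bounded_op_mult [simp]: assumes "bounded_op a" "bounded_op b" shows "bounded_op (op_mult a b)"
  by (rule bounded_opI[OF _ _ _ _ op_mult_norm[OF assms]])
    (use assms in \<open>auto simp: op_mult_def bop_add bop_scale bop_outside\<close>)

lemma opnorm_mult_le:
  assumes "bounded_op a" "bounded_op b" shows "opnorm (op_mult a b) \<le> opnorm a * opnorm b"
  by (rule opnorm_leI[OF _ op_mult_norm[OF assms]]) (use assms in \<open>simp add: opnorm_nonneg\<close>)

lemma opnorm_add_le:
  assumes "bounded_op a" "bounded_op b" shows "opnorm (op_add a b) \<le> opnorm a + opnorm b"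
  by (rule opnorm_leI[OF _ op_add_norm[OF assms]]) (use assms in \<open>simp add: opnorm_nonneg\<close>)

lemma opnorm_scale_le:
  assumes "bounded_op a" shows "opnorm (op_scale c a) \<le> cmod c * opnorm a"
  by (rule opnorm_leI[OF _ op_scale_norm[OF assms]]) (use assms in \<open>simp add: opnorm_nonneg\<close>)

lemma entry_le_opnorm: assumes "bounded_op a" shows "cmod (entry a x y) \<le> opnorm a"
  using l2_norm_coord_le[of "a (delta x)" y] opnorm_bound[OF assms, of "delta x"] assms
  by (simp add: entry_eq)

section \<open>Adjoints and matrix entries\<close>

lemma l2_eq_via_inner:
  assumes "\<And>x. l2inner (delta x) v = l2inner (delta x) w" shows "v = w"
proof
  fix x show "v x = w x" using assms[of x] by simp
qed

text \<open>The candidate is given by its coordinates, the inner products of \<open>w\<close> with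
  \<open>a (delta x)\<close>; the adjoint identity is immediate for finitely supported
  \<open>v\<close> and extends by density. Domain and codomain have different index types because
  the lemma also produces the synthesis map of an orthonormal family, as the adjoint of the map
  taking a vector to its coefficients.\<close>

lemma adjoint_exists:
  fixes a :: "'a vec \<Rightarrow> 'b vec"
  assumes al2: "\<And>v. v \<in> l2 \<Longrightarrow> a v \<in> l2"
    and add: "\<And>v w. v \<in> l2 \<Longrightarrow> w \<in> l2 \<Longrightarrow> a (\<lambda>x. v x + w x) = (\<lambda>x. a v x + a w x)"
    and scale: "\<And>v c. v \<in> l2 \<Longrightarrow> a (\<lambda>x. c * v x) = (\<lambda>x. c * a v x)"
    and C: "0 \<le> C" "\<And>v. v \<in> l2 \<Longrightarrow> l2norm (a v) \<le> C * l2norm v"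
  shows "\<exists>b. (\<forall>w\<in>l2. b w \<in> l2 \<and> l2norm (b w) \<le> C * l2norm w) \<and> (\<forall>w. w \<notin> l2 \<longrightarrow> b w = (\<lambda>x. 0)) \<and>
    (\<forall>v\<in>l2. \<forall>w\<in>l2. l2inner (a v) w = l2inner v (b w))"
proof -
  have zero: "a (\<lambda>x. 0) = (\<lambda>x. 0)" using scale[OF l2_zero, of 0] by simp
  have asum: "a (\<lambda>x. \<Sum>i\<in>F. v i x) = (\<lambda>x. \<Sum>i\<in>F. a (v i) x)" if "finite F" "\<And>i. v i \<in> l2"
    for F :: "'a set" and v :: "'a \<Rightarrow> 'a vec"
    using that(1)
  proof (induction F)
    case (insert i F)
    then show ?case using add[of "v i" "\<lambda>x. \<Sum>i\<in>F. v i x"] l2_sum[of F v] that(2) by simp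
  qed (simp add: zero)
  have aminus: "a (\<lambda>x. v x - w x) = (\<lambda>x. a v x - a w x)" if "v \<in> l2" "w \<in> l2" for v w
    using add[of v "\<lambda>x. -1 * w x"] scale[of w "-1"] l2_scale[of w "-1"] that by simp
  define b where "b = (\<lambda>w. if w \<in> l2 then (\<lambda>x. l2inner w (a (delta x))) else (\<lambda>x. 0))"
  have fs: "l2inner w (a (\<lambda>z. if z \<in> F then u z else 0)) = (\<Sum>x\<in>F. cnj (u x) * b w x)"
    if "finite F" "w \<in> l2" for F u w
  proof -
    have eq: "(\<lambda>z. if z \<in> F then u z else 0) = (\<lambda>z. \<Sum>x\<in>F. u x * delta x z)"
    proof
      fix z
      have "(\<Sum>x\<in>F. u x * delta x z) = (\<Sum>x\<in>F. if x = z then u x else 0)"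
        by (intro sum.cong) (auto simp: delta_def)
      then show "(if z \<in> F then u z else 0) = (\<Sum>x\<in>F. u x * delta x z)" using that(1) by simp
    qed
    show ?thesis unfolding eq
      by (subst asum) (auto simp: l2_scale scale l2inner_sum_right that l2inner_scale_right al2 b_def)
  qed
  have bd: "(\<Sum>x\<in>F. (cmod (b w x))^2) \<le> (C * l2norm w)^2" if F: "finite F" and w: "w \<in> l2" for F w
  proof -
    \<comment> \<open>Testing \<open>a\<close> on the truncation of \<open>b w\<close> itself gives
      \<open>(l2norm u)^2\<close> as an inner product of \<open>w\<close> with \<open>a u\<close>;
      one factor \<open>l2norm u\<close> then cancels.\<close>
    define u where "u = (\<lambda>z. if z \<in> F then b w z else 0)"
    have u: "u \<in> l2" "(l2norm u)^2 = (\<Sum>x\<in>F. (cmod (b w x))^2)"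
      using l2_finite_support(1,2)[of F u] F by (auto simp: u_def)
    have "of_real ((l2norm u)^2) = (\<Sum>x\<in>F. cnj (b w x) * b w x)"
      unfolding u(2) of_real_sum complex_norm_square by (simp add: mult.commute)
    also have "\<dots> = l2inner w (a u)" using fs[OF F w, of "b w"] by (simp add: u_def)
    finally have "cmod (of_real ((l2norm u)^2)) = cmod (l2inner w (a u))" by (rule arg_cong)
    then have "(l2norm u)^2 = cmod (l2inner w (a u))" by (simp only: norm_of_real abs_power2)
    also have "\<dots> \<le> l2norm w * l2norm (a u)" by (intro l2_CS w al2 u)
    also have "\<dots> \<le> l2norm w * (C * l2norm u)" by (intro mult_left_mono C u) simp
    finally have *: "l2norm u * l2norm u \<le> (C * l2norm w) * l2norm u"
      by (simp add: power2_eq_square mult_ac)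
    have "l2norm u \<le> C * l2norm w"
    proof (cases "l2norm u = 0")
      case True then show ?thesis using C(1) by simp
    next
      case False then show ?thesis using l2norm_nonneg[of u] by (intro mult_right_le_imp_le[OF *]) linarith
    qed
    then show ?thesis unfolding u(2)[symmetric] by (intro power_mono) auto
  qed
  have bl2: "b w \<in> l2" if "w \<in> l2" for w using bd[OF _ that] by (rule l2I)
  have bbd: "l2norm (b w) \<le> C * l2norm w" if w: "w \<in> l2" for w
    using bd[OF _ w] C(1) by (intro l2norm_leI bl2 w) auto
  have adj: "l2inner (a v) w = l2inner v (b w)" if v: "v \<in> l2" and w: "w \<in> l2" for v w
  proof -
    have small: "cmod (l2inner (a v) w - l2inner v (b w)) \<le> e" if e: "e > 0" for e
    proof -
      \<comment> \<open>Replacing \<open>v\<close> by a truncation costs \<open>C * l2norm w\<close>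
        on one side and \<open>l2norm (b w)\<close> on the other, per unit of error; the 1 keeps the
        divisor positive.\<close>
      define K where "K = C * l2norm w + l2norm (b w) + 1"
      have K: "K > 0" using C(1) unfolding K_def by (simp add: add_nonneg_pos)
      obtain F where F: "finite F" "l2norm (\<lambda>x. v x - (if x \<in> F then v x else 0)) \<le> e / K"
        using l2_approx[OF v, of "e/K"] e K by auto
      define u where "u = (\<lambda>x. if x \<in> F then v x else 0)"
      define d where "d = (\<lambda>x. v x - u x)"
      have u: "u \<in> l2" unfolding u_def by (rule l2_truncate_le[OF v])
      have d: "d \<in> l2" unfolding d_def by (rule l2_minus[OF v u])
      have "cnj (l2inner (a u) w) = cnj (l2inner u (b w))"
        using fs[OF F(1) w, of v] l2_finite_support(4)[OF F(1), of u "b w"]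
        by (simp add: l2inner_cnj u_def mult.commute)
      then have "l2inner (a u) w = l2inner u (b w)" by (metis complex_cnj_cnj)
      moreover have "l2inner (a d) w = l2inner (a v) w - l2inner (a u) w"
        unfolding d_def by (simp add: aminus al2 u v l2inner_minus_left w)
      moreover have "l2inner d (b w) = l2inner v (b w) - l2inner u (b w)"
        unfolding d_def by (simp add: u v l2inner_minus_left bl2 w)
      ultimately have "cmod (l2inner (a v) w - l2inner v (b w)) = cmod (l2inner (a d) w - l2inner d (b w))" by simp
      also have "\<dots> \<le> cmod (l2inner (a d) w) + cmod (l2inner d (b w))" by (rule norm_triangle_ineq4)
      also have "\<dots> \<le> l2norm (a d) * l2norm w + l2norm d * l2norm (b w)"
        by (intro add_mono l2_CS) (auto simp: al2 d w bl2)
      also have "\<dots> \<le> (C * l2norm d) * l2norm w + l2norm d * l2norm (b w)"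
        by (intro add_mono mult_right_mono C d) auto
      also have "\<dots> \<le> l2norm d * K" unfolding K_def by (simp add: algebra_simps)
      also have "\<dots> \<le> (e / K) * K" using F(2) K unfolding d_def u_def by (intro mult_right_mono) auto
      finally show ?thesis using K by simp
    qed
    have "cmod (l2inner (a v) w - l2inner v (b w)) \<le> 0"
      by (rule field_le_epsilon) (metis add_0 small)
    then show ?thesis by simp
  qed
  show ?thesis using bl2 bbd adj by (intro exI[of _ b]) (simp add: b_def)
qed

lemma op_adj_unique:
  assumes "bounded_op b" "\<And>v w. v \<in> l2 \<Longrightarrow> w \<in> l2 \<Longrightarrow> l2inner (a v) w = l2inner v (b w)"
  shows "op_adj a = b"
  unfolding op_adj_def
proof (rule the_equality)
  fix c assume c: "bounded_op c \<and> (\<forall>v\<in>l2. \<forall>w\<in>l2. l2inner (a v) w = l2inner v (c w))"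
  show "c = b"
  proof
    fix w show "c w = b w"
    proof (cases "w \<in> l2")
      case True
      then show ?thesis using c assms by (intro l2_eq_via_inner) (metis delta_l2)
    qed (use c assms in \<open>simp add: bop_outside\<close>)
  qed
qed (use assms in blast)

lemma op_adj:
  fixes a :: "'a op"
  assumes "bounded_op a"
  shows "bounded_op (op_adj a)" "\<And>v w. v \<in> l2 \<Longrightarrow> w \<in> l2 \<Longrightarrow> l2inner (a v) w = l2inner v (op_adj a w)"
proof -
  have "\<exists>b. (\<forall>w\<in>l2. b w \<in> l2 \<and> l2norm (b w) \<le> opnorm a * l2norm w) \<and> (\<forall>w. w \<notin> l2 \<longrightarrow> b w = (\<lambda>x. 0)) \<and>
    (\<forall>v\<in>l2. \<forall>w\<in>l2. l2inner (a v) w = l2inner v (b w))"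
    by (rule adjoint_exists) (auto simp: assms bop_add bop_scale opnorm_nonneg opnorm_bound)
  then obtain b where b0: "\<And>w. w \<in> l2 \<Longrightarrow> b w \<in> l2" "\<And>w. w \<notin> l2 \<Longrightarrow> b w = (\<lambda>x. 0)"
    "\<And>w. w \<in> l2 \<Longrightarrow> l2norm (b w) \<le> opnorm a * l2norm w"
    and badj: "\<And>v w. v \<in> l2 \<Longrightarrow> w \<in> l2 \<Longrightarrow> l2inner (a v) w = l2inner v (b w)" by (elim exE conjE) auto
  have bb: "bounded_op b"
  proof (rule bounded_opI[where C="opnorm a"])
    fix v w :: "'a vec" assume "v \<in> l2" "w \<in> l2"
    then show "b (\<lambda>x. v x + w x) = (\<lambda>x. b v x + b w x)"
      by (intro l2_eq_via_inner) (simp only: badj[symmetric] l2inner_add_right l2_add delta_l2 bop_l2[OF assms] b0(1))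
  next
    fix v :: "'a vec" and c assume "v \<in> l2"
    then show "b (\<lambda>x. c * v x) = (\<lambda>x. c * b v x)"
      by (intro l2_eq_via_inner) (simp only: badj[symmetric] l2inner_scale_right l2_scale delta_l2)
  qed (use b0 in auto)
  note b = bb badj
  from b have "op_adj a = b" by (rule op_adj_unique)
  then show "bounded_op (op_adj a)" "\<And>v w. v \<in> l2 \<Longrightarrow> w \<in> l2 \<Longrightarrow> l2inner (a v) w = l2inner v (op_adj a w)"
    using b by auto
qed

lemma bop_eqI:
  assumes "bounded_op a" "bounded_op b" "\<And>v. v \<in> l2 \<Longrightarrow> a v = b v" shows "a = b"
  using assms by (metis bop_outside ext)

text \<open>The numbers \<open>entry a z y\<close> for fixed \<open>y\<close> are the conjugated
  coordinates of \<open>op_adj a (delta y)\<close>, hence square-summable in \<open>z\<close>. So a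
  bounded operator is determined by its matrix, with absolutely convergent sums.\<close>

lemma bop_expand:
  assumes "bounded_op a" "v \<in> l2"
  shows "a v y = (\<Sum>\<^sub>\<infinity>z. v z * entry a z y)" "(\<lambda>z. cmod (v z * entry a z y)) summable_on UNIV"
proof -
  have e: "cnj (op_adj a (delta y) z) = entry a z y" for z
    using op_adj(2)[OF assms(1), of "delta z" "delta y"] by (simp add: entry_eq)
  have "a v y = l2inner v (op_adj a (delta y))"
    using op_adj(2)[OF assms, of "delta y"] by simp
  then show "a v y = (\<Sum>\<^sub>\<infinity>z. v z * entry a z y)" by (simp add: l2inner_def e)
  show "(\<lambda>z. cmod (v z * entry a z y)) summable_on UNIV"
    using l2_mult_abs_summable[OF assms(2) l2_cnj[OF bop_l2[OF op_adj(1)[OF assms(1)], of "delta y"]]]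
    by (simp add: e)
qed

lemma bop_eq_deltaI:
  fixes a b :: "'a op"
  assumes "bounded_op a" "bounded_op b" "\<And>x. a (delta x) = b (delta x)" shows "a = b"
proof (rule bop_eqI[OF assms(1,2)])
  fix v :: "'a vec" assume v: "v \<in> l2"
  show "a v = b v"
  proof
    fix y show "a v y = b v y"
      unfolding bop_expand(1)[OF assms(1) v] bop_expand(1)[OF assms(2) v] entry_eq assms(3) ..
  qed
qed

section \<open>Partial translations and the uniform Roe algebra\<close>

text \<open>Partial translations are kept as graphs: converse and relational composition then give
  adjoints and products, and subsets of a graph give the restrictions over which the category
  argument runs.\<close>

definition pinj :: "('a \<times> 'b) set \<Rightarrow> bool" where
  "pinj G \<longleftrightarrow> inj_on fst G \<and> inj_on snd G"

definition trans_op :: "('a \<times> 'a) set \<Rightarrow> 'a op" where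
  "trans_op G = (\<lambda>v. if v \<in> l2 then (\<lambda>y. if y \<in> snd ` G then v (fst (inv_into G snd y)) else 0) else (\<lambda>y. 0))"

lemma trans_op_apply:
  assumes "pinj G" "v \<in> l2" "(x, y) \<in> G" shows "trans_op G v y = v x"
proof -
  have "inv_into G snd y = (x, y)" using inv_into_f_f[of snd G "(x, y)"] assms by (auto simp: pinj_def)
  then show ?thesis using assms by (force simp: trans_op_def)
qed

lemma trans_op_outside: "y \<notin> snd ` G \<Longrightarrow> trans_op G v y = 0"
  by (auto simp: trans_op_def)

lemma trans_op_mass:
  assumes "pinj G" "v \<in> l2" "finite F"
  shows "(\<Sum>y\<in>F. (cmod (trans_op G v y))^2) \<le> (l2norm v)^2"
proof -
  define H where "H = {z \<in> G. snd z \<in> F}"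
  have inj: "inj_on fst H" "inj_on snd H" using assms(1) by (auto simp: H_def pinj_def inj_on_def)
  have im: "snd ` H = F \<inter> snd ` G" by (auto simp: H_def)
  then have fin: "finite H" using assms(3) inj(2) by (metis finite_Int finite_imageD)
  have "(\<Sum>y\<in>F. (cmod (trans_op G v y))^2) = (\<Sum>y\<in>snd ` H. (cmod (trans_op G v y))^2)"
    unfolding im using assms(3) by (intro sum.mono_neutral_right) (auto simp: trans_op_outside)
  also have "\<dots> = (\<Sum>z\<in>H. (cmod (v (fst z)))^2)"
    using trans_op_apply[OF assms(1,2)] by (subst sum.reindex[OF inj(2)]) (auto simp: H_def intro!: sum.cong)
  also have "\<dots> = (\<Sum>x\<in>fst ` H. (cmod (v x))^2)" by (subst sum.reindex[OF inj(1)]) simp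
  also have "\<dots> \<le> (l2norm v)^2" using fin by (intro l2_sum_le assms) auto
  finally show ?thesis .
qed

lemma trans_op_l2 [simp]: assumes "pinj G" shows "trans_op G v \<in> l2"
proof (cases "v \<in> l2")
  case True then show ?thesis using trans_op_mass[OF assms] by (intro l2I)
qed (simp add: trans_op_def)

lemma trans_op_norm: assumes "pinj G" "v \<in> l2" shows "l2norm (trans_op G v) \<le> l2norm v"
  using trans_op_mass[OF assms] by (intro l2norm_leI) (auto simp: assms)

lemma bounded_trans_op [simp]: assumes "pinj G" shows "bounded_op (trans_op G)"
proof (rule bounded_opI[where C=1])
  fix v :: "'a vec" assume "v \<in> l2"
  then show "l2norm (trans_op G v) \<le> 1 * l2norm v" using trans_op_norm[OF assms] by simp
qed (simp add: assms, auto simp: trans_op_def l2_add l2_scale)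

lemma trans_op_inner:
  assumes "pinj G" "v \<in> l2" "w \<in> l2"
  shows "l2inner (trans_op G v) w = (\<Sum>\<^sub>\<infinity>z\<in>G. v (fst z) * cnj (w (snd z)))"
proof -
  have "l2inner (trans_op G v) w = (\<Sum>\<^sub>\<infinity>y\<in>snd ` G. trans_op G v y * cnj (w y))"
    unfolding l2inner_def by (rule infsum_cong_neutral) (auto simp: trans_op_outside)
  also have "\<dots> = (\<Sum>\<^sub>\<infinity>z\<in>G. trans_op G v (snd z) * cnj (w (snd z)))"
    using infsum_reindex[of snd G "\<lambda>y. trans_op G v y * cnj (w y)"] assms(1) by (simp add: pinj_def o_def)
  also have "\<dots> = (\<Sum>\<^sub>\<infinity>z\<in>G. v (fst z) * cnj (w (snd z)))"
    using trans_op_apply[OF assms(1,2)] by (intro infsum_cong) auto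
  finally show ?thesis .
qed

text \<open>Absolute convergence is what allows the sum over a graph to be split along arbitrary
  subsets.\<close>

lemma pinj_summable:
  fixes G :: "('a \<times> 'a) set"
  assumes "pinj G" "v \<in> l2" "w \<in> l2"
  shows "(\<lambda>z. cmod (v (fst z) * w (snd z))) summable_on G"
proof -
  have "(\<lambda>y. cmod (trans_op G v y * w y)) summable_on snd ` G"
    by (intro l2_mult_abs_summable assms) (simp add: assms)
  then have "(\<lambda>z. cmod (trans_op G v (snd z) * w (snd z))) summable_on G"
    using summable_on_reindex[of snd G "\<lambda>y. cmod (trans_op G v y * w y)"] assms(1) by (simp add: pinj_def o_def)
  then show ?thesis
    by (rule summable_on_cong[THEN iffD1, rotated]) (use trans_op_apply[OF assms(1,2)] in auto)
qed

lemma pinj_converse: "pinj G \<Longrightarrow> pinj (G\<inverse>)"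
  unfolding pinj_def inj_on_def by force

lemma trans_op_adjoint:
  assumes "pinj G" "v \<in> l2" "w \<in> l2"
  shows "l2inner (trans_op G v) w = l2inner v (trans_op (G\<inverse>) w)"
proof -
  have "l2inner v (trans_op (G\<inverse>) w) = cnj (l2inner (trans_op (G\<inverse>) w) v)" by (simp add: l2inner_cnj)
  also have "\<dots> = (\<Sum>\<^sub>\<infinity>z\<in>G\<inverse>. cnj (w (fst z)) * v (snd z))"
    unfolding trans_op_inner[OF pinj_converse[OF assms(1)] assms(3,2)] infsum_cnj[symmetric] by simp
  also have "\<dots> = (\<Sum>\<^sub>\<infinity>z\<in>prod.swap ` G. cnj (w (fst z)) * v (snd z))"
    by (rule arg_cong[where f="infsum _"]) auto
  also have "\<dots> = (\<Sum>\<^sub>\<infinity>z\<in>G. v (fst z) * cnj (w (snd z)))"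
    by (subst infsum_reindex) (auto simp: o_def mult.commute)
  finally show ?thesis using trans_op_inner[OF assms] by simp
qed

lemma op_adj_trans_op: assumes "pinj G" shows "op_adj (trans_op G) = trans_op (G\<inverse>)"
  using assms by (intro op_adj_unique trans_op_adjoint) (auto simp: pinj_converse)

lemma trans_op_delta:
  assumes "pinj G" "(x, y) \<in> G" shows "trans_op G (delta x) = delta y"
proof
  fix z
  show "trans_op G (delta x) z = delta y z"
  proof (cases "z \<in> snd ` G")
    case True
    then obtain u where u: "(u, z) \<in> G" by auto
    then have "u = x \<longleftrightarrow> z = y" using assms by (force simp: pinj_def inj_on_def)
    then show ?thesis using trans_op_apply[OF assms(1) delta_l2 u] by (auto simp: delta_def)
  next
    case False
    then have "z \<noteq> y" using assms(2) by force
    then show ?thesis using False by (simp add: trans_op_outside delta_def)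
  qed
qed

lemma trans_op_delta_outside:
  assumes "pinj G" "x \<notin> fst ` G" shows "trans_op G (delta x) = (\<lambda>y. 0)"
proof
  fix z
  show "trans_op G (delta x) z = 0"
  proof (cases "z \<in> snd ` G")
    case True
    then obtain u where u: "(u, z) \<in> G" by auto
    then have "u \<noteq> x" using assms by force
    then show ?thesis using trans_op_apply[OF assms(1) delta_l2 u] by (auto simp: delta_def)
  qed (simp add: trans_op_outside)
qed

lemma pinj_comp: "pinj G \<Longrightarrow> pinj H \<Longrightarrow> pinj (G O H)"
  unfolding pinj_def inj_on_def by force

lemma trans_op_mult:
  assumes "pinj G" "pinj H" shows "op_mult (trans_op H) (trans_op G) = trans_op (G O H)"
proof (rule bop_eq_deltaI)
  fix x
  show "op_mult (trans_op H) (trans_op G) (delta x) = trans_op (G O H) (delta x)"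
  proof (cases "x \<in> fst ` G")
    case True
    then obtain y where y: "(x, y) \<in> G" by auto
    show ?thesis
    proof (cases "y \<in> fst ` H")
      case True
      then obtain z where z: "(y, z) \<in> H" by auto
      have "(x, z) \<in> G O H" using y z by blast
      from trans_op_delta[OF pinj_comp[OF assms] this] show ?thesis
        by (simp add: op_mult_def trans_op_delta[OF assms(1) y] trans_op_delta[OF assms(2) z])
    next
      case False
      have "x \<notin> fst ` (G O H)"
      proof
        assume "x \<in> fst ` (G O H)"
        then obtain y' z where "(x, y') \<in> G" "(y', z) \<in> H" by auto
        moreover then have "y' = y" using y assms(1) by (force simp: pinj_def inj_on_def)
        ultimately show False using False by force
      qed
      then show ?thesis using y assms False
        by (simp add: op_mult_def trans_op_delta[OF assms(1) y] trans_op_delta_outside pinj_comp)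
    qed
  next
    case False
    then have "x \<notin> fst ` (G O H)" by force
    then show ?thesis using False assms by (simp add: op_mult_def trans_op_delta_outside pinj_comp)
  qed
qed (auto simp: assms pinj_comp)

lemma pinj_Id_on [simp]: "pinj (Id_on M)" by (auto simp: pinj_def inj_on_def)
lemma pinj_single [simp]: "pinj {(x, y)}" by (auto simp: pinj_def)

lemma trans_op_Id_on:
  assumes "v \<in> l2" shows "trans_op (Id_on M) v = (\<lambda>x. (if x \<in> M then 1 else 0) * v x)"
proof
  fix x
  show "trans_op (Id_on M) v x = (if x \<in> M then 1 else 0) * v x"
  proof (cases "x \<in> M")
    case True then show ?thesis using trans_op_apply[of "Id_on M" v x x] assms by auto
  next
    case False
    then have "x \<notin> snd ` Id_on M" by auto
    then show ?thesis using False by (simp add: trans_op_outside)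
  qed
qed

lemma trans_op_single:
  assumes "v \<in> l2" shows "trans_op {(x, y)} v = (\<lambda>z. v x * delta y z)"
proof
  fix z
  show "trans_op {(x, y)} v z = v x * delta y z"
    using trans_op_apply[OF pinj_single assms, of x y x y] trans_op_outside[of z "{(x, y)}" v]
    by (cases "z = y") (auto simp: delta_def)
qed

lemma op_mult_assoc: "op_mult (op_mult a b) c = op_mult a (op_mult b c)"
  by (simp add: op_mult_def o_assoc)

lemma trans_op_Id_on_linf: "trans_op (Id_on M) \<in> linf_diag"
proof -
  have "bounded (range (\<lambda>x. if x \<in> M then 1 else 0 :: complex))"
    by (rule boundedI[where B=1]) auto
  then show ?thesis unfolding linf_diag_def using trans_op_Id_on by fastforce
qed

lemma trans_op_identity: "bounded_op a \<Longrightarrow> op_mult a (trans_op (Id_on UNIV)) = a"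
   "bounded_op a \<Longrightarrow> op_mult (trans_op (Id_on UNIV)) a = a"
  by (rule bop_eqI; (simp; fail)?; simp add: op_mult_def trans_op_Id_on)+

text \<open>Expresses a matrix coefficient by multiplication inside the Roe algebra, so that a
  homomorphism has to respect it.\<close>

lemma sandwich_single:
  fixes a :: "'a op"
  assumes "bounded_op a"
  shows "op_mult (op_mult (trans_op {(y, z)}) a) (trans_op {(x, w)}) = op_scale (entry a w y) (trans_op {(x, z)})"
proof (rule bop_eqI)
  fix v :: "'a vec" assume "v \<in> l2"
  then show "op_mult (op_mult (trans_op {(y, z)}) a) (trans_op {(x, w)}) v = op_scale (entry a w y) (trans_op {(x, z)}) v"
    by (simp add: assms op_mult_def trans_op_single bop_scale op_scale_def entry_eq mult_ac)
qed (simp_all add: assms)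

section \<open>Closure properties of the uniform Roe algebra\<close>

lemma roeI:
  assumes "bounded_op a" "finite_prop a" shows "a \<in> roe_alg"
proof -
  have "opnorm (op_minus a a) \<le> 0" by (rule opnorm_leI) (auto simp: op_minus_def)
  then have "opnorm (op_minus a a) \<le> e" if "e > 0" for e using that by linarith
  then show ?thesis unfolding roe_alg_def using assms by blast
qed

lemma linf_subset_roe: "linf_diag \<subseteq> roe_alg"
proof
  fix a :: "'a op" assume a: "a \<in> linf_diag"
  then obtain f where f: "\<forall>v\<in>l2. a v = (\<lambda>x. f x * v x)" and b: "bounded_op a" by (auto simp: linf_diag_def)
  have "a (delta x) y = f y * delta x y" for x y using f delta_l2[of x] by simp
  then have "propg_le a 0" by (auto simp: propg_le_def entry_eq) (auto simp: delta_def split: if_splits)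
  then show "a \<in> roe_alg" using b by (intro roeI) (auto simp: finite_prop_def)
qed

lemma roe_bounded [simp]: "a \<in> roe_alg \<Longrightarrow> bounded_op a"
  by (simp add: roe_alg_def)

lemma propg_trans_op:
  assumes "pinj G" "\<And>x y. (x, y) \<in> G \<Longrightarrow> dist x y \<le> r" shows "propg_le (trans_op G) r"
  unfolding propg_le_def
proof (intro allI impI)
  fix x y assume ne: "entry (trans_op G) x y \<noteq> 0"
  then have "x \<in> fst ` G" using trans_op_delta_outside[OF assms(1), of x] unfolding entry_eq by metis
  then obtain z where z: "(x, z) \<in> G" by auto
  then have "y = z" using ne trans_op_delta[OF assms(1) z] by (auto simp: entry_eq delta_def split: if_splits)
  then show "dist x y \<le> r" using assms(2) z by blast
qed

lemma trans_op_roe: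
  assumes "pinj G" "\<And>x y. (x, y) \<in> G \<Longrightarrow> dist x y \<le> r" shows "trans_op G \<in> roe_alg"
  using propg_trans_op[OF assms] assms(1) by (intro roeI) (auto simp: finite_prop_def)

lemma trans_op_single_roe [simp]: "trans_op {(x, y)} \<in> roe_alg"
  by (rule trans_op_roe[where r="dist x y"]) auto

lemma roe_approx:
  assumes "a \<in> roe_alg" "e > 0"
  obtains b where "bounded_op b" "finite_prop b" "opnorm (op_minus a b) \<le> e"
  using assms unfolding roe_alg_def by blast

lemma finite_prop_add:
  assumes "finite_prop a" "finite_prop b" shows "finite_prop (op_add a b)"
proof -
  obtain r s where "propg_le a r" "propg_le b s" using assms by (auto simp: finite_prop_def)
  then have "propg_le (op_add a b) (max r s)"
    unfolding propg_le_def entry_eq op_add_def by (metis add_0 le_max_iff_disj)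
  then show ?thesis by (auto simp: finite_prop_def)
qed

lemma finite_prop_scale: "finite_prop a \<Longrightarrow> finite_prop (op_scale c a)"
  by (auto simp: finite_prop_def propg_le_def entry_eq op_scale_def)

lemma finite_prop_mult:
  assumes "bounded_op a" "bounded_op b" "finite_prop a" "finite_prop b"
  shows "finite_prop (op_mult a b)"
proof -
  obtain r s where rs: "propg_le a r" "propg_le b s" using assms by (auto simp: finite_prop_def)
  have "dist x y \<le> s + r" if ne: "entry (op_mult a b) x y \<noteq> 0" for x y
  proof -
    have "entry (op_mult a b) x y = (\<Sum>\<^sub>\<infinity>z. entry b x z * entry a z y)"
      unfolding entry_eq op_mult_def comp_def using bop_expand(1)[OF assms(1), of "b (delta x)" y] assms(2)
      by (simp add: entry_eq)
    then obtain z where "entry b x z * entry a z y \<noteq> 0" using ne by (metis (mono_tags, lifting) infsum_0)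
    then have "dist x z \<le> s" "dist z y \<le> r" using rs by (auto simp: propg_le_def)
    then show ?thesis using dist_triangle[of x y z] by linarith
  qed
  then show ?thesis by (auto simp: finite_prop_def propg_le_def)
qed

lemma roe_add: assumes "a \<in> roe_alg" "b \<in> roe_alg" shows "op_add a b \<in> roe_alg"
  unfolding roe_alg_def
proof (intro CollectI conjI allI impI)
  fix e :: real assume e: "e > 0"
  obtain a' where a': "bounded_op a'" "finite_prop a'" "opnorm (op_minus a a') \<le> e/2" using roe_approx[OF assms(1), of "e/2"] e by auto
  obtain b' where b': "bounded_op b'" "finite_prop b'" "opnorm (op_minus b b') \<le> e/2" using roe_approx[OF assms(2), of "e/2"] e by auto
  have "op_minus (op_add a b) (op_add a' b') = op_add (op_minus a a') (op_minus b b')"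
    by (auto simp: op_minus_def op_add_def fun_eq_iff)
  then have "opnorm (op_minus (op_add a b) (op_add a' b')) \<le> e"
    using opnorm_add_le[of "op_minus a a'" "op_minus b b'"] a' b' assms by simp
  then show "\<exists>c. bounded_op c \<and> finite_prop c \<and> opnorm (op_minus (op_add a b) c) \<le> e"
    using a' b' by (intro exI[of _ "op_add a' b'"]) (auto simp: finite_prop_add)
qed (use assms in auto)

lemma roe_scale: assumes "a \<in> roe_alg" shows "op_scale c a \<in> roe_alg"
  unfolding roe_alg_def
proof (intro CollectI conjI allI impI)
  fix e :: real assume e: "e > 0"
  have pos: "cmod c + 1 > 0" by (simp add: add_nonneg_pos)
  obtain a' where a': "bounded_op a'" "finite_prop a'" "opnorm (op_minus a a') \<le> e/(cmod c + 1)"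
    using roe_approx[OF assms(1), of "e/(cmod c + 1)"] e pos by auto
  have "op_minus (op_scale c a) (op_scale c a') = op_scale c (op_minus a a')"
    by (auto simp: op_minus_def op_scale_def algebra_simps)
  then have "opnorm (op_minus (op_scale c a) (op_scale c a')) \<le> cmod c * opnorm (op_minus a a')"
    using opnorm_scale_le[of "op_minus a a'" c] a' assms by simp
  also have "\<dots> \<le> (cmod c + 1) * (e/(cmod c + 1))"
    using a' pos e assms by (intro mult_mono) (auto simp: opnorm_nonneg)
  also have "\<dots> = e" using pos by (metis nonzero_mult_div_cancel_left less_numeral_extra(3) times_divide_eq_right)
  finally show "\<exists>d. bounded_op d \<and> finite_prop d \<and> opnorm (op_minus (op_scale c a) d) \<le> e"
    using a' by (intro exI[of _ "op_scale c a'"]) (auto simp: finite_prop_scale)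
qed (use assms in auto)

lemma roe_mult: assumes "a \<in> roe_alg" "b \<in> roe_alg" shows "op_mult a b \<in> roe_alg"
  unfolding roe_alg_def
proof (intro CollectI conjI allI impI)
  fix e :: real assume e: "e > 0"
  have ba: "bounded_op a" "bounded_op b" using assms by auto
  have p1: "opnorm b + 1 > 0" using opnorm_nonneg[OF ba(2)] by simp
  obtain a' where a': "bounded_op a'" "finite_prop a'" "opnorm (op_minus a a') \<le> e/2/(opnorm b + 1)"
    using roe_approx[OF assms(1), of "e/2/(opnorm b + 1)"] e p1 by auto
  \<comment> \<open>The tolerance for \<open>b'\<close> is measured against \<open>a'\<close>, which
    is already chosen, because the error is split as
    \<open>(a - a') b + a' (b - b')\<close>.\<close>
  have p2: "opnorm a' + 1 > 0" using opnorm_nonneg[OF a'(1)] by simp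
  obtain b' where b': "bounded_op b'" "finite_prop b'" "opnorm (op_minus b b') \<le> e/2/(opnorm a' + 1)"
    using roe_approx[OF assms(2), of "e/2/(opnorm a' + 1)"] e p2 by auto
  have eq: "op_minus (op_mult a b) (op_mult a' b') = op_add (op_mult (op_minus a a') b) (op_mult a' (op_minus b b'))"
  proof (rule bop_eqI)
    fix v :: "'a vec" assume "v \<in> l2"
    show "op_minus (op_mult a b) (op_mult a' b') v = op_add (op_mult (op_minus a a') b) (op_mult a' (op_minus b b')) v"
      using bop_minus[OF a'(1), of "b v" "b' v"] ba b'(1) by (simp add: op_minus_def op_mult_def op_add_def)
  qed (use a' b' ba in auto)
  have "opnorm (op_minus (op_mult a b) (op_mult a' b'))
      \<le> opnorm (op_mult (op_minus a a') b) + opnorm (op_mult a' (op_minus b b'))"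
    unfolding eq by (rule opnorm_add_le) (use a' b' ba in auto)
  also have "\<dots> \<le> opnorm (op_minus a a') * opnorm b + opnorm a' * opnorm (op_minus b b')"
    by (intro add_mono opnorm_mult_le) (use a' b' ba in auto)
  also have "\<dots> \<le> (e/2/(opnorm b + 1)) * (opnorm b + 1) + (opnorm a' + 1) * (e/2/(opnorm a' + 1))"
    using a' b' ba e p1 p2 by (intro add_mono mult_mono) (auto simp: opnorm_nonneg)
  also have "\<dots> = e/2 + e/2"
    using p1 p2 by (intro arg_cong2[where f="(+)"]) (simp_all only: nonzero_divide_eq_eq nonzero_mult_div_cancel_left
        times_divide_eq_left times_divide_eq_right nonzero_mult_div_cancel_right less_irrefl, auto)
  also have "\<dots> = e" by simp
  finally show "\<exists>d. bounded_op d \<and> finite_prop d \<and> opnorm (op_minus (op_mult a b) d) \<le> e"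
    using a' b' by (intro exI[of _ "op_mult a' b'"]) (auto simp: finite_prop_mult)
qed (use assms in auto)

section \<open>Rank-one operators\<close>

definition rank1 :: "'a vec \<Rightarrow> 'a op" where
  "rank1 u = (\<lambda>v. if v \<in> l2 then (\<lambda>y. l2inner v u * u y) else (\<lambda>y. 0))"

lemma rank1_apply: "v \<in> l2 \<Longrightarrow> rank1 u v = (\<lambda>y. l2inner v u * u y)"
  by (simp add: rank1_def)

lemma bounded_rank1 [simp]: assumes "u \<in> l2" shows "bounded_op (rank1 u)"
proof (rule bounded_opI[where C="l2norm u * l2norm u"])
  fix v :: "'a vec" assume v: "v \<in> l2"
  show "l2norm (rank1 u v) \<le> l2norm u * l2norm u * l2norm v"
    using mult_right_mono[OF l2_CS[OF v assms], of "l2norm u"] by (simp add: rank1_apply v l2norm_scale) (simp add: mult_ac)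
qed (use assms in \<open>auto simp: rank1_def l2_scale l2_add l2inner_add_left l2inner_scale_left distrib_right mult.assoc\<close>)

lemma rank1_adjoint: "v \<in> l2 \<Longrightarrow> w \<in> l2 \<Longrightarrow> l2inner (rank1 u v) w = l2inner v (rank1 u w)"
  by (simp add: rank1_apply l2inner_scale_left l2inner_scale_right l2inner_cnj)

lemma rank1_inner_self: "v \<in> l2 \<Longrightarrow> l2inner (rank1 u v) v = of_real ((cmod (l2inner v u))^2)"
  unfolding complex_norm_square by (simp add: rank1_apply l2inner_scale_left l2inner_cnj)

lemma positive_rank1: "u \<in> l2 \<Longrightarrow> positive_op (rank1 u)"
  by (simp add: positive_op_def rank1_inner_self)

text \<open>Truncating \<open>u\<close> to a finite set \<open>D\<close> makes the propagation
  finite, and the error is at most the norm of the removed tail times the sum of the norms of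
  \<open>u\<close> and its truncation.\<close>

lemma rank1_roe: fixes u :: "'a::metric_space \<Rightarrow> complex" assumes "u \<in> l2" shows "rank1 u \<in> roe_alg"
  unfolding roe_alg_def
proof (intro CollectI conjI allI impI)
  fix e :: real assume e: "e > 0"
  define K where "K = 2 * l2norm u + 1"
  have K: "K > 0" unfolding K_def by (simp add: add_nonneg_pos)
  obtain D where D: "finite D" "l2norm (\<lambda>x. u x - (if x \<in> D then u x else 0)) \<le> e / K"
    using l2_approx[OF assms, of "e/K"] e K by auto
  define w where "w = (\<lambda>x. if x \<in> D then u x else 0)"
  define d where "d = (\<lambda>x. u x - w x)"
  have w: "w \<in> l2" "l2norm w \<le> l2norm u" unfolding w_def by (rule l2_truncate_le[OF assms])+
  have d: "d \<in> l2" unfolding d_def by (rule l2_minus[OF assms w(1)])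
  have "opnorm (op_minus (rank1 u) (rank1 w)) \<le> l2norm d * K"
  proof (rule opnorm_leI)
    fix v :: "'a vec" assume v: "v \<in> l2"
    have "op_minus (rank1 u) (rank1 w) v = (\<lambda>y. l2inner v d * u y + l2inner v w * d y)"
      by (simp add: op_minus_def rank1_apply v d_def l2inner_minus_right assms w algebra_simps)
    then have "l2norm (op_minus (rank1 u) (rank1 w) v) \<le> cmod (l2inner v d) * l2norm u + cmod (l2inner v w) * l2norm d"
      using l2norm_triangle[OF l2_scale[OF assms, of "l2inner v d"] l2_scale[OF d, of "l2inner v w"]]
      by (simp add: l2norm_scale)
    also have "\<dots> \<le> (l2norm v * l2norm d) * l2norm u + (l2norm v * l2norm w) * l2norm d"
      by (intro add_mono mult_right_mono l2_CS v d w) auto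
    also have "\<dots> \<le> (l2norm v * l2norm d) * l2norm u + (l2norm v * l2norm u) * l2norm d"
      using w by (intro add_mono mult_right_mono mult_left_mono) auto
    also have "\<dots> \<le> l2norm d * K * l2norm v" unfolding K_def by (simp add: algebra_simps)
    finally show "l2norm (op_minus (rank1 u) (rank1 w) v) \<le> l2norm d * K * l2norm v" .
  qed (use K in simp)
  also have "\<dots> \<le> (e / K) * K" using D(2) K unfolding d_def w_def by (intro mult_right_mono) auto
  finally have *: "opnorm (op_minus (rank1 u) (rank1 w)) \<le> e" using K by simp
  \<comment> \<open>The propagation is at most the diameter of \<open>D\<close>; the inserted 0
    covers the empty set.\<close>
  have "propg_le (rank1 w) (Max (insert 0 ((\<lambda>(x, y). dist x y) ` (D \<times> D))))"
    unfolding propg_le_def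
  proof (intro allI impI)
    fix x y assume "entry (rank1 w) x y \<noteq> 0"
    then have "(x, y) \<in> D \<times> D" by (auto simp: entry_eq rank1_apply w_def split: if_splits)
    then show "dist x y \<le> Max (insert 0 ((\<lambda>(x, y). dist x y) ` (D \<times> D)))" using D(1) by (intro Max_ge) auto
  qed
  then show "\<exists>b. bounded_op b \<and> finite_prop b \<and> opnorm (op_minus (rank1 u) b) \<le> e"
    using * w by (intro exI[of _ "rank1 w"]) (auto simp: finite_prop_def)
qed (use assms in simp)

section \<open>Baire category, sign choices and Hall's theorem\<close>

text \<open>The Baire category theorem for the Cantor space of subsets of \<open>'i\<close>; basic open sets are given by
  a finite window \<open>F\<close> and a prescribed trace \<open>S\<close> on it.\<close>

lemma baire_subsets:
  fixes P :: "nat \<Rightarrow> 'i set \<Rightarrow> bool"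
  assumes "\<And>j F S. finite F \<Longrightarrow> S \<subseteq> F \<Longrightarrow>
     \<exists>F' S'. finite F' \<and> F \<subseteq> F' \<and> S' \<subseteq> F' \<and> S' \<inter> F = S \<and> (\<forall>M. M \<inter> F' = S' \<longrightarrow> P j M)"
  shows "\<exists>M. \<forall>j. P j M"
proof -
  define Q where "Q = (\<lambda>(F :: 'i set, S). finite F \<and> S \<subseteq> F)"
  define R where "R = (\<lambda>j (F :: 'i set, S) (F', S'). F \<subseteq> F' \<and> S' \<inter> F = S \<and> (\<forall>M. M \<inter> F' = S' \<longrightarrow> P j M))"
  have "\<exists>f. \<forall>n. Q (f n) \<and> R n (f n) (f (Suc n))"
  proof (rule dependent_nat_choice)
    show "\<exists>x. Q x" by (rule exI[of _ "({}, {})"]) (simp add: Q_def)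
    fix x n assume "Q x"
    then have "finite (fst x)" "snd x \<subseteq> fst x" by (auto simp: Q_def split_beta)
    from assms[OF this, of n] obtain F' S' where "finite F' \<and> fst x \<subseteq> F' \<and> S' \<subseteq> F' \<and> S' \<inter> fst x = snd x \<and>
      (\<forall>M. M \<inter> F' = S' \<longrightarrow> P n M)" by blast
    then show "\<exists>y. Q y \<and> R n x y" unfolding Q_def R_def split_beta by (intro exI[of _ "(F', S')"]) simp
  qed
  then obtain f where f: "\<And>n. Q (f n)" "\<And>n. R n (f n) (f (Suc n))" by blast
  define F S where "F = (\<lambda>n. fst (f n))" and "S = (\<lambda>n. snd (f n))"
  have sub: "S n \<subseteq> F n" for n using f(1)[of n] by (auto simp: Q_def F_def S_def split: prod.splits)
  have step: "F n \<subseteq> F (Suc n)" "S (Suc n) \<inter> F n = S n" "\<And>M. M \<inter> F (Suc n) = S (Suc n) \<Longrightarrow> P n M" for n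
    using f(2)[of n] by (auto simp: R_def F_def S_def split: prod.splits)
  have FF: "F m \<subseteq> F n" if "m \<le> n" for m n using that step(1) by (rule lift_Suc_mono_le[rotated])
  note step_S = step(2)
  have mono: "S n \<inter> F m = S m" if "m \<le> n" for m n
    using that
  proof (induction n rule: dec_induct)
    case base then show ?case using sub by blast
  next
    case (step n)
    then show ?case using FF[of m n] step_S[of n] by blast
  qed
  define M where "M = (\<Union>n. S n)"
  have "M \<inter> F m = S m" for m
  proof
    show "S m \<subseteq> M \<inter> F m" using sub by (auto simp: M_def)
    show "M \<inter> F m \<subseteq> S m"
    proof
      fix x assume "x \<in> M \<inter> F m"
      then obtain n where n: "x \<in> S n" "x \<in> F m" by (auto simp: M_def)
      show "x \<in> S m"
      proof (cases "m \<le> n")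
        case True then show ?thesis using mono[OF True] n by blast
      next
        case False then have "S m \<inter> F n = S n" using mono[of n m] by simp
        then show ?thesis using n by blast
      qed
    qed
  qed
  then have "P j M" for j using step(3)[of M j] by blast
  then show ?thesis by blast
qed

text \<open>Averaging over all signs, done greedily by the parallelogram law.\<close>

lemma exists_signs:
  fixes w :: "'i \<Rightarrow> 'b vec"
  assumes "finite M"
  shows "\<exists>s. (\<forall>x\<in>M. s x = 1 \<or> s x = -1) \<and>
    (\<Sum>x\<in>M. \<Sum>y\<in>D. (cmod (w x y))^2) \<le> (\<Sum>y\<in>D. (cmod (\<Sum>x\<in>M. s x * w x y))^2)"
  using assms
proof (induction M)
  case (insert a M)
  then obtain s where s: "\<forall>x\<in>M. s x = 1 \<or> s x = -1"
    "(\<Sum>x\<in>M. \<Sum>y\<in>D. (cmod (w x y))^2) \<le> (\<Sum>y\<in>D. (cmod (\<Sum>x\<in>M. s x * w x y))^2)" by blast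
  define t where "t = (\<lambda>y. \<Sum>x\<in>M. s x * w x y)"
  have "(\<Sum>y\<in>D. (cmod (w a y + t y))^2) + (\<Sum>y\<in>D. (cmod (- w a y + t y))^2)
     = 2 * ((\<Sum>y\<in>D. (cmod (w a y))^2) + (mass D t))"
    unfolding sum.distrib[symmetric] sum_distrib_left
    by (intro sum.cong refl, unfold cmod_power2) (simp add: power2_eq_square algebra_simps)
  then have "\<exists>e. (e = 1 \<or> e = -1) \<and>
     (\<Sum>y\<in>D. (cmod (w a y))^2) + mass D t \<le> (\<Sum>y\<in>D. (cmod (e * w a y + t y))^2)"
    by (cases "(\<Sum>y\<in>D. (cmod (w a y))^2) + mass D t \<le> (\<Sum>y\<in>D. (cmod (w a y + t y))^2)")
       (auto intro: exI[of _ 1] exI[of _ "-1"])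
  then obtain e where e: "e = 1 \<or> e = -1"
    "(\<Sum>y\<in>D. (cmod (w a y))^2) + mass D t \<le> (\<Sum>y\<in>D. (cmod (e * w a y + t y))^2)" by blast
  have s2: "(\<Sum>x\<in>M. \<Sum>y\<in>D. (cmod (w x y))^2) \<le> mass D t" using s(2) by (simp add: t_def)
  have "(\<Sum>x\<in>M. (s(a := e)) x * w x y) = t y" for y
    unfolding t_def using insert.hyps by (intro sum.cong) auto
  then have "(\<Sum>x\<in>insert a M. (s(a := e)) x * w x y) = e * w a y + t y" for y
    using insert.hyps by simp
  then show ?case using e s(1) s2 insert.hyps by (intro exI[of _ "s(a := e)"]) simp
qed auto

text \<open>Gaussian elimination: a pivot \<open>x0\<close> of equation \<open>e\<close> is
  eliminated from the remaining equations, which costs one equation and one unknown. It will produce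
  a nonzero combination of basis vectors vanishing on a set with fewer points than there are
  vectors.\<close>

lemma homogeneous_system_nontrivial:
  fixes m :: "'i \<Rightarrow> 'e \<Rightarrow> 'k::field"
  assumes "finite E" "finite F" "card E < card F"
  shows "\<exists>b. (\<exists>x\<in>F. b x \<noteq> 0) \<and> (\<forall>e\<in>E. (\<Sum>x\<in>F. b x * m x e) = 0)"
  using assms
proof (induction E arbitrary: F m rule: finite_induct)
  case empty
  then have "F \<noteq> {}" by auto
  then show ?case by (intro exI[of _ "\<lambda>_. 1"]) auto
next
  case (insert e E)
  show ?case
  proof (cases "\<exists>x0\<in>F. m x0 e \<noteq> 0")
    case False
    have "card E < card F" using insert by simp
    then obtain b where "\<exists>x\<in>F. b x \<noteq> 0" "\<forall>e\<in>E. (\<Sum>x\<in>F. b x * m x e) = 0" using insert.IH insert.prems(1) by blast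
    then show ?thesis using False by (intro exI[of _ b]) auto
  next
    case True
    then obtain x0 where x0: "x0 \<in> F" "m x0 e \<noteq> 0" by blast
    define m' where "m' = (\<lambda>x e'. m x e' - m x e / m x0 e * m x0 e')"
    have "card E < card (F - {x0})" using insert x0 by simp
    then obtain b where b: "\<exists>x\<in>F-{x0}. b x \<noteq> 0" "\<forall>e\<in>E. (\<Sum>x\<in>F-{x0}. b x * m' x e) = 0"
      using insert.IH[of "F - {x0}" m'] insert.prems(1) by blast
    \<comment> \<open>The value of the unknown \<open>x0\<close> that solves equation
      \<open>e\<close>; the modified coefficients \<open>m'\<close> are arranged so that the other
      equations then hold as well.\<close>
    define c where "c = - (\<Sum>x\<in>F-{x0}. b x * m x e) / m x0 e"
    have eq: "(\<Sum>x\<in>F. (b(x0 := c)) x * m x e') = c * m x0 e' + (\<Sum>x\<in>F-{x0}. b x * m x e')" for e'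
      using sum.remove[OF insert.prems(1) x0(1), of "\<lambda>x. (b(x0 := c)) x * m x e'"] by simp
    have "(\<Sum>x\<in>F. (b(x0 := c)) x * m x e) = 0" by (simp only: eq) (simp add: c_def x0)
    moreover have "(\<Sum>x\<in>F. (b(x0 := c)) x * m x e') = 0" if "e' \<in> E" for e'
    proof -
      have "(\<Sum>x\<in>F-{x0}. b x * m' x e') = (\<Sum>x\<in>F-{x0}. b x * m x e') - (\<Sum>x\<in>F-{x0}. b x * m x e) / m x0 e * m x0 e'"
        unfolding m'_def sum_divide_distrib sum_distrib_right sum_subtractf[symmetric]
        by (intro sum.cong) (auto simp: algebra_simps)
      then show ?thesis using b(2) that by (simp only: eq) (simp add: c_def)
    qed
    moreover have "\<exists>x\<in>F. (b(x0 := c)) x \<noteq> 0" using b(1) by auto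
    ultimately show ?thesis by (intro exI[of _ "b(x0 := c)"]) auto
  qed
qed

text \<open>The index type may be infinite. Finiteness of every \<open>H x\<close> belongs to the
  condition because it makes descending chains stabilise on finite sets of indices.\<close>

definition hall :: "('i \<Rightarrow> 'b set) \<Rightarrow> bool" where
  "hall H \<longleftrightarrow> (\<forall>x. finite (H x)) \<and> (\<forall>F. finite F \<longrightarrow> card F \<le> card (\<Union>x\<in>F. H x))"

lemma hallD: "hall H \<Longrightarrow> finite F \<Longrightarrow> card F \<le> card (\<Union>x\<in>F. H x)"
  by (simp add: hall_def)

text \<open>Rado's argument: if removing either of two elements of \<open>H x\<close> destroys Hall's condition, the two violating
  index sets contradict the submodularity of cardinality.\<close>

lemma hall_minimal_singleton:
  assumes H: "hall H" and min: "\<And>H'. hall H' \<Longrightarrow> (\<And>x. H' x \<subseteq> H x) \<Longrightarrow> H' = H"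
    and y: "y1 \<in> H x" "y2 \<in> H x"
  shows "y1 = y2"
proof (rule ccontr)
  assume ne: "y1 \<noteq> y2"
  \<comment> \<open>Minimality yields a violating index set, which must contain \<open>x\<close>.
    Taking \<open>x\<close> out of it turns the strict inequality into \<open>\<le>\<close>.\<close>
  have ex: "\<exists>F. finite F \<and> x \<notin> F \<and> card ((\<Union>z\<in>F. H z) \<union> (H x - {y})) \<le> card F" if yH: "y \<in> H x" for y
  proof -
    define H' where "H' = H(x := H x - {y})"
    have sub: "H' z \<subseteq> H z" for z by (auto simp: H'_def)
    have "H' \<noteq> H" using yH by (auto simp: H'_def fun_eq_iff)
    then have "\<not> hall H'" using min[of H'] sub by blast
    moreover have "\<forall>z. finite (H' z)" using H sub by (auto simp: hall_def intro: finite_subset)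
    ultimately obtain F where F: "finite F" "card (\<Union>z\<in>F. H' z) < card F" by (auto simp: hall_def not_le)
    have xF: "x \<in> F"
    proof (rule ccontr)
      assume "x \<notin> F"
      then have "(\<Union>z\<in>F. H' z) = (\<Union>z\<in>F. H z)" by (auto simp: H'_def)
      then show False using F H by (auto simp: hall_def not_le[symmetric])
    qed
    have "(\<Union>z\<in>F. H' z) = (\<Union>z\<in>F-{x}. H z) \<union> (H x - {y})" using xF by (auto simp: H'_def split: if_splits)
    moreover have "card F = Suc (card (F - {x}))" using xF F(1) by (metis card_Suc_Diff1)
    ultimately show ?thesis using F by (intro exI[of _ "F - {x}"]) auto
  qed
  obtain F1 where F1: "finite F1" "x \<notin> F1" "card ((\<Union>z\<in>F1. H z) \<union> (H x - {y1})) \<le> card F1" using ex[OF y(1)] by blast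
  obtain F2 where F2: "finite F2" "x \<notin> F2" "card ((\<Union>z\<in>F2. H z) \<union> (H x - {y2})) \<le> card F2" using ex[OF y(2)] by blast
  \<comment> \<open>As \<open>y1\<close> and \<open>y2\<close> differ, all of \<open>H x\<close>
    lies in \<open>U1 \<union> U2\<close>, so Hall's condition applies to the union of the index
    sets together with \<open>x\<close>. This extra index is the 1 that contradicts the two bounds
    on \<open>U1\<close> and \<open>U2\<close>.\<close>
  define U1 U2 where "U1 = (\<Union>z\<in>F1. H z) \<union> (H x - {y1})" and "U2 = (\<Union>z\<in>F2. H z) \<union> (H x - {y2})"
  have fin: "finite U1" "finite U2" using H F1(1) F2(1) by (auto simp: U1_def U2_def hall_def)
  have "(\<Union>z\<in>insert x (F1 \<union> F2). H z) \<subseteq> U1 \<union> U2" using ne by (auto simp: U1_def U2_def)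
  then have "card (insert x (F1 \<union> F2)) \<le> card (U1 \<union> U2)"
    using H F1(1) F2(1) fin card_mono[of "U1 \<union> U2"] unfolding hall_def
    by (metis (no_types, lifting) finite_Un finite_insert order_trans)
  moreover have "(\<Union>z\<in>F1 \<inter> F2. H z) \<subseteq> U1 \<inter> U2" by (auto simp: U1_def U2_def)
  then have "card (F1 \<inter> F2) \<le> card (U1 \<inter> U2)"
    using H F1(1) fin card_mono[of "U1 \<inter> U2"] unfolding hall_def
    by (metis (no_types, lifting) finite_Int order_trans)
  ultimately have "card (F1 \<union> F2) + 1 + card (F1 \<inter> F2) \<le> card U1 + card U2"
    using card_Un_Int[OF fin] F1 F2 by simp
  then show False using card_Un_Int[OF F1(1) F2(1)] F1(3) F2(3) unfolding U1_def[symmetric] U2_def[symmetric] by linarith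
qed

text \<open>Zorn's lemma for reversed pointwise inclusion. The intersection of a chain still
  satisfies Hall's condition, since each instance of the condition involves finitely many indices
  and there the intersection agrees with a member of the chain.\<close>

lemma hall_minimal_exists:
  assumes H: "hall H"
  obtains H0 where "hall H0" "\<And>x. H0 x \<subseteq> H x" "\<And>H'. hall H' \<Longrightarrow> (\<And>x. H' x \<subseteq> H0 x) \<Longrightarrow> H' = H0"
proof -
  define A where "A = {H'. hall H' \<and> (\<forall>x. H' x \<subseteq> H x)}"
  define r where "r = {(H1, H2). H1 \<in> A \<and> H2 \<in> A \<and> (\<forall>x. H2 x \<subseteq> H1 x)}"
  have Field: "Field r = A" by (auto simp: r_def Field_def)
  have "Partial_order r"
    unfolding partial_order_on_def preorder_on_def Field
    by (auto simp: refl_on_def trans_def antisym_def r_def fun_eq_iff)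
  moreover have "\<exists>u\<in>Field r. \<forall>a\<in>C. (a, u) \<in> r" if C: "C \<in> Chains r" for C
  proof (cases "C = {}")
    case True then show ?thesis using H Field by (auto simp: A_def)
  next
    case False
    have CA: "C \<subseteq> A" using C Field by (auto simp: Chains_def Field_def)
    define u where "u = (\<lambda>x. \<Inter>K\<in>C. K x)"
    have fin: "finite (K x)" if "K \<in> C" for K x using CA that by (auto simp: A_def hall_def)
    have tot: "(\<forall>x. K x \<subseteq> L x) \<or> (\<forall>x. L x \<subseteq> K x)" if "K \<in> C" "L \<in> C" for K L
      using C that by (auto simp: Chains_def r_def)
    have attained: "\<exists>K\<in>C. \<forall>x\<in>F. K x = u x" if "finite F" for F
    proof -
      \<comment> \<open>On a finite set of indices the chain of finite sets stabilises.\<close>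
      obtain K where K: "K \<in> C" "\<And>L. L \<in> C \<Longrightarrow> (\<Sum>x\<in>F. card (K x)) \<le> (\<Sum>x\<in>F. card (L x))"
        using False ex_has_least_nat[of "\<lambda>K. K \<in> C" _ "\<lambda>K. \<Sum>x\<in>F. card (K x)"] by (metis all_not_in_conv)
      have "K x \<subseteq> L x" if "L \<in> C" "x \<in> F" for L x
      proof (cases "\<forall>x. K x \<subseteq> L x")
        case False
        then have LK: "\<forall>x. L x \<subseteq> K x" using tot K(1) that(1) by blast
        have "L x = K x"
        proof (rule ccontr)
          assume "L x \<noteq> K x"
          then have "card (L x) < card (K x)" using LK fin[OF K(1)] by (intro psubset_card_mono) auto
          then have "(\<Sum>x\<in>F. card (L x)) < (\<Sum>x\<in>F. card (K x))"
            using LK fin[OF K(1)] that(2) \<open>finite F\<close> by (intro sum_strict_mono_ex1) (auto intro: card_mono)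
          then show False using K(2)[OF that(1)] by simp
        qed
        then show ?thesis by simp
      qed (use that in auto)
      then show ?thesis using K(1) by (intro bexI[of _ K]) (auto simp: u_def)
    qed
    have "hall u" unfolding hall_def
    proof (intro conjI allI impI)
      fix x
      obtain K where "K \<in> C" "K x = u x" using attained[of "{x}"] by auto
      then show "finite (u x)" using fin[of K x] by simp
    next
      fix F :: "'a set" assume F: "finite F"
      then obtain K where K: "K \<in> C" "\<forall>x\<in>F. K x = u x" using attained by blast
      then have "(\<Union>x\<in>F. u x) = (\<Union>x\<in>F. K x)" by auto
      then show "card F \<le> card (\<Union>x\<in>F. u x)" using K(1) CA F by (auto simp: A_def hall_def)
    qed
    moreover have "u x \<subseteq> H x" for x using False CA by (auto simp: u_def A_def)
    ultimately have "u \<in> A" by (simp add: A_def)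
    then show ?thesis unfolding Field using CA by (intro bexI[of _ u]) (auto simp: r_def u_def)
  qed
  ultimately obtain H0 where "H0 \<in> Field r" "\<forall>a\<in>Field r. (H0, a) \<in> r \<longrightarrow> a = H0"
    using Zorns_po_lemma[of r] by blast
  then have H0: "H0 \<in> A" "\<And>a. a \<in> A \<Longrightarrow> (\<And>x. a x \<subseteq> H0 x) \<Longrightarrow> a = H0" unfolding Field by (auto simp: r_def)
  show ?thesis
  proof (rule that)
    show "hall H0" "\<And>x. H0 x \<subseteq> H x" using H0(1) by (auto simp: A_def)
    fix H' assume H': "hall H'" "\<And>x. H' x \<subseteq> H0 x"
    then have "H' \<in> A" using H0(1) unfolding A_def by blast
    then show "H' = H0" using H0(2) H'(2) by blast
  qed
qed

lemma hall_marriage: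
  assumes "hall H"
  obtains f where "inj f" "\<And>x. f x \<in> H x"
proof -
  obtain H0 where H0: "hall H0" "\<And>x. H0 x \<subseteq> H x" "\<And>H'. hall H' \<Longrightarrow> (\<And>x. H' x \<subseteq> H0 x) \<Longrightarrow> H' = H0"
    using hall_minimal_exists[OF assms] by blast
  have "H0 x \<noteq> {}" for x
  proof -
    have "card {x} \<le> card (\<Union>z\<in>{x}. H0 z)" by (rule hallD[OF H0(1)]) simp
    then show ?thesis by auto
  qed
  then have "\<exists>y. H0 x = {y}" for x
    using hall_minimal_singleton[OF H0(1) H0(3)] by (metis is_singletonI' is_singleton_def)
  then obtain f where f: "\<And>x. H0 x = {f x}" by metis
  have "inj f"
  proof (rule injI, rule ccontr)
    fix x x' assume "f x = f x'" "x \<noteq> x'"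
    moreover have "card {x, x'} \<le> card (\<Union>z\<in>{x, x'}. H0 z)" by (rule hallD[OF H0(1)]) simp
    ultimately show False by (simp add: f)
  qed
  then show ?thesis using that f H0(2) by blast
qed

text \<open>Turns the failure of a coarse property into a partial translation: the bad pairs must
  have pairwise distinct first and pairwise distinct second entries. Only finitely many bad pairs
  touch a given finite set, and each is bad for boundedly many \<open>n\<close>; hence a pair that
  is bad for a large index avoids the set, and it is also bad for every smaller index.\<close>

lemma injective_bad_sequence:
  fixes Q :: "nat \<Rightarrow> 'a \<Rightarrow> 'a \<Rightarrow> bool"
  assumes ex: "\<And>n. \<exists>x x'. Q n x x'"
    and rows: "\<And>x. finite {x'. \<exists>n. Q n x x'}" and cols: "\<And>x'. finite {x. \<exists>n. Q n x x'}"
    and fin: "\<And>x x'. \<exists>N. \<forall>n. Q n x x' \<longrightarrow> n \<le> N" and dec: "\<And>m n x x'. m \<le> n \<Longrightarrow> Q n x x' \<Longrightarrow> Q m x x'"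
  obtains s t where "\<And>n. Q n (s n) (t n)" "inj s" "inj t"
proof -
  have avoid: "\<exists>x x'. x \<notin> F \<and> x' \<notin> F \<and> Q n x x'" if F: "finite F" for F n
  proof (rule ccontr)
    assume neg: "\<not> ?thesis"
    define B where "B = (\<Union>x\<in>F. Pair x ` {x'. \<exists>n. Q n x x'}) \<union> (\<Union>x'\<in>F. (\<lambda>x. (x, x')) ` {x. \<exists>n. Q n x x'})"
    have "finite B" unfolding B_def using F rows cols by auto
    obtain N where N: "\<And>x x' n. Q n x x' \<Longrightarrow> n \<le> N x x'" using fin by metis
    define K where "K = Max (insert n ((\<lambda>(x, x'). N x x') ` B))"
    obtain x x' where q: "Q (Suc K) x x'" using ex by blast
    have "n \<le> K" unfolding K_def using \<open>finite B\<close> by (intro Max_ge) auto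
    then have "Q n x x'" using q dec[of n "Suc K"] by simp
    then have "x \<in> F \<or> x' \<in> F" using neg by blast
    then have "(x, x') \<in> B" using q unfolding B_def by blast
    then have "N x x' \<le> K" unfolding K_def using \<open>finite B\<close> by (intro Max_ge) auto
    then show False using N[OF q] by simp
  qed
  have "\<exists>f :: nat \<Rightarrow> 'a \<times> 'a. \<forall>n. Q n (fst (f n)) (snd (f n)) \<and>
     (\<forall>m<n. fst (f n) \<noteq> fst (f m) \<and> snd (f n) \<noteq> snd (f m))"
  proof (rule dependent_wellorder_choice)
    fix n :: nat and f :: "nat \<Rightarrow> 'a \<times> 'a"
    obtain x x' where "x \<notin> fst ` f ` {..<n} \<union> snd ` f ` {..<n}" "x' \<notin> fst ` f ` {..<n} \<union> snd ` f ` {..<n}" "Q n x x'"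
      using avoid[of "fst ` f ` {..<n} \<union> snd ` f ` {..<n}" n] by auto
    then show "\<exists>r. Q n (fst r) (snd r) \<and> (\<forall>m<n. fst r \<noteq> fst (f m) \<and> snd r \<noteq> snd (f m))"
      by (intro exI[of _ "(x, x')"]) auto
  qed auto
  then obtain f where f: "\<And>n. Q n (fst (f n)) (snd (f n))"
    "\<And>m n. m < n \<Longrightarrow> fst (f n) \<noteq> fst (f m) \<and> snd (f n) \<noteq> snd (f m)" by blast
  show ?thesis
  proof (rule that[of "\<lambda>n. fst (f n)" "\<lambda>n. snd (f n)"])
    show "inj (\<lambda>n. fst (f n))" "inj (\<lambda>n. snd (f n))"
      by (metis f(2) injI linorder_neqE_nat)+
  qed (rule f(1))
qed

section \<open>Schur multipliers from property A\<close>

text \<open>For \<open>m = entry a\<close> and vectors supported in \<open>D\<close> this is the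
  inner product of \<open>a v\<close> with \<open>w\<close>.\<close>

definition mform :: "('b \<Rightarrow> 'b \<Rightarrow> complex) \<Rightarrow> 'b set \<Rightarrow> 'b vec \<Rightarrow> 'b vec \<Rightarrow> complex" where
  "mform m D v w = (\<Sum>y\<in>D. \<Sum>y'\<in>D. m y y' * v y * cnj (w y'))"

text \<open>Operator norm at most \<open>C\<close>, read off from finite sections. This makes sense
  for any matrix, so Schur products and differences can be estimated before any operator with that
  matrix is known to exist.\<close>

definition mbd :: "('b \<Rightarrow> 'b \<Rightarrow> complex) \<Rightarrow> real \<Rightarrow> bool" where
  "mbd m C \<longleftrightarrow> (\<forall>D v w. finite D \<longrightarrow> mass D v \<le> 1 \<longrightarrow> mass D w \<le> 1
     \<longrightarrow> cmod (mform m D v w) \<le> C)"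

lemma mbd_nonneg: "mbd m C \<Longrightarrow> 0 \<le> C"
  unfolding mbd_def by (drule spec[of _ "{}"]) (simp add: mform_def)

lemma mform_scale: "mform m D (\<lambda>y. a * v y) (\<lambda>y. b * w y) = a * cnj b * mform m D v w"
  by (simp add: mform_def sum_distrib_left mult_ac)

lemma mbdD:
  assumes "mbd m C" "finite D"
  shows "cmod (mform m D v w) \<le> C * (sqrt (mass D v) * sqrt (mass D w))"
proof -
  define V W where "V = sqrt (mass D v)" and "W = sqrt (mass D w)"
  have sq: "mass D v = V^2" "mass D w = W^2"
    by (simp_all add: V_def W_def sum_nonneg)
  show ?thesis
  proof (cases "V = 0 \<or> W = 0")
    case True
    then have "(\<forall>y\<in>D. v y = 0) \<or> (\<forall>y\<in>D. w y = 0)"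
      using assms(2) by (auto simp: V_def W_def sum_nonneg_eq_0_iff)
    then have "mform m D v w = 0" by (auto simp: mform_def)
    then show ?thesis using mbd_nonneg[OF assms(1)] by (simp add: sum_nonneg)
  next
    case False
    then have pos: "V > 0" "W > 0" by (auto simp: V_def W_def sum_nonneg less_le)
    have *: "cmod (mform m D (\<lambda>y. of_real (1/V) * v y) (\<lambda>y. of_real (1/W) * w y)) \<le> C"
      using assms pos unfolding mbd_def
      by (auto simp: norm_mult norm_divide power_mult_distrib power_divide sum_divide_distrib[symmetric] sq)
    have "cmod (mform m D v w) / (V * W) \<le> C"
      using * unfolding mform_scale using pos by (simp add: norm_mult norm_divide)
    then show ?thesis using pos unfolding V_def[symmetric] W_def[symmetric] by (simp add: field_simps)
  qed
qed

lemma mform_add: "mform (\<lambda>y y'. m y y' + m' y y') D v w = mform m D v w + mform m' D v w"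
  by (simp add: mform_def sum.distrib distrib_right)

lemma mform_diff: "mform (\<lambda>y y'. m y y' - m' y y') D v w = mform m D v w - mform m' D v w"
  by (simp add: mform_def sum_subtractf left_diff_distrib)

lemma mbd_add:
  fixes m m' :: "'b \<Rightarrow> 'b vec"
  assumes "mbd m C" "mbd m' C'" shows "mbd (\<lambda>y y'. m y y' + m' y y') (C + C')"
  unfolding mbd_def mform_add
proof (intro allI impI)
  fix D and v w :: "'b vec"
  assume "finite D" "mass D v \<le> 1" "mass D w \<le> 1"
  then have "cmod (mform m D v w) \<le> C" "cmod (mform m' D v w) \<le> C'" using assms by (simp_all add: mbd_def)
  then show "cmod (mform m D v w + mform m' D v w) \<le> C + C'" by (rule norm_triangle_mono)
qed

lemma mbd_diff:
  fixes m m' :: "'b \<Rightarrow> 'b vec"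
  assumes "mbd m C" "mbd m' C'" shows "mbd (\<lambda>y y'. m y y' - m' y y') (C + C')"
  unfolding mbd_def mform_diff
proof (intro allI impI)
  fix D and v w :: "'b vec"
  assume "finite D" "mass D v \<le> 1" "mass D w \<le> 1"
  then have "cmod (mform m D v w) \<le> C" "cmod (mform m' D v w) \<le> C'" using assms by (simp_all add: mbd_def)
  then show "cmod (mform m D v w - mform m' D v w) \<le> C + C'"
    using norm_triangle_ineq4[of "mform m D v w" "mform m' D v w"] by linarith
qed

lemma mbd_mono: "mbd m C \<Longrightarrow> C \<le> C' \<Longrightarrow> mbd m C'"
  unfolding mbd_def by (meson order_trans)

text \<open>Pairing \<open>delta y\<close> with the row itself, cut off to \<open>D\<close>, the
  form returns the squared length of the row, while the bound gives \<open>C\<close> times its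
  length.\<close>

lemma mbd_entry_row:
  assumes "mbd m C" "finite D"
  shows "mass D (m y) \<le> C^2"
proof -
  define V where "V = mass D (m y)"
  define w where "w = (\<lambda>y'. if y' \<in> D then m y y' else 0)"
  have V0: "V \<ge> 0" by (simp add: V_def sum_nonneg)
  have W: "mass (insert y D) w = V"
    unfolding V_def w_def using assms(2) by (intro sum.mono_neutral_cong_right) auto
  have d: "mass (insert y D) (delta y) = 1"
    using assms(2) by (subst sum.mono_neutral_right[of _ "{y}"]) (auto simp: delta_def)
  have "mform m (insert y D) (delta y) w = (\<Sum>z\<in>{y}. \<Sum>y'\<in>insert y D. m z y' * delta y z * cnj (w y'))"
    unfolding mform_def using assms(2) by (intro sum.mono_neutral_right) (auto simp: delta_def)
  also have "\<dots> = (\<Sum>y'\<in>insert y D. m y y' * cnj (w y'))" by (simp add: delta_def)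
  also have "\<dots> = (\<Sum>y'\<in>D. m y y' * cnj (m y y'))"
    using assms(2) by (intro sum.mono_neutral_cong_right) (auto simp: w_def)
  also have "\<dots> = of_real V" unfolding V_def of_real_sum complex_norm_square ..
  finally have "V = cmod (mform m (insert y D) (delta y) w)" using V0 by simp
  also have "\<dots> \<le> C * sqrt V" using mbdD[OF assms(1), of "insert y D" "delta y" w] assms(2) W d by simp
  finally have *: "sqrt V * sqrt V \<le> C * sqrt V" using V0 by simp
  have "sqrt V \<le> C"
  proof (cases "V = 0")
    case True then show ?thesis using mbd_nonneg[OF assms(1)] by simp
  next
    case False then show ?thesis using V0 by (intro mult_right_le_imp_le[OF *]) simp
  qed
  then show ?thesis using sqrt_le_D by (auto simp: V_def)
qed

lemma bop_finite_support:
  assumes "bounded_op a" "finite D"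
  shows "a (\<lambda>y. if y \<in> D then v y else 0) y' = (\<Sum>y\<in>D. v y * entry a y y')"
proof -
  have "(\<lambda>y. if y \<in> D then v y else 0) \<in> l2" by (rule l2_finite_support(1)[OF assms(2)]) auto
  then have "a (\<lambda>y. if y \<in> D then v y else 0) y' = (\<Sum>\<^sub>\<infinity>z. (if z \<in> D then v z else 0) * entry a z y')"
    by (rule bop_expand(1)[OF assms(1)])
  also have "\<dots> = (\<Sum>\<^sub>\<infinity>z\<in>D. v z * entry a z y')" by (rule infsum_cong_neutral) auto
  finally show ?thesis using assms(2) by simp
qed

lemma mbd_entry: fixes a :: "'b op" assumes "bounded_op a" shows "mbd (entry a) (opnorm a)"
  unfolding mbd_def
proof (intro allI impI)
  fix D and v w :: "'b vec"
  assume D: "finite D" and v: "mass D v \<le> 1" and w: "mass D w \<le> 1"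
  define v' w' where "v' = (\<lambda>y. if y \<in> D then v y else 0)" and "w' = (\<lambda>y. if y \<in> D then w y else 0)"
  have v': "v' \<in> l2" "l2norm v' \<le> 1" and w': "w' \<in> l2" "l2norm w' \<le> 1"
    using l2_finite_support(1)[OF D, of v'] l2norm_finite_support[OF D, of v'] v
      l2_finite_support(1)[OF D, of w'] l2norm_finite_support[OF D, of w'] w by (auto simp: v'_def w'_def)
  have "l2inner (a v') w' = (\<Sum>y'\<in>D. (\<Sum>y\<in>D. v y * entry a y y') * cnj (w y'))"
    using l2_finite_support(4)[OF D, of w' "a v'"] bop_finite_support[OF assms D, of v]
    by (simp add: v'_def w'_def)
  also have "\<dots> = mform (entry a) D v w"
    unfolding mform_def sum_distrib_right by (subst sum.swap) (simp add: mult_ac)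
  finally have "cmod (mform (entry a) D v w) \<le> l2norm (a v') * l2norm w'"
    using l2_CS[of "a v'" w'] assms w' by simp
  also have "\<dots> \<le> opnorm a * 1"
    using opnorm_ge[OF assms v'] w' opnorm_nonneg[OF assms] by (intro mult_mono) auto
  finally show "cmod (mform (entry a) D v w) \<le> opnorm a" by simp
qed

text \<open>Each term is at most \<open>c/2\<close> times the sum of the two squared moduli, and by
  finite propagation every point occurs in at most \<open>N\<close> nonzero terms on either
  side.\<close>

lemma mbd_schur_test:
  fixes m :: "'b::metric_space \<Rightarrow> 'b vec"
  assumes "\<And>y y'. cmod (m y y') \<le> c" "\<And>y y'. m y y' \<noteq> 0 \<Longrightarrow> dist y y' \<le> r"
    and N: "\<And>y :: 'b. finite (cball y r)" "\<And>y :: 'b. card (cball y r) \<le> N"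
  shows "mbd m (c * real N)"
  unfolding mbd_def
proof (intro allI impI)
  fix D and v w :: "'b vec"
  assume D: "finite D" and v: "mass D v \<le> 1" and w: "mass D w \<le> 1"
  have c: "c \<ge> 0" using assms(1) norm_ge_zero order_trans by blast
  have one: "cmod (m y y' * v y * cnj (w y')) \<le>
     c/2 * ((if y' \<in> cball y r then (cmod (v y))^2 else 0) + (if y \<in> cball y' r then (cmod (w y'))^2 else 0))" for y y'
  proof (cases "m y y' = 0")
    case False
    then have d: "dist y y' \<le> r" by (rule assms(2))
    have "cmod (v y) * cmod (w y') \<le> ((cmod (v y))^2 + (cmod (w y'))^2)/2"
      using sum_squares_bound[of "cmod (v y)" "cmod (w y')"] by simp
    then have "cmod (m y y') * (cmod (v y) * cmod (w y')) \<le> c * (((cmod (v y))^2 + (cmod (w y'))^2)/2)"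
      using assms(1)[of y y'] c by (intro mult_mono) auto
    then show ?thesis using d by (simp add: norm_mult dist_commute mult.assoc)
  qed (use c in auto)
  have cnt: "(\<Sum>y\<in>D. \<Sum>y'\<in>D. (if y' \<in> cball y r then (f y)^2 else 0)) \<le> real N * (\<Sum>y\<in>D. (f y)^2)" for f :: "'b \<Rightarrow> real"
    unfolding sum_distrib_left
  proof (rule sum_mono)
    fix y assume "y \<in> D"
    have "(\<Sum>y'\<in>D. (if y' \<in> cball y r then (f y)^2 else 0)) = real (card (D \<inter> cball y r)) * (f y)^2"
      using D by (simp add: sum.inter_restrict[symmetric] del: mem_cball)
    moreover have "card (D \<inter> cball y r) \<le> N"
      by (rule order_trans[OF card_mono[OF N(1) Int_lower2] N(2)])
    then have "real (card (D \<inter> cball y r)) * (f y)^2 \<le> real N * (f y)^2" by (intro mult_right_mono) auto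
    ultimately show "(\<Sum>y'\<in>D. (if y' \<in> cball y r then (f y)^2 else 0)) \<le> real N * (f y)^2" by simp
  qed
  have "cmod (mform m D v w) \<le> (\<Sum>y\<in>D. \<Sum>y'\<in>D. cmod (m y y' * v y * cnj (w y')))"
    unfolding mform_def by (intro order_trans[OF norm_sum] sum_mono norm_sum)
  also have "\<dots> \<le> (\<Sum>y\<in>D. \<Sum>y'\<in>D. c/2 * ((if y' \<in> cball y r then (cmod (v y))^2 else 0) + (if y \<in> cball y' r then (cmod (w y'))^2 else 0)))"
    by (intro sum_mono one)
  also have "\<dots> = c/2 * ((\<Sum>y\<in>D. \<Sum>y'\<in>D. (if y' \<in> cball y r then (cmod (v y))^2 else 0))
       + (\<Sum>y'\<in>D. \<Sum>y\<in>D. (if y \<in> cball y' r then (cmod (w y'))^2 else 0)))"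
    unfolding sum_distrib_left[symmetric] sum.distrib by (subst (3) sum.swap) simp
  also have "\<dots> \<le> c/2 * (real N * 1 + real N * 1)"
    using c v w by (intro mult_left_mono add_mono order_trans[OF cnt]) auto
  finally show "cmod (mform m D v w) \<le> c * real N" by simp
qed

text \<open>The Gram kernel of the rows of \<eta>; summing over the support of the first row loses
  nothing. For rows of length one it is positive definite with 1 on the diagonal, which is why
  multiplying entrywise by it does not increase norms.\<close>

definition kern :: "('b \<Rightarrow> 'z \<Rightarrow> real) \<Rightarrow> 'b \<Rightarrow> 'b \<Rightarrow> real" where
  "kern \<eta> y y' = (\<Sum>z\<in>{z. \<eta> y z \<noteq> 0}. \<eta> y z * \<eta> y' z)"

definition unit_rows :: "('b \<Rightarrow> 'z \<Rightarrow> real) \<Rightarrow> bool" where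
  "unit_rows \<eta> \<longleftrightarrow> (\<forall>y. finite {z. \<eta> y z \<noteq> 0} \<and> (\<Sum>z\<in>{z. \<eta> y z \<noteq> 0}. (\<eta> y z)^2) = 1)"

lemma unit_rows_superset:
  assumes "unit_rows \<eta>" "finite Z" "{z. \<eta> y z \<noteq> 0} \<subseteq> Z"
  shows "kern \<eta> y y' = (\<Sum>z\<in>Z. \<eta> y z * \<eta> y' z)" "(\<Sum>z\<in>Z. (\<eta> y z)^2) = 1"
proof -
  show "kern \<eta> y y' = (\<Sum>z\<in>Z. \<eta> y z * \<eta> y' z)"
    unfolding kern_def using assms by (intro sum.mono_neutral_left) auto
  have "(\<Sum>z\<in>Z. (\<eta> y z)^2) = (\<Sum>z\<in>{z. \<eta> y z \<noteq> 0}. (\<eta> y z)^2)"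
    using assms by (intro sum.mono_neutral_right) auto
  then show "(\<Sum>z\<in>Z. (\<eta> y z)^2) = 1" using assms(1) by (simp add: unit_rows_def)
qed

abbreviation schur :: "('b \<Rightarrow> 'z \<Rightarrow> real) \<Rightarrow> ('b \<Rightarrow> 'b vec) \<Rightarrow> 'b \<Rightarrow> 'b vec" where
  "schur \<eta> m \<equiv> \<lambda>y y'. of_real (kern \<eta> y y') * m y y'"

abbreviation cut :: "('b \<Rightarrow> 'z \<Rightarrow> real) \<Rightarrow> 'z \<Rightarrow> 'b vec \<Rightarrow> 'b vec" where
  "cut \<eta> z v \<equiv> \<lambda>y. of_real (\<eta> y z) * v y"

text \<open>Inserting the definition of the kernel writes the multiplied form as a sum of values of
  the original form at the vectors \<open>cut \<eta> z v\<close>, and unit rows make the masses of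
  these vectors add up to the mass of \<open>v\<close>. This gives contractivity, and when
  \<open>\<eta> y z\<close> vanishes for \<open>y\<close> far from \<open>z\<close> it also
  localises the form to balls.\<close>

lemma schur_decompose:
  assumes "unit_rows \<eta>" "finite D"
  shows "\<exists>Z. finite Z \<and>
    (\<forall>m v w. mform (schur \<eta> m) D v w =
       (\<Sum>z\<in>Z. mform m D (cut \<eta> z v) (cut \<eta> z w))) \<and>
    (\<forall>v. (\<Sum>z\<in>Z. mass D (cut \<eta> z v)) = (mass D v))"
proof -
  define Z where "Z = (\<Union>y\<in>D. {z. \<eta> y z \<noteq> 0})"
  have Z: "finite Z" using assms by (auto simp: Z_def unit_rows_def)
  have sup: "{z. \<eta> y z \<noteq> 0} \<subseteq> Z" if "y \<in> D" for y using that by (auto simp: Z_def)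
  have "mform (schur \<eta> m) D v w =
       (\<Sum>z\<in>Z. mform m D (cut \<eta> z v) (cut \<eta> z w))" for m v w
  proof -
    have "mform (schur \<eta> m) D v w =
       (\<Sum>y\<in>D. \<Sum>y'\<in>D. \<Sum>z\<in>Z. m y y' * (of_real (\<eta> y z) * v y) * cnj (of_real (\<eta> y' z) * w y'))"
      unfolding mform_def using unit_rows_superset(1)[OF assms(1) Z sup]
      by (intro sum.cong refl) (simp add: sum_distrib_left sum_distrib_right mult_ac)
    also have "\<dots> = (\<Sum>y\<in>D. \<Sum>z\<in>Z. \<Sum>y'\<in>D. m y y' * (of_real (\<eta> y z) * v y) * cnj (of_real (\<eta> y' z) * w y'))"
      by (intro sum.cong refl sum.swap)
    also have "\<dots> = (\<Sum>z\<in>Z. mform m D (cut \<eta> z v) (cut \<eta> z w))"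
      unfolding mform_def by (rule sum.swap)
    finally show ?thesis .
  qed
  moreover have "(\<Sum>z\<in>Z. mass D (cut \<eta> z v)) = mass D v" for v
  proof -
    have "(\<Sum>z\<in>Z. mass D (cut \<eta> z v)) = (\<Sum>y\<in>D. \<Sum>z\<in>Z. (\<eta> y z)^2 * (cmod (v y))^2)"
      by (subst sum.swap) (simp add: norm_mult power_mult_distrib)
    also have "\<dots> = mass D v"
      using unit_rows_superset(2)[OF assms(1) Z sup] by (intro sum.cong refl) (simp add: sum_distrib_right[symmetric])
    finally show ?thesis .
  qed
  ultimately show ?thesis using Z by (intro exI[of _ Z]) simp
qed

text \<open>Each piece is bounded by \<open>C\<close> times a product of two square roots of masses;
  the inequality of arithmetic and geometric means and the additivity of the masses recombine the
  pieces without loss.\<close>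

lemma mbd_schur:
  fixes m :: "'b \<Rightarrow> 'b vec"
  assumes "unit_rows \<eta>" "mbd m C" shows "mbd (schur \<eta> m) C"
  unfolding mbd_def
proof (intro allI impI)
  fix D and v w :: "'b vec"
  assume D: "finite D" and v: "mass D v \<le> 1" and w: "mass D w \<le> 1"
  obtain Z where Z: "finite Z"
    "\<And>m v w. mform (schur \<eta> m) D v w =
       (\<Sum>z\<in>Z. mform m D (cut \<eta> z v) (cut \<eta> z w))"
    "\<And>v. (\<Sum>z\<in>Z. mass D (cut \<eta> z v)) = mass D v"
    using schur_decompose[OF assms(1) D] by (elim exE conjE) simp
  define V where "V = (\<lambda>v z. mass D (cut \<eta> z v))"
  have "cmod (mform (schur \<eta> m) D v w)
     \<le> (\<Sum>z\<in>Z. C * (sqrt (V v z) * sqrt (V w z)))"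
    unfolding Z(2) V_def by (intro order_trans[OF norm_sum] sum_mono mbdD assms D)
  also have "\<dots> \<le> (\<Sum>z\<in>Z. C * ((V v z + V w z)/2))"
    using mbd_nonneg[OF assms(2)]
    unfolding real_sqrt_mult[symmetric]
    by (intro sum_mono mult_left_mono arith_geo_mean_sqrt) (auto simp: V_def sum_nonneg)
  also have "\<dots> = C * (((mass D v) + (mass D w))/2)"
  proof -
    have "(\<Sum>z\<in>Z. V v z) = mass D v" "(\<Sum>z\<in>Z. V w z) = mass D w"
      unfolding V_def by (rule Z(3))+
    then show ?thesis by (simp only: sum_distrib_left[symmetric] sum_divide_distrib[symmetric] sum.distrib)
  qed
  also have "\<dots> \<le> C * 1" using mbd_nonneg[OF assms(2)] v w by (intro mult_left_mono) auto
  finally show "cmod (mform (schur \<eta> m) D v w) \<le> C" by simp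
qed

text \<open>Converts the summable variation of the probability functions in property A into the
  square-summable variation of their square roots.\<close>

lemma sqrt_diff_sq_le: fixes a b :: real assumes "0 \<le> a" "0 \<le> b" shows "(sqrt a - sqrt b)^2 \<le> \<bar>a - b\<bar>"
proof -
  have "(sqrt a - sqrt b)^2 = \<bar>sqrt a - sqrt b\<bar> * \<bar>sqrt a - sqrt b\<bar>" by (simp add: power2_eq_square)
  also have "\<dots> \<le> \<bar>sqrt a - sqrt b\<bar> * (sqrt a + sqrt b)"
    using real_sqrt_ge_zero[OF assms(1)] real_sqrt_ge_zero[OF assms(2)]
    by (intro mult_left_mono) (auto simp: abs_le_iff)
  also have "\<dots> = \<bar>(sqrt a - sqrt b) * (sqrt a + sqrt b)\<bar>" using assms by (simp add: abs_mult)
  also have "(sqrt a - sqrt b) * (sqrt a + sqrt b) = a - b" using assms by (simp add: algebra_simps)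
  finally show ?thesis .
qed

text \<open>A single index controls both parameters of property A: \<open>n\<close> is the distance
  up to which the kernel is close to 1 and \<open>1 / real (Suc n)\<close> is the precision. The
  radius \<open>S n\<close> of the rows makes the kernel vanish beyond
  \<open>2 * S n\<close>.\<close>

definition kernels :: "(nat \<Rightarrow> 'b::metric_space \<Rightarrow> 'b \<Rightarrow> real) \<Rightarrow> (nat \<Rightarrow> real) \<Rightarrow> bool" where
  "kernels \<eta> S \<longleftrightarrow> (\<forall>n. unit_rows (\<eta> n) \<and> (\<forall>y z. \<eta> n y z \<noteq> 0 \<longrightarrow> dist y z \<le> S n) \<and>
     (\<forall>y y'. dist y y' \<le> real n \<longrightarrow> \<bar>1 - kern (\<eta> n) y y'\<bar> \<le> 1 / real (Suc n)))"

lemma property_A_kernels: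
  assumes "property_A (UNIV :: 'b::metric_space set)"
  obtains \<eta> :: "nat \<Rightarrow> 'b::metric_space \<Rightarrow> 'b \<Rightarrow> real" and S where "kernels \<eta> S"
proof -
  have "\<exists>(\<eta> :: 'b \<Rightarrow> 'b \<Rightarrow> real) S. unit_rows \<eta> \<and> (\<forall>y z. \<eta> y z \<noteq> 0 \<longrightarrow> dist y z \<le> S) \<and>
     (\<forall>y y'. dist y y' \<le> real n \<longrightarrow> \<bar>1 - kern \<eta> y y'\<bar> \<le> 1 / real (Suc n))" for n
  proof -
    \<comment> \<open>Property A asks for a positive radius, so \<open>Suc n\<close> is used in
      place of \<open>n\<close>, which may be 0.\<close>
    have "real (Suc n) > 0" "1 / real (Suc n) > 0" by auto
    note pos = this
    from assms[unfolded property_A_def, THEN spec, THEN mp, OF pos(1), THEN spec, THEN mp, OF pos(2)]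
    obtain S and \<xi> :: "'b \<Rightarrow> 'b \<Rightarrow> real" where
      xi: "(\<forall>x\<in>UNIV. (\<forall>z. \<xi> x z \<ge> 0) \<and> {z. \<xi> x z \<noteq> 0} \<subseteq> cball x S \<inter> UNIV \<and>
              finite {z. \<xi> x z \<noteq> 0} \<and> (\<Sum>z\<in>{z. \<xi> x z \<noteq> 0}. \<xi> x z) = 1) \<and>
        (\<forall>x\<in>UNIV. \<forall>y\<in>UNIV. dist x y \<le> real (Suc n) \<longrightarrow>
          (\<Sum>z\<in>{z. \<xi> x z \<noteq> 0} \<union> {z. \<xi> y z \<noteq> 0}. \<bar>\<xi> x z - \<xi> y z\<bar>) \<le> 1 / real (Suc n))" by (elim exE)
    have x1: "\<xi> x z \<ge> 0" and x2: "{z. \<xi> x z \<noteq> 0} \<subseteq> cball x S" and x3: "finite {z. \<xi> x z \<noteq> 0}"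
      and x4: "(\<Sum>z\<in>{z. \<xi> x z \<noteq> 0}. \<xi> x z) = 1" for x z
      using xi[THEN conjunct1, THEN bspec, OF UNIV_I, of x] by auto
    have x5: "(\<Sum>z\<in>{z. \<xi> x z \<noteq> 0} \<union> {z. \<xi> y z \<noteq> 0}. \<bar>\<xi> x z - \<xi> y z\<bar>) \<le> 1 / real (Suc n)"
      if "dist x y \<le> real (Suc n)" for x y
      by (rule xi[THEN conjunct2, THEN bspec, OF UNIV_I, THEN bspec, OF UNIV_I, THEN mp, OF that])
    define \<eta> where "\<eta> = (\<lambda>y z. sqrt (\<xi> y z))"
    have supp: "{z. \<eta> y z \<noteq> 0} = {z. \<xi> y z \<noteq> 0}" for y by (simp add: \<eta>_def)
    have u: "unit_rows \<eta>" unfolding unit_rows_def supp using x3 x4 x1 by (simp add: \<eta>_def)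
    have "\<bar>1 - kern \<eta> y y'\<bar> \<le> 1 / real (Suc n)" if "dist y y' \<le> real n" for y y'
    proof -
      define Z where "Z = {z. \<xi> y z \<noteq> 0} \<union> {z. \<xi> y' z \<noteq> 0}"
      have Z: "finite Z" "{z. \<eta> y z \<noteq> 0} \<subseteq> Z" "{z. \<eta> y' z \<noteq> 0} \<subseteq> Z" using x3 by (auto simp: Z_def supp)
      \<comment> \<open>For unit vectors, the squared distance is twice the defect of the inner
        product from 1.\<close>
      have eq: "2 * (1 - kern \<eta> y y') = (\<Sum>z\<in>Z. (\<eta> y z - \<eta> y' z)^2)"
        using unit_rows_superset[OF u Z(1,2)] unit_rows_superset(2)[OF u Z(1,3)]
        by (simp add: power2_diff sum.distrib sum_subtractf sum_distrib_left[symmetric] mult.assoc)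
      have "(\<Sum>z\<in>Z. (\<eta> y z - \<eta> y' z)^2) \<le> (\<Sum>z\<in>Z. \<bar>\<xi> y z - \<xi> y' z\<bar>)"
        unfolding \<eta>_def by (intro sum_mono sqrt_diff_sq_le x1)
      also have "\<dots> \<le> 1 / real (Suc n)" using x5[of y y'] that by (simp add: Z_def)
      finally have "2 * (1 - kern \<eta> y y') \<le> 1 / real (Suc n)" using eq by simp
      moreover have "0 \<le> 2 * (1 - kern \<eta> y y')" unfolding eq by (simp add: sum_nonneg)
      ultimately have "\<bar>1 - kern \<eta> y y'\<bar> \<le> 2 * (1 - kern \<eta> y y')" "2 * (1 - kern \<eta> y y') \<le> 1 / real (Suc n)" by auto
      then show ?thesis by (rule order_trans)
    qed
    moreover have "dist y z \<le> S" if "\<eta> y z \<noteq> 0" for y z using that x2[of y] supp[of y] by auto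
    ultimately show ?thesis using u by blast
  qed
  then obtain \<eta> :: "nat \<Rightarrow> 'b \<Rightarrow> 'b \<Rightarrow> real" and S where "\<And>n. unit_rows (\<eta> n) \<and> (\<forall>y z. \<eta> n y z \<noteq> 0 \<longrightarrow> dist y z \<le> S n) \<and>
     (\<forall>y y'. dist y y' \<le> real n \<longrightarrow> \<bar>1 - kern (\<eta> n) y y'\<bar> \<le> 1 / real (Suc n))" by metis
  then show ?thesis using that[of \<eta> S] by (simp add: kernels_def)
qed

lemma kern_far: assumes "kernels \<eta> S" "dist y y' > 2 * S n" shows "kern (\<eta> n) y y' = 0"
  unfolding kern_def
proof (rule sum.neutral, rule ballI)
  fix z assume "z \<in> {z. \<eta> n y z \<noteq> 0}"
  then have "dist y z \<le> S n" using assms(1) by (auto simp: kernels_def)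
  then have "\<not> dist y' z \<le> S n" using assms(2) dist_triangle2[of y y' z] by linarith
  then have "\<eta> n y' z = 0" using assms(1) by (auto simp: kernels_def)
  then show "\<eta> n y z * \<eta> n y' z = 0" by simp
qed

text \<open>The error of the Schur approximation: \<open>m\<close> minus its entrywise product with
  the kernel. A bound \<open>mbd (ckern \<eta> n m) e\<close> places \<open>m\<close> within
  \<open>e\<close> of a matrix of propagation at most \<open>2 * S n\<close>.\<close>

definition ckern :: "(nat \<Rightarrow> 'b \<Rightarrow> 'b \<Rightarrow> real) \<Rightarrow> nat \<Rightarrow> ('b \<Rightarrow> 'b \<Rightarrow> complex) \<Rightarrow> 'b \<Rightarrow> 'b vec" where
  "ckern \<eta> n m = (\<lambda>y y'. of_real (1 - kern (\<eta> n) y y') * m y y')"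

text \<open>For a finite propagation \<open>b\<close> near \<open>a\<close> the error matrix has
  uniformly small entries and falls under the Schur test; the remainder \<open>a - b\<close>
  contributes its own norm and that of its Schur product, which is no larger.\<close>

lemma roe_schur_approx:
  fixes a :: "'b::metric_space op"
  assumes ulf: "ulf (UNIV :: 'b set)" and K: "kernels \<eta> S" and a: "a \<in> roe_alg" and e: "e > 0"
  shows "\<exists>n0. \<forall>n\<ge>n0. mbd (ckern \<eta> n (entry a)) e"
proof -
  obtain b where b: "bounded_op b" "finite_prop b" "opnorm (op_minus a b) \<le> e/4"
    using roe_approx[OF a, of "e/4"] e by auto
  obtain r where r: "propg_le b r" using b(2) by (auto simp: finite_prop_def)
  obtain N :: nat where N: "\<And>y::'b. finite (cball y r)" "\<And>y::'b. card (cball y r) \<le> N"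
    using ulf unfolding ulf_def by (metis Int_UNIV_right UNIV_I)
  \<comment> \<open>Exceeding \<open>r\<close> puts the support of \<open>b\<close> where the kernel
    is close to 1; the second bound pushes the Schur test estimate below \<open>e/2\<close>.\<close>
  obtain n0 :: nat where n0: "real n0 > max r (2 * opnorm b * real N / e)" using reals_Archimedean2 by blast
  have "mbd (ckern \<eta> n (entry a)) e" if n: "n \<ge> n0" for n
  proof -
    have nr: "r \<le> real n" "2 * opnorm b * real N / e \<le> real (Suc n)" using n0 n by (auto simp: max_def split: if_splits)
    have "mbd (ckern \<eta> n (entry b)) (opnorm b * (1 / real (Suc n)) * real N)"
    proof (rule mbd_schur_test[OF _ _ N])
      show "dist y y' \<le> r" if "ckern \<eta> n (entry b) y y' \<noteq> 0" for y y'
        using that r by (auto simp: ckern_def propg_le_def)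
      then have *: "ckern \<eta> n (entry b) y y' = 0" if "\<not> dist y y' \<le> r" for y y' using that by blast
      show "cmod (ckern \<eta> n (entry b) y y') \<le> opnorm b * (1 / real (Suc n))" for y y'
      proof (cases "dist y y' \<le> r")
        case True
        then have "\<bar>1 - kern (\<eta> n) y y'\<bar> \<le> 1 / real (Suc n)" using K nr(1) unfolding kernels_def by (meson order_trans)
        then have "\<bar>1 - kern (\<eta> n) y y'\<bar> * cmod (entry b y y') \<le> 1 / real (Suc n) * opnorm b"
          using entry_le_opnorm[OF b(1)] by (intro mult_mono) auto
        then show ?thesis by (simp add: ckern_def norm_mult mult.commute del: of_real_diff)
      qed (use * opnorm_nonneg[OF b(1)] in simp)
    qed
    moreover have "opnorm b * (1 / real (Suc n)) * real N \<le> e/2" using nr(2) e by (simp add: field_simps)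
    ultimately have 1: "mbd (ckern \<eta> n (entry b)) (e/2)" by (rule mbd_mono)
    have 2: "mbd (entry (op_minus a b)) (e/4)"
      using mbd_entry[of "op_minus a b"] a b by (intro mbd_mono[OF _ b(3)]) auto
    have 3: "mbd (\<lambda>y y'. of_real (kern (\<eta> n) y y') * entry (op_minus a b) y y') (e/4)"
      using K by (intro mbd_schur 2) (auto simp: kernels_def)
    have "ckern \<eta> n (entry a) = (\<lambda>y y'. ckern \<eta> n (entry b) y y' +
       (entry (op_minus a b) y y' - of_real (kern (\<eta> n) y y') * entry (op_minus a b) y y'))"
      by (auto simp: ckern_def entry_eq op_minus_def algebra_simps fun_eq_iff)
    then show ?thesis using mbd_add[OF 1 mbd_diff[OF 2 3]] by simp
  qed
  then show ?thesis by blast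
qed

section \<open>Equi-approximability\<close>

definition msum :: "('i \<Rightarrow> 'b \<Rightarrow> 'b \<Rightarrow> complex) \<Rightarrow> 'i set \<Rightarrow> 'b \<Rightarrow> 'b vec" where
  "msum t M = (\<lambda>y y'. \<Sum>\<^sub>\<infinity>i\<in>M. t i y y')"

lemma msum_split:
  assumes "\<And>y y'. (\<lambda>i. cmod (t i y y')) summable_on UNIV" "M \<inter> N = {}"
  shows "msum t (M \<union> N) = (\<lambda>y y'. msum t M y y' + msum t N y y')"
proof (intro ext)
  fix y y'
  have s: "(\<lambda>i. t i y y') summable_on K" for K
    using summable_on_subset_banach[OF abs_summable_summable[OF assms(1)]] by blast
  show "msum t (M \<union> N) y y' = msum t M y y' + msum t N y y'"
    unfolding msum_def by (rule infsum_Un_disjoint[OF s s assms(2)])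
qed

text \<open>Continuity of the sum as a function of the index set: two sets that agree on a large
  enough finite window give nearly equal sums, since each leaves a tail of at most
  \<open>e/2\<close>.\<close>

lemma abs_summable_tail:
  fixes g :: "'i \<Rightarrow> complex"
  assumes g: "(\<lambda>i. cmod (g i)) summable_on UNIV" and e: "e > 0"
  obtains F where "finite F" "\<And>F' M M'. F \<subseteq> F' \<Longrightarrow> M \<inter> F' = M' \<inter> F' \<Longrightarrow> cmod ((\<Sum>\<^sub>\<infinity>i\<in>M. g i) - (\<Sum>\<^sub>\<infinity>i\<in>M'. g i)) \<le> e"
proof -
  obtain F where F: "finite F" "dist (\<Sum>i\<in>F. cmod (g i)) (\<Sum>\<^sub>\<infinity>i. cmod (g i)) \<le> e/2"
    using infsum_finite_approximation[OF g, of "e/2"] e by auto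
  have gs: "(\<lambda>i. cmod (g i)) summable_on K" for K using summable_on_subset_banach[OF g] by blast
  have s: "g summable_on K" for K by (rule abs_summable_summable[OF gs])
  have "(\<Sum>\<^sub>\<infinity>i\<in>F \<union> -F. cmod (g i)) = (\<Sum>\<^sub>\<infinity>i\<in>F. cmod (g i)) + (\<Sum>\<^sub>\<infinity>i\<in>-F. cmod (g i))"
    by (rule infsum_Un_disjoint[OF gs gs]) auto
  then have tail: "(\<Sum>\<^sub>\<infinity>i\<in>-F. cmod (g i)) \<le> e/2" using F by (simp add: dist_real_def)
  have small: "cmod (\<Sum>\<^sub>\<infinity>i\<in>K. g i) \<le> e/2" if "K \<subseteq> -F" for K
  proof -
    have "cmod (\<Sum>\<^sub>\<infinity>i\<in>K. g i) \<le> (\<Sum>\<^sub>\<infinity>i\<in>K. cmod (g i))" by (rule norm_infsum_bound[OF gs])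
    also have "\<dots> \<le> (\<Sum>\<^sub>\<infinity>i\<in>-F. cmod (g i))" using that by (intro infsum_mono_neutral gs) auto
    finally show ?thesis using tail by simp
  qed
  show ?thesis
  proof (rule that[OF F(1)])
    fix F' M M' assume FF: "F \<subseteq> F'" and MM: "M \<inter> F' = M' \<inter> F'"
    have sp: "(\<Sum>\<^sub>\<infinity>i\<in>M. g i) = (\<Sum>\<^sub>\<infinity>i\<in>M \<inter> F'. g i) + (\<Sum>\<^sub>\<infinity>i\<in>M - F'. g i)" for M
    proof -
      have "(\<Sum>\<^sub>\<infinity>i\<in>(M \<inter> F') \<union> (M - F'). g i) = (\<Sum>\<^sub>\<infinity>i\<in>M \<inter> F'. g i) + (\<Sum>\<^sub>\<infinity>i\<in>M - F'. g i)"
        by (rule infsum_Un_disjoint[OF s s]) auto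
      then show ?thesis by (simp add: Int_Diff_Un)
    qed
    have "(\<Sum>\<^sub>\<infinity>i\<in>M. g i) - (\<Sum>\<^sub>\<infinity>i\<in>M'. g i) = (\<Sum>\<^sub>\<infinity>i\<in>M - F'. g i) - (\<Sum>\<^sub>\<infinity>i\<in>M' - F'. g i)"
      using sp[of M] sp[of M'] MM by simp
    also have "cmod \<dots> \<le> e/2 + e/2"
      using small[of "M - F'"] small[of "M' - F'"] FF by (intro order_trans[OF norm_triangle_ineq4] add_mono) auto
    finally show "cmod ((\<Sum>\<^sub>\<infinity>i\<in>M. g i) - (\<Sum>\<^sub>\<infinity>i\<in>M'. g i)) \<le> e" by simp
  qed
qed

text \<open>For fixed finite \<open>D\<close> and fixed vectors the form depends on finitely many
  entries only, so exceeding a bound is an open condition on the matrix.\<close>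

lemma mform_small:
  assumes "finite D" "0 < e"
  obtains d where "d > 0" "\<And>m m'. (\<And>y y'. y \<in> D \<Longrightarrow> y' \<in> D \<Longrightarrow> cmod (m y y' - m' y y') \<le> d) \<Longrightarrow>
      cmod (mform (ckern \<eta> n m) D v w - mform (ckern \<eta> n m') D v w) \<le> e"
proof -
  define c where "c = (\<lambda>y y'. cmod (of_real (1 - kern (\<eta> n) y y')) * cmod (v y) * cmod (w y'))"
  define T where "T = (\<Sum>y\<in>D. \<Sum>y'\<in>D. c y y')"
  have T: "T \<ge> 0" by (simp add: T_def c_def sum_nonneg)
  show ?thesis
  proof (rule that[of "e / (T + 1)"])
    show "e / (T + 1) > 0" using assms T by simp
    fix m m' assume *: "\<And>y y'. y \<in> D \<Longrightarrow> y' \<in> D \<Longrightarrow> cmod (m y y' - m' y y') \<le> e / (T + 1)"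
    have "mform (ckern \<eta> n m) D v w - mform (ckern \<eta> n m') D v w
      = (\<Sum>y\<in>D. \<Sum>y'\<in>D. of_real (1 - kern (\<eta> n) y y') * (m y y' - m' y y') * v y * cnj (w y'))"
      unfolding mform_diff[symmetric] unfolding mform_def ckern_def by (simp only: right_diff_distrib)
    also have "cmod \<dots> \<le> (\<Sum>y\<in>D. \<Sum>y'\<in>D. cmod (of_real (1 - kern (\<eta> n) y y') * (m y y' - m' y y') * v y * cnj (w y')))"
      by (intro order_trans[OF norm_sum] sum_mono norm_sum)
    also have "\<dots> \<le> (\<Sum>y\<in>D. \<Sum>y'\<in>D. c y y' * (e / (T + 1)))"
    proof (intro sum_mono)
      fix y y' assume "y \<in> D" "y' \<in> D"
      then have "c y y' * cmod (m y y' - m' y y') \<le> c y y' * (e / (T + 1))"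
        by (intro mult_left_mono *) (auto simp: c_def)
      then show "cmod (of_real (1 - kern (\<eta> n) y y') * (m y y' - m' y y') * v y * cnj (w y')) \<le> c y y' * (e / (T + 1))"
        unfolding c_def norm_mult complex_mod_cnj by (simp only: mult_ac)
    qed
    also have "\<dots> = T * (e / (T + 1))" unfolding sum_distrib_right[symmetric] T_def[symmetric] ..
    also have "\<dots> \<le> e" using T assms by (simp add: field_simps)
    finally show "cmod (mform (ckern \<eta> n m) D v w - mform (ckern \<eta> n m') D v w) \<le> e" .
  qed
qed

lemma ckern_add: "ckern \<eta> n (\<lambda>y y'. m y y' + m' y y') = (\<lambda>y y'. ckern \<eta> n m y y' + ckern \<eta> n m' y y')"
  by (simp add: ckern_def distrib_left)

text \<open>If no single \<open>n\<close> serves all \<open>M\<close>, then the sets whose error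
  exceeds \<open>e/4\<close> at some index beyond \<open>j\<close> are dense for each
  \<open>j\<close>, and the same holds throughout a basic open set. Baire yields one set whose error
  exceeds \<open>e/4\<close> at arbitrarily large indices, against the assumed approximability of
  that set.\<close>

lemma equi_approximable:
  fixes t :: "'i \<Rightarrow> 'b \<Rightarrow> 'b vec"
  assumes t: "\<And>y y'. (\<lambda>i. cmod (t i y y')) summable_on UNIV"
    and ap: "\<And>M e. e > 0 \<Longrightarrow> \<exists>n0. \<forall>n\<ge>n0. mbd (ckern \<eta> n (msum t M)) e"
    and e: "e > 0"
  shows "\<exists>n. \<forall>M. mbd (ckern \<eta> n (msum t M)) e"
proof (rule ccontr)
  assume neg: "\<not> ?thesis"
  have "\<exists>M. \<forall>j::nat. \<exists>n\<ge>j. \<not> mbd (ckern \<eta> n (msum t M)) (e/4)"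
  proof (rule baire_subsets)
    fix j :: nat and F S :: "'i set" assume F: "finite F" and SF: "S \<subseteq> F"
    have "\<forall>M\<in>Pow F. \<exists>n0. \<forall>n\<ge>n0. mbd (ckern \<eta> n (msum t M)) (e/4)" using ap[of "e/4"] e by auto
    then obtain n0 where n0: "\<And>M n. M \<subseteq> F \<Longrightarrow> n \<ge> n0 M \<Longrightarrow> mbd (ckern \<eta> n (msum t M)) (e/4)" by (metis PowI)
    \<comment> \<open>One index beyond \<open>j\<close> at which all subsets of the finite window
      \<open>F\<close> have error at most \<open>e/4\<close>; these are the parts that get
      exchanged.\<close>
    define n where "n = Max (insert j (n0 ` Pow F))"
    have nj: "j \<le> n" unfolding n_def using F by (intro Max_ge) auto
    have small: "mbd (ckern \<eta> n (msum t M)) (e/4)" if "M \<subseteq> F" for M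
      using that F by (intro n0) (auto simp: n_def intro!: Max_ge)
    obtain M where M: "\<not> mbd (ckern \<eta> n (msum t M)) e" using neg by blast
    \<comment> \<open>The trace on \<open>F\<close> is replaced by the prescribed \<open>S\<close>.
      The exchange of two small parts costs at most \<open>e/2\<close>, so an error above
      \<open>e\<close> leaves one above \<open>e/2\<close>.\<close>
    define M2 where "M2 = (M - F) \<union> S"
    have "mbd (ckern \<eta> n (msum t M)) (C + e/4 + e/4)" if "mbd (ckern \<eta> n (msum t M2)) C" for C
    proof -
      have e1: "msum t M = (\<lambda>y y'. msum t (M - F) y y' + msum t (M \<inter> F) y y')"
      proof -
        have "M - F \<union> M \<inter> F = M" "(M - F) \<inter> (M \<inter> F) = {}" by auto
        then show ?thesis using msum_split[of t "M - F" "M \<inter> F", OF t] by simp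
      qed
      have e2: "msum t M2 = (\<lambda>y y'. msum t (M - F) y y' + msum t S y y')"
        unfolding M2_def by (rule msum_split[of t "M - F" S, OF t]) (use SF in auto)
      have "ckern \<eta> n (msum t M) = (\<lambda>y y'. (ckern \<eta> n (msum t M2) y y' - ckern \<eta> n (msum t S) y y') + ckern \<eta> n (msum t (M \<inter> F)) y y')"
        unfolding e1 e2 ckern_add by simp
      then show ?thesis using mbd_add[OF mbd_diff[OF that small[OF SF]] small[of "M \<inter> F"]] by simp
    qed
    from this[of "e/2"] have "\<not> mbd (ckern \<eta> n (msum t M2)) (e/2)" using M by auto
    then obtain D v w where D: "finite D" "mass D v \<le> 1" "mass D w \<le> 1"
      and big: "cmod (mform (ckern \<eta> n (msum t M2)) D v w) > e/2" unfolding mbd_def by (auto simp: not_le)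
    obtain d where d: "d > 0" "\<And>m m'. (\<And>y y'. y \<in> D \<Longrightarrow> y' \<in> D \<Longrightarrow> cmod (m y y' - m' y y') \<le> d) \<Longrightarrow>
      cmod (mform (ckern \<eta> n m) D v w - mform (ckern \<eta> n m') D v w) \<le> e/4"
      using mform_small[OF D(1), of "e/4" \<eta> n v w] e by auto
    have "\<exists>F0. finite F0 \<and> (\<forall>F' M M'. F0 \<subseteq> F' \<longrightarrow> M \<inter> F' = M' \<inter> F' \<longrightarrow> cmod (msum t M y y' - msum t M' y y') \<le> d)" for y y'
      unfolding msum_def using abs_summable_tail[OF t d(1), of y y'] by metis
    then obtain F0 where F0: "\<And>y y'. finite (F0 y y')"
      "\<And>y y' F' M M'. F0 y y' \<subseteq> F' \<Longrightarrow> M \<inter> F' = M' \<inter> F' \<Longrightarrow> cmod (msum t M y y' - msum t M' y y') \<le> d" by metis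
    \<comment> \<open>Freezing this window fixes the entries on \<open>D\<close> up to
      \<open>d\<close>, so the witnesses \<open>D\<close>, \<open>v\<close>, \<open>w\<close> still
      show an error above \<open>e/4\<close>; containing \<open>F\<close> keeps the trace
      \<open>S\<close>.\<close>
    define F' where "F' = F \<union> (\<Union>y\<in>D. \<Union>y'\<in>D. F0 y y')"
    have F': "finite F'" "F \<subseteq> F'" "\<And>y y'. y \<in> D \<Longrightarrow> y' \<in> D \<Longrightarrow> F0 y y' \<subseteq> F'" using F F0(1) D(1) by (auto simp: F'_def)
    have key: "\<exists>n\<ge>j. \<not> mbd (ckern \<eta> n (msum t M')) (e/4)" if M': "M' \<inter> F' = M2 \<inter> F'" for M'
    proof -
      have "cmod (mform (ckern \<eta> n (msum t M2)) D v w - mform (ckern \<eta> n (msum t M')) D v w) \<le> e/4"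
        using F0(2)[OF F'(3)] M' by (intro d(2)) metis
      then have "cmod (mform (ckern \<eta> n (msum t M')) D v w) > e/4"
        using big norm_triangle_sub[of "mform (ckern \<eta> n (msum t M2)) D v w" "mform (ckern \<eta> n (msum t M')) D v w"] by linarith
      then have "\<not> mbd (ckern \<eta> n (msum t M')) (e/4)" using D unfolding mbd_def by (meson not_le)
      then show ?thesis using nj by blast
    qed
    have "(M2 \<inter> F') \<inter> F = S" using F'(2) SF by (auto simp: M2_def)
    then show "\<exists>F' S'. finite F' \<and> F \<subseteq> F' \<and> S' \<subseteq> F' \<and> S' \<inter> F = S \<and>
       (\<forall>M. M \<inter> F' = S' \<longrightarrow> (\<exists>n\<ge>j. \<not> mbd (ckern \<eta> n (msum t M)) (e/4)))"
      by (intro exI[of _ F'] exI[of _ "M2 \<inter> F'"] conjI allI impI F' Int_lower2 key)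
  qed
  then obtain M where "\<forall>j::nat. \<exists>n\<ge>j. \<not> mbd (ckern \<eta> n (msum t M)) (e/4)" by blast
  then show False using ap[of "e/4" M] e by (metis divide_pos_pos zero_less_numeral)
qed

section \<open>Orthonormal families\<close>

definition orthonormal :: "('a \<Rightarrow> 'b \<Rightarrow> complex) \<Rightarrow> bool" where
  "orthonormal \<xi> \<longleftrightarrow> (\<forall>x. \<xi> x \<in> l2) \<and> (\<forall>x x'. l2inner (\<xi> x) (\<xi> x') = (if x = x' then 1 else 0))"

lemma orthonormal_norm_sum:
  assumes "orthonormal \<xi>" "finite F"
  shows "(l2norm (\<lambda>y. \<Sum>x\<in>F. c x * \<xi> x y))^2 = mass F c"
proof -
  have l: "(\<lambda>y. c x * \<xi> x y) \<in> l2" for x using assms by (auto simp: orthonormal_def l2_scale)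
  have "complex_of_real ((l2norm (\<lambda>y. \<Sum>x\<in>F. c x * \<xi> x y))^2) = (\<Sum>x\<in>F. \<Sum>x'\<in>F. c x * cnj (c x') * l2inner (\<xi> x) (\<xi> x'))"
    unfolding l2inner_self[symmetric] l2inner_sum_left[OF assms(2) l l2_sum[OF l]] l2inner_sum_right[OF assms(2) l l]
    by (intro sum.cong refl) (simp add: l2inner_scale_left l2inner_scale_right)
  also have "\<dots> = (\<Sum>x\<in>F. \<Sum>x'\<in>F. if x = x' then c x * cnj (c x') else 0)"
    using assms by (intro sum.cong refl) (auto simp: orthonormal_def)
  also have "\<dots> = (\<Sum>x\<in>F. c x * cnj (c x))" using assms(2) by simp
  also have "\<dots> = complex_of_real (mass F c)" unfolding of_real_sum complex_norm_square ..
  finally show ?thesis by (simp only: of_real_eq_iff)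
qed

lemma bessel_finite:
  assumes "orthonormal \<xi>" "w \<in> l2" "finite F"
  shows "(\<Sum>x\<in>F. (cmod (l2inner w (\<xi> x)))^2) \<le> (l2norm w)^2"
proof -
  define c where "c = (\<lambda>x. l2inner w (\<xi> x))"
  define s where "s = (\<lambda>y. \<Sum>x\<in>F. c x * \<xi> x y)"
  define T where "T = mass F c"
  have xi: "\<xi> x \<in> l2" for x using assms by (auto simp: orthonormal_def)
  have s: "s \<in> l2" unfolding s_def by (intro l2_sum l2_scale xi)
  have sn: "(l2norm s)^2 = T" unfolding s_def T_def by (rule orthonormal_norm_sum[OF assms(1,3)])
  have "l2inner w s = (\<Sum>x\<in>F. cnj (c x) * c x)"
    unfolding s_def by (simp add: l2inner_sum_right[OF assms(3)] l2_scale xi assms(2) l2inner_scale_right c_def)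
  also have "\<dots> = of_real T" unfolding T_def of_real_sum complex_norm_square by (simp add: mult.commute)
  finally have "T \<le> cmod (l2inner w s)" by simp
  also have "\<dots> \<le> l2norm w * l2norm s" by (rule l2_CS[OF assms(2) s])
  finally have *: "l2norm s * l2norm s \<le> l2norm w * l2norm s" using sn by (simp add: power2_eq_square)
  have "l2norm s \<le> l2norm w"
  proof (cases "l2norm s = 0")
    case False then show ?thesis using l2norm_nonneg[of s] by (intro mult_right_le_imp_le[OF *]) linarith
  qed simp
  then have "(l2norm s)^2 \<le> (l2norm w)^2" by (intro power_mono) auto
  then show ?thesis unfolding sn T_def c_def .
qed

lemma bessel:
  assumes "orthonormal \<xi>" "w \<in> l2"
  shows "(\<lambda>x. l2inner w (\<xi> x)) \<in> l2" "l2norm (\<lambda>x. l2inner w (\<xi> x)) \<le> l2norm w"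
proof -
  show "(\<lambda>x. l2inner w (\<xi> x)) \<in> l2" using bessel_finite[OF assms] by (rule l2I)
  then show "l2norm (\<lambda>x. l2inner w (\<xi> x)) \<le> l2norm w" using bessel_finite[OF assms] by (intro l2norm_leI) auto
qed

text \<open>Parseval's identity in the range of \<open>p\<close>. The sum of the Fourier series of
  \<open>u\<close> is taken as the adjoint of the coefficient map applied to the coefficients of
  \<open>u\<close>, which replaces a convergence argument; the difference from \<open>u\<close> lies
  in the range of \<open>p\<close> and is orthogonal to every \<xi>\<open>x\<close>, hence
  zero.\<close>

lemma orthonormal_complete_inner:
  fixes \<xi> :: "'a \<Rightarrow> 'b vec" and p :: "'b op"
  assumes on: "orthonormal \<xi>" and p: "bounded_op p" and sa: "\<And>v w. v \<in> l2 \<Longrightarrow> w \<in> l2 \<Longrightarrow> l2inner (p v) w = l2inner v (p w)"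
    and px: "\<And>x. p (\<xi> x) = \<xi> x"
    and complete: "\<And>v. v \<in> l2 \<Longrightarrow> p v = v \<Longrightarrow> (\<And>x. l2inner v (\<xi> x) = 0) \<Longrightarrow> v = (\<lambda>y. 0)"
    and u: "u \<in> l2" "p u = u" and w: "w \<in> l2"
  shows "l2inner u w = l2inner (\<lambda>x. l2inner u (\<xi> x)) (\<lambda>x. l2inner w (\<xi> x))"
proof -
  define V where "V = (\<lambda>w x. l2inner w (\<xi> x))"
  have xi: "\<xi> x \<in> l2" for x using on by (auto simp: orthonormal_def)
  have "\<exists>U. (\<forall>c\<in>l2. U c \<in> l2 \<and> l2norm (U c) \<le> 1 * l2norm c) \<and> (\<forall>c. c \<notin> l2 \<longrightarrow> U c = (\<lambda>x. 0)) \<and>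
    (\<forall>w\<in>l2. \<forall>c\<in>l2. l2inner (V w) c = l2inner w (U c))"
    by (rule adjoint_exists) (auto simp: V_def bessel[OF on] l2inner_add_left l2inner_scale_left xi)
  then obtain U where U: "\<And>c. c \<in> l2 \<Longrightarrow> U c \<in> l2"
    and adj: "\<And>w c. w \<in> l2 \<Longrightarrow> c \<in> l2 \<Longrightarrow> l2inner (V w) c = l2inner w (U c)" by (elim exE conjE) auto
  have V: "V w \<in> l2" if "w \<in> l2" for w unfolding V_def by (rule bessel[OF on that])
  define u' where "u' = U (V u)"
  have u': "u' \<in> l2" unfolding u'_def by (intro U V u)
  have inner: "l2inner u' w = l2inner (V u) (V w)" if "w \<in> l2" for w
    unfolding u'_def by (metis adj[OF that V[OF u(1)]] l2inner_cnj)
  have Vp: "V (p w) = V w" if "w \<in> l2" for w unfolding V_def using sa[OF that xi] px by simp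
  \<comment> \<open>Coefficients do not change under \<open>p\<close>, so by duality the synthesis
    map takes values in the range of \<open>p\<close>.\<close>
  have pu': "p u' = u'"
  proof
    fix y
    have "l2inner (p u') (delta y) = l2inner u' (delta y)"
      using sa[OF u' delta_l2] inner[OF bop_l2[OF p, of "delta y"]] Vp[OF delta_l2, of y] inner[OF delta_l2] by simp
    then show "p u' y = u' y" by simp
  qed
  have "V (\<xi> x) = delta x" for x using on by (auto simp: V_def orthonormal_def delta_def fun_eq_iff)
  then have ux: "l2inner u' (\<xi> x) = l2inner u (\<xi> x)" for x using inner[OF xi, of x] by (simp add: V_def)
  have "(\<lambda>y. u y - u' y) = (\<lambda>y. 0)"
  proof (rule complete)
    show "(\<lambda>y. u y - u' y) \<in> l2" by (intro l2_minus u u')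
    show "p (\<lambda>y. u y - u' y) = (\<lambda>y. u y - u' y)" by (simp add: bop_minus[OF p u(1) u'] u pu')
    show "l2inner (\<lambda>y. u y - u' y) (\<xi> x) = 0" for x by (simp add: l2inner_minus_left u u' xi ux)
  qed
  then have "u = u'" by (auto simp: fun_eq_iff)
  then show ?thesis using inner[OF w] by (simp add: V_def)
qed

section \<open>Roe Cartan embeddings are spatial\<close>

locale roe_cartan_embedding =
  fixes \<Phi> :: "('a::metric_space) op \<Rightarrow> ('b::metric_space) op" and A :: "'b op set"
  assumes emb: "embedding \<Phi> (roe_alg :: 'a op set) (roe_alg :: 'b op set)"
    and her: "hereditary A (roe_alg :: 'b op set)"
    and rc: "roe_cartan A (\<Phi> ` (linf_diag :: 'a op set))"
begin

lemma Phi_roe: "a \<in> roe_alg \<Longrightarrow> \<Phi> a \<in> roe_alg"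
  using emb by (auto simp: embedding_def)

lemma Phi_bounded: "a \<in> roe_alg \<Longrightarrow> bounded_op (\<Phi> a)"
  using Phi_roe roe_bounded by blast

lemma Phi_mult: "a \<in> roe_alg \<Longrightarrow> b \<in> roe_alg \<Longrightarrow> \<Phi> (op_mult a b) = op_mult (\<Phi> a) (\<Phi> b)"
  using emb by (auto simp: embedding_def star_hom_def)

lemma Phi_scale: "a \<in> roe_alg \<Longrightarrow> \<Phi> (op_scale c a) = op_scale c (\<Phi> a)"
  using emb by (auto simp: embedding_def star_hom_def)

lemma Phi_adj: "a \<in> roe_alg \<Longrightarrow> \<Phi> (op_adj a) = op_adj (\<Phi> a)"
  using emb by (auto simp: embedding_def star_hom_def)

lemma Phi_zero: "\<Phi> op_zero = op_zero"
proof -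
  have "op_zero = op_scale 0 (trans_op {(undefined :: 'a, undefined)})" by (auto simp: op_zero_def op_scale_def)
  then have "\<Phi> op_zero = op_scale 0 (\<Phi> (trans_op {(undefined, undefined)}))"
    using Phi_scale[of "trans_op {(undefined, undefined)}" 0] by simp
  then show ?thesis by (auto simp: op_zero_def op_scale_def)
qed

lemma Phi_eq_zero: assumes "a \<in> roe_alg" "\<Phi> a = op_zero" shows "a = op_zero"
proof -
  have "op_zero \<in> (roe_alg :: 'a op set)"
    using roe_scale[of "trans_op {(undefined, undefined)}" 0] by (simp add: op_zero_def op_scale_def)
  then show ?thesis using emb assms Phi_zero unfolding embedding_def inj_on_def by metis
qed

lemma Phi_trans_adjoint:
  assumes "pinj G" "trans_op G \<in> roe_alg" "v \<in> l2" "w \<in> l2"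
  shows "l2inner (\<Phi> (trans_op G) v) w = l2inner v (\<Phi> (trans_op (G\<inverse>)) w)"
  using op_adj(2)[OF Phi_bounded[OF assms(2)] assms(3,4)] Phi_adj[OF assms(2)] op_adj_trans_op[OF assms(1)] by simp

abbreviation "mu \<equiv> (\<lambda>x x'. trans_op {(x, x')})"

text \<open>\<Phi> is not assumed to be unital; its whole image lives in the corner cut out by this
  projection.\<close>

definition p :: "'b op" where "p = \<Phi> (trans_op (Id_on UNIV))"

lemma id_linf: "trans_op (Id_on UNIV) \<in> linf_diag" by (rule trans_op_Id_on_linf)
lemma id_roe: "trans_op (Id_on UNIV) \<in> roe_alg" using id_linf linf_subset_roe by blast

lemma e_linf: "mu x x \<in> linf_diag"
proof -
  have "{(x, x)} = Id_on {x}" by auto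
  then show ?thesis using trans_op_Id_on_linf by metis
qed

lemma p_roe: "p \<in> roe_alg" unfolding p_def by (rule Phi_roe[OF id_roe])
lemma p_bounded: "bounded_op p" using p_roe by simp

lemma p_mult: assumes "a \<in> roe_alg" shows "op_mult p (\<Phi> a) = \<Phi> a" "op_mult (\<Phi> a) p = \<Phi> a"
  unfolding p_def using assms
  by (simp_all add: Phi_mult[symmetric] id_roe trans_op_identity)

lemma p_Phi: "a \<in> roe_alg \<Longrightarrow> p (\<Phi> a v) = \<Phi> a v"
  using p_mult(1)[of a] by (metis comp_apply op_mult_def)

lemma Phi_p: "a \<in> roe_alg \<Longrightarrow> \<Phi> a (p v) = \<Phi> a v"
  using p_mult(2)[of a] by (metis comp_apply op_mult_def)

lemma p_idem: "p (p v) = p v"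
  using p_Phi[OF id_roe] by (simp add: p_def)

lemma p_sa: "v \<in> l2 \<Longrightarrow> w \<in> l2 \<Longrightarrow> l2inner (p v) w = l2inner v (p w)"
  unfolding p_def using Phi_trans_adjoint[of "Id_on UNIV" v w] id_roe by simp

lemma p_norm: assumes "v \<in> l2" shows "l2norm (p v) \<le> l2norm v"
proof -
  have "of_real ((l2norm (p v))^2) = l2inner (p v) (p v)" by (simp add: l2inner_self)
  also have "\<dots> = l2inner v (p v)" using p_sa[OF assms bop_l2[OF p_bounded], of v] p_idem by simp
  finally have "(l2norm (p v))^2 = cmod (l2inner v (p v))"
    by (metis abs_of_nonneg norm_of_real zero_le_power2)
  also have "\<dots> \<le> l2norm v * l2norm (p v)" by (intro l2_CS assms bop_l2 p_bounded)
  finally have *: "l2norm (p v) * l2norm (p v) \<le> l2norm v * l2norm (p v)" by (simp add: power2_eq_square)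
  show ?thesis
  proof (cases "l2norm (p v) = 0")
    case False then show ?thesis using l2norm_nonneg[of "p v"] by (intro mult_right_le_imp_le[OF *]) linarith
  qed simp
qed

lemma A_cstar: "cstar_subalg A" and A_roe: "A \<subseteq> roe_alg"
  and A_her: "a \<in> A \<Longrightarrow> b \<in> roe_alg \<Longrightarrow> positive_op b \<Longrightarrow> positive_op (op_minus a b) \<Longrightarrow> b \<in> A"
  using her by (auto simp: hereditary_def)

lemma A_add: "a \<in> A \<Longrightarrow> b \<in> A \<Longrightarrow> op_add a b \<in> A" and A_scale: "a \<in> A \<Longrightarrow> op_scale c a \<in> A"
  and A_mult: "a \<in> A \<Longrightarrow> b \<in> A \<Longrightarrow> op_mult a b \<in> A"
proof -
  have *: "\<forall>a\<in>A. \<forall>b\<in>A. op_add a b \<in> A \<and> op_mult a b \<in> A" using A_cstar unfolding cstar_subalg_def by (elim conjE)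
  have "\<forall>a\<in>A. \<forall>c. op_scale c a \<in> A" using A_cstar unfolding cstar_subalg_def by (elim conjE)
  with * show "a \<in> A \<Longrightarrow> b \<in> A \<Longrightarrow> op_add a b \<in> A" "a \<in> A \<Longrightarrow> op_scale c a \<in> A" "a \<in> A \<Longrightarrow> b \<in> A \<Longrightarrow> op_mult a b \<in> A"
    by blast+
qed

lemma cart: "cartan (\<Phi> ` linf_diag) A" using rc by (simp add: roe_cartan_def)

lemma B_A: "g \<in> linf_diag \<Longrightarrow> \<Phi> g \<in> A" using cart by (auto simp: cartan_def)

lemma B_masa:
  assumes "a \<in> A" "\<And>g. g \<in> linf_diag \<Longrightarrow> op_mult a (\<Phi> g) = op_mult (\<Phi> g) a"
  obtains g where "g \<in> linf_diag" "a = \<Phi> g"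
proof -
  have "\<forall>a\<in>A. (\<forall>b\<in>\<Phi> ` linf_diag. op_mult a b = op_mult b a) \<longrightarrow> a \<in> \<Phi> ` linf_diag"
    using cart unfolding cartan_def by (elim conjE)
  then have "a \<in> \<Phi> ` linf_diag" using assms by auto
  then show ?thesis using that by blast
qed

lemma p_A: "p \<in> A" unfolding p_def by (rule B_A[OF id_linf])

section \<open>The corner of the Roe algebra contained in the hereditary subalgebra\<close>

abbreviation "crn b \<equiv> op_mult p (op_mult b p)"

text \<open>Heredity speaks of positive elements below an element of \<open>A\<close>. With
  \<open>c\<close> the norm of \<open>b\<close>, the compression of \<open>b + c\<close> is positive
  and below \<open>2 * c\<close> times \<open>p\<close>, so it lies in \<open>A\<close>; then
  \<open>c\<close> times \<open>p\<close> is subtracted again.\<close>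

lemma corner_selfadjoint:
  assumes b: "b \<in> roe_alg" and sa: "\<And>v w. v \<in> l2 \<Longrightarrow> w \<in> l2 \<Longrightarrow> l2inner (b v) w = l2inner v (b w)"
  shows "crn b \<in> A"
proof -
  define c where "c = opnorm b"
  have bb: "bounded_op b" using b by simp
  define I where "I = (trans_op (Id_on UNIV) :: 'b op)"
  have I: "I \<in> roe_alg" "bounded_op I" "\<And>v. v \<in> l2 \<Longrightarrow> I v = v" unfolding I_def
    using trans_op_Id_on_linf linf_subset_roe by (blast, simp, simp add: trans_op_Id_on)
  define b1 where "b1 = op_add b (op_scale (of_real c) I)"
  define d where "d = crn b1"
  have b1: "b1 \<in> roe_alg" unfolding b1_def by (intro roe_add roe_scale b I)
  have d: "d \<in> roe_alg" unfolding d_def by (intro roe_mult p_roe b1)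
  have dv: "l2inner (d v) v = l2inner (b (p v)) (p v) + of_real (c * (l2norm (p v))^2)" if v: "v \<in> l2" for v
  proof -
    have "l2inner (d v) v = l2inner (b1 (p v)) (p v)"
      unfolding d_def op_mult_def comp_def using p_sa v b1 by simp
    also have "\<dots> = l2inner (b (p v)) (p v) + of_real c * l2inner (p v) (p v)"
      unfolding b1_def op_add_def op_scale_def
      by (simp add: I p_bounded bb l2inner_add_left l2inner_scale_left l2_scale)
    finally show ?thesis by (simp add: l2inner_self)
  qed
  have pv: "l2inner (p v) v = of_real ((l2norm (p v))^2)" if v: "v \<in> l2" for v
    using p_sa[OF bop_l2[OF p_bounded] v, of v] by (simp add: p_idem l2inner_self)
  have real: "Im (l2inner (b u) u) = 0" "\<bar>Re (l2inner (b u) u)\<bar> \<le> c * (l2norm u)^2" if u: "u \<in> l2" for u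
  proof -
    have "cnj (l2inner (b u) u) = l2inner (b u) u" using sa[OF u u] by (simp add: l2inner_cnj)
    then show "Im (l2inner (b u) u) = 0" by (metis Reals_cnj_iff complex_is_Real_iff)
    have "\<bar>Re (l2inner (b u) u)\<bar> \<le> cmod (l2inner (b u) u)" by (rule abs_Re_le_cmod)
    also have "\<dots> \<le> l2norm (b u) * l2norm u" by (intro l2_CS u bop_l2 bb)
    also have "\<dots> \<le> (c * l2norm u) * l2norm u" unfolding c_def by (intro mult_right_mono opnorm_bound bb u) simp
    finally show "\<bar>Re (l2inner (b u) u)\<bar> \<le> c * (l2norm u)^2" by (simp add: power2_eq_square mult_ac)
  qed
  have "positive_op d"
    unfolding positive_op_def
  proof (intro conjI ballI)
    fix v :: "'b vec" assume v: "v \<in> l2"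
    show "Im (l2inner (d v) v) = 0" "0 \<le> Re (l2inner (d v) v)"
      unfolding dv[OF v] using real[OF bop_l2[OF p_bounded], of v] by (auto simp: abs_le_iff)
  qed (use d in simp)
  moreover have "positive_op (op_minus (op_scale (of_real (2*c)) p) d)"
    unfolding positive_op_def
  proof (intro conjI ballI)
    show "bounded_op (op_minus (op_scale (of_real (2*c)) p) d)" using d p_bounded by simp
    fix v :: "'b vec" assume v: "v \<in> l2"
    have "l2inner (op_minus (op_scale (of_real (2*c)) p) d v) v = of_real (2*c) * l2inner (p v) v - l2inner (d v) v"
      unfolding op_minus_def op_scale_def
      by (simp only: l2inner_minus_left l2_scale bop_l2 p_bounded roe_bounded[OF d] v l2inner_scale_left)
    also have "\<dots> = of_real (c * (l2norm (p v))^2) - l2inner (b (p v)) (p v)"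
      unfolding pv[OF v] dv[OF v] by simp
    finally have eq: "l2inner (op_minus (op_scale (of_real (2*c)) p) d v) v = of_real (c * (l2norm (p v))^2) - l2inner (b (p v)) (p v)" .
    show "Im (l2inner (op_minus (op_scale (of_real (2*c)) p) d v) v) = 0"
      "0 \<le> Re (l2inner (op_minus (op_scale (of_real (2*c)) p) d v) v)"
      unfolding eq using real[OF bop_l2[OF p_bounded], of v] by (auto simp: abs_le_iff)
  qed
  ultimately have "d \<in> A" using d by (intro A_her[OF A_scale[OF p_A]])
  then have "op_add d (op_scale (- of_real c) p) \<in> A" by (intro A_add A_scale p_A)
  moreover have "op_add d (op_scale (- of_real c) p) = crn b"
  proof (rule bop_eqI)
    fix v :: "'b vec" assume "v \<in> l2"
    have "d v = p (\<lambda>x. b (p v) x + of_real c * p v x)"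
      unfolding d_def b1_def op_mult_def op_add_def op_scale_def by (simp add: I p_bounded)
    also have "\<dots> = (\<lambda>x. p (b (p v)) x + of_real c * p v x)"
      using bop_add[OF p_bounded bop_l2[OF bb] l2_scale[OF bop_l2[OF p_bounded]], of "p v" "of_real c" v]
        bop_scale[OF p_bounded bop_l2[OF p_bounded], of "of_real c" v] by (simp add: p_idem)
    finally show "op_add d (op_scale (- of_real c) p) v = crn b v"
      by (simp add: op_add_def op_scale_def op_mult_def)
  qed (use d p_bounded bb in auto)
  ultimately show ?thesis by simp
qed

text \<open>Splits \<open>b\<close> into the self-adjoint elements \<open>b + b'\<close> and
  \<open>\<i> (b - b')\<close>. The adjoint is passed as an explicit element of the Roe algebra; for
  a partial translation it is the converse.\<close>

lemma corner:
  assumes b: "b \<in> roe_alg" "b' \<in> roe_alg"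
    and adj: "\<And>v w. v \<in> l2 \<Longrightarrow> w \<in> l2 \<Longrightarrow> l2inner (b v) w = l2inner v (b' w)"
  shows "crn b \<in> A"
proof -
  have bb: "bounded_op b" "bounded_op b'" using b by auto
  have adj': "l2inner (b' v) w = l2inner v (b w)" if "v \<in> l2" "w \<in> l2" for v w
    using adj[OF that(2,1)] by (metis l2inner_cnj)
  define s where "s = op_add b b'"
  define t where "t = op_scale \<i> (op_minus b b')"
  have "crn s \<in> A"
  proof (rule corner_selfadjoint)
    show "s \<in> roe_alg" unfolding s_def by (intro roe_add b)
    show "l2inner (s v) w = l2inner v (s w)" if "v \<in> l2" "w \<in> l2" for v w
      using that by (simp add: s_def op_add_def l2inner_add_left l2inner_add_right bb adj adj')
  qed
  moreover have "crn t \<in> A"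
  proof (rule corner_selfadjoint)
    show "t \<in> roe_alg" unfolding t_def op_minus_eq by (intro roe_add roe_scale b)
    show "l2inner (t v) w = l2inner v (t w)" if "v \<in> l2" "w \<in> l2" for v w
      using that by (simp add: t_def op_scale_def op_minus_def l2inner_scale_left l2inner_scale_right
          l2inner_minus_left l2inner_minus_right bb adj adj') (simp add: algebra_simps)
  qed
  ultimately have "op_add (op_scale (1/2) (crn s)) (op_scale (-\<i>/2) (crn t)) \<in> A"
    by (intro A_add A_scale)
  moreover have "op_add (op_scale (1/2) (crn s)) (op_scale (-\<i>/2) (crn t)) = crn b"
  proof
    fix v
    define u where "u = p v"
    have ps: "p (s u) = (\<lambda>x. p (b u) x + p (b' u) x)" unfolding s_def op_add_def by (rule bop_add) (use p_bounded bb in auto)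
    have "p (t u) = (\<lambda>x. \<i> * p (\<lambda>x. b u x - b' u x) x)"
      unfolding t_def op_scale_def op_minus_def by (rule bop_scale) (use p_bounded bb in \<open>auto intro: l2_minus\<close>)
    also have "p (\<lambda>x. b u x - b' u x) = (\<lambda>x. p (b u) x - p (b' u) x)" by (rule bop_minus) (use p_bounded bb in auto)
    finally have pt: "p (t u) = (\<lambda>x. \<i> * (p (b u) x - p (b' u) x))" .
    show "op_add (op_scale (1/2) (crn s)) (op_scale (-\<i>/2) (crn t)) v = crn b v"
      unfolding op_add_def op_scale_def op_mult_def comp_def u_def[symmetric] ps pt by (auto simp: field_simps)
  qed
  ultimately show ?thesis by simp
qed

section \<open>Images of minimal projections have rank one\<close>

lemma Phi_e_scalar:
  assumes "g \<in> linf_diag"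
  shows "op_mult (\<Phi> g) (\<Phi> (mu x x)) = op_scale (entry g x x) (\<Phi> (mu x x))"
    "op_mult (\<Phi> (mu x x)) (\<Phi> g) = op_scale (entry g x x) (\<Phi> (mu x x))"
proof -
  have gr: "g \<in> roe_alg" using assms linf_subset_roe by blast
  obtain f where f: "\<And>v. v \<in> l2 \<Longrightarrow> g v = (\<lambda>x. f x * v x)" using assms by (auto simp: linf_diag_def)
  have g1: "op_mult g (mu x x) = op_scale (entry g x x) (mu x x)"
  proof (rule bop_eqI)
    fix v :: "'a vec" assume "v \<in> l2"
    then show "op_mult g (mu x x) v = op_scale (entry g x x) (mu x x) v"
      by (simp add: op_mult_def op_scale_def trans_op_single entry_eq f l2_scale) (auto simp: delta_def)
  qed (use gr in auto)
  have g2: "op_mult (mu x x) g = op_scale (entry g x x) (mu x x)"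
  proof (rule bop_eqI)
    fix v :: "'a vec" assume v: "v \<in> l2"
    have "g v \<in> l2" using gr by simp
    then show "op_mult (mu x x) g v = op_scale (entry g x x) (mu x x) v"
      using v by (simp add: op_mult_def op_scale_def trans_op_single entry_eq f) (auto simp: delta_def)
  qed (use gr in auto)
  show "op_mult (\<Phi> g) (\<Phi> (mu x x)) = op_scale (entry g x x) (\<Phi> (mu x x))"
    "op_mult (\<Phi> (mu x x)) (\<Phi> g) = op_scale (entry g x x) (\<Phi> (mu x x))"
    using g1 g2 gr by (simp_all add: Phi_mult[symmetric] Phi_scale)
qed

lemma e_mult: "op_mult (mu x' x'') (mu x x') = mu x x''"
  by (subst trans_op_mult) (auto intro!: arg_cong[where f=trans_op])

lemma Phi_e_e: "\<Phi> (mu x' x'') (\<Phi> (mu x x') v) = \<Phi> (mu x x'') v"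
proof -
  have "op_mult (\<Phi> (mu x' x'')) (\<Phi> (mu x x')) = \<Phi> (mu x x'')" by (subst Phi_mult[symmetric]) (simp_all add: e_mult)
  then show ?thesis by (metis comp_apply op_mult_def)
qed

lemma Phi_e_adj: "v \<in> l2 \<Longrightarrow> w \<in> l2 \<Longrightarrow> l2inner (\<Phi> (mu x x') v) w = l2inner v (\<Phi> (mu x' x) w)"
proof -
  have "{(x, x')}\<inverse> = {(x', x)}" by auto
  then show "v \<in> l2 \<Longrightarrow> w \<in> l2 \<Longrightarrow> ?thesis" using Phi_trans_adjoint[of "{(x, x')}" v w] by simp
qed

lemma Phi_e_ne: "\<Phi> (mu x x) \<noteq> op_zero"
proof
  assume "\<Phi> (mu x x) = op_zero"
  then have "mu x x = op_zero" by (intro Phi_eq_zero) simp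
  then have "mu x x (delta x) x = 0" by (simp add: op_zero_def)
  then show False by (simp add: trans_op_single) (simp add: delta_def)
qed

text \<open>The image \<open>q\<close> of a minimal projection absorbs every diagonal element up to
  a scalar, from both sides. Hence \<open>q a q\<close> commutes with the maximal abelian
  subalgebra, lies in it, and being absorbed by \<open>q\<close> is a multiple of
  \<open>q\<close>.\<close>

lemma corner_scalar:
  assumes "a \<in> A"
  obtains c where "op_mult (op_mult (\<Phi> (mu x x)) a) (\<Phi> (mu x x)) = op_scale c (\<Phi> (mu x x))"
proof -
  define q where "q = \<Phi> (mu x x)"
  have qA: "q \<in> A" unfolding q_def by (rule B_A[OF e_linf])
  define d where "d = op_mult (op_mult q a) q"
  have qq: "op_mult q q = q" unfolding q_def by (subst Phi_mult[symmetric]) (simp_all add: e_mult)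
  have bq: "bounded_op q" "bounded_op a" using qA A_roe assms by auto
  have "op_mult d (\<Phi> g) = op_mult (\<Phi> g) d" if g: "g \<in> linf_diag" for g
  proof -
    have "op_mult d (\<Phi> g) = op_mult (op_mult q a) (op_scale (entry g x x) q)"
      unfolding d_def op_mult_assoc using Phi_e_scalar(2)[OF g, of x] by (simp add: q_def)
    also have "\<dots> = op_mult (op_mult (op_scale (entry g x x) q) a) q"
      by (rule ext) (simp add: op_mult_def op_scale_def bop_scale bq)
    also have "\<dots> = op_mult (\<Phi> g) d"
      unfolding d_def using Phi_e_scalar(1)[OF g, of x] by (simp add: q_def op_mult_assoc[symmetric])
    finally show ?thesis .
  qed
  moreover have "d \<in> A" unfolding d_def by (intro A_mult qA assms)
  ultimately obtain g where g: "g \<in> linf_diag" "d = \<Phi> g" using B_masa by blast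
  have "d = op_mult q d" unfolding d_def using qq by (simp add: op_mult_assoc[symmetric])
  also have "\<dots> = op_scale (entry g x x) q" using Phi_e_scalar(2)[OF g(1), of x] g(2) by (simp add: q_def)
  finally show ?thesis using that unfolding d_def q_def by blast
qed

text \<open>Minimality in \<open>A\<close> alone does not give rank one; it does because
  \<open>A\<close> contains the compression by \<open>p\<close> of a coordinate projection.
  Sandwiched by \<open>q\<close>, this compression is the rank-one operator of
  \<open>u = q (delta y)\<close>, and by minimality it is also a multiple of
  \<open>q\<close>.\<close>

lemma rank_one_at:
  obtains z where "z \<in> l2" "l2norm z = 1" "\<And>v. v \<in> l2 \<Longrightarrow> \<Phi> (mu x x) v = (\<lambda>y. l2inner v z * z y)"
proof -
  define q where "q = \<Phi> (mu x x)"
  have bq: "bounded_op q" unfolding q_def by (rule Phi_bounded) simp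
  have qq: "q (q v) = q v" for v unfolding q_def by (rule Phi_e_e)
  have qsa: "l2inner (q v) w = l2inner v (q w)" if "v \<in> l2" "w \<in> l2" for v w
    unfolding q_def using Phi_e_adj[OF that] .
  have "\<exists>y. q (delta y) \<noteq> (\<lambda>z. 0)"
  proof (rule ccontr)
    assume "\<not> ?thesis"
    then have "q = op_zero" by (intro bop_eq_deltaI bq bounded_op_zero) (auto simp: op_zero_def)
    then show False using Phi_e_ne by (simp add: q_def)
  qed
  then obtain y where y: "q (delta y) \<noteq> (\<lambda>z. 0)" by blast
  define u where "u = q (delta y)"
  have u: "u \<in> l2" unfolding u_def by (rule bop_l2[OF bq])
  have nu: "l2norm u \<noteq> 0" using l2norm_eq_0[OF u] y by (auto simp: u_def)
  \<comment> \<open>For a self-adjoint idempotent the diagonal entry is the squared norm of the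
    column; this identifies the scalar \<open>c\<close> below.\<close>
  have uy: "u y = of_real ((l2norm u)^2)"
  proof -
    have "u y = l2inner (q (q (delta y))) (delta y)" by (simp add: qq u_def)
    also have "\<dots> = l2inner u u" using qsa[OF bop_l2[OF bq] delta_l2] by (simp add: u_def)
    finally show ?thesis by (simp add: l2inner_self)
  qed
  have qv: "q v y = l2inner v u" if "v \<in> l2" for v using qsa[OF that delta_l2, of y] by (simp add: u_def)
  have "{(y, y)}\<inverse> = {(y, y)}" by auto
  then have "crn (trans_op {(y, y)}) \<in> A"
    using trans_op_adjoint[of "{(y, y)}"] by (intro corner_selfadjoint) auto
  then obtain c where c: "op_mult (op_mult q (crn (trans_op {(y, y)}))) q = op_scale c q"
    unfolding q_def by (rule corner_scalar)
  have qp: "q (p v) = q v" "p (q v) = q v" for v unfolding q_def by (simp_all add: Phi_p p_Phi)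
  have key: "l2inner v u * u z = c * q v z" if v: "v \<in> l2" for v z
  proof -
    have "op_scale c q v = q (p (trans_op {(y, y)} (p (q v))))" unfolding c[symmetric] op_mult_def by simp
    also have "\<dots> = q (\<lambda>z. l2inner v u * delta y z)" by (simp add: qp trans_op_single bq qv v)
    also have "\<dots> = (\<lambda>z. l2inner v u * u z)" by (simp add: bop_scale bq u_def)
    finally show ?thesis by (metis op_scale_def)
  qed
  obtain z0 where z0: "u z0 \<noteq> 0" using y by (auto simp: u_def)
  have "l2inner (delta y) u * u z0 = c * u z0" using key[OF delta_l2, of y z0] by (simp add: u_def)
  then have c: "c = of_real ((l2norm u)^2)" using z0 uy by simp
  define z where "z = (\<lambda>x. of_real (1 / l2norm u) * u x)"
  have z: "z \<in> l2" "l2norm z = 1" unfolding z_def using u nu by (simp_all only: l2_scale l2norm_scale) (simp add: norm_divide)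
  have "q v y' = l2inner v z * z y'" if v: "v \<in> l2" for v y'
  proof -
    have "l2inner v z * z y' = l2inner v u * u y' / of_real ((l2norm u)^2)"
      unfolding z_def l2inner_scale_right by (simp add: power2_eq_square)
    then show ?thesis using key[OF v, of y'] nu by (simp add: c)
  qed
  then show ?thesis using that[OF z] unfolding q_def by blast
qed

text \<open>A unit vector of the rank-one projection at an arbitrary base point is carried to all
  other points by the matrix units; fixing the phases this way makes the vectors compatible with
  every \<open>mu x x'\<close>.\<close>

lemma spatial:
  obtains \<xi> where "orthonormal \<xi>" "\<And>x x'. \<Phi> (mu x x') (\<xi> x) = \<xi> x'"
    "\<And>x v. v \<in> l2 \<Longrightarrow> \<Phi> (mu x x) v = (\<lambda>y. l2inner v (\<xi> x) * \<xi> x y)"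
proof -
  fix x0 :: 'a
  obtain z where z: "z \<in> l2" "l2norm z = 1" "\<And>v. v \<in> l2 \<Longrightarrow> \<Phi> (mu x0 x0) v = (\<lambda>y. l2inner v z * z y)"
    using rank_one_at[of x0] by metis
  have zz: "\<Phi> (mu x0 x0) z = z" using z(3)[OF z(1)] z(2) by (simp add: l2inner_self)
  define \<xi> where "\<xi> = (\<lambda>x. \<Phi> (mu x0 x) z)"
  have xi: "\<xi> x \<in> l2" for x unfolding \<xi>_def by (rule bop_l2[OF Phi_bounded]) simp
  have tr: "\<Phi> (mu x x') (\<xi> x) = \<xi> x'" for x x' unfolding \<xi>_def by (rule Phi_e_e)
  have rk: "\<Phi> (mu x x) v = (\<lambda>y. l2inner v (\<xi> x) * \<xi> x y)" if v: "v \<in> l2" for x v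
  proof -
    have w: "\<Phi> (mu x x0) v \<in> l2" by (rule bop_l2[OF Phi_bounded]) simp
    have "\<Phi> (mu x x) v = \<Phi> (mu x0 x) (\<Phi> (mu x0 x0) (\<Phi> (mu x x0) v))" by (simp add: Phi_e_e)
    also have "\<dots> = \<Phi> (mu x0 x) (\<lambda>y. l2inner (\<Phi> (mu x x0) v) z * z y)" by (simp only: z(3)[OF w])
    also have "\<dots> = (\<lambda>y. l2inner (\<Phi> (mu x x0) v) z * \<xi> x y)"
      unfolding \<xi>_def by (rule bop_scale[OF Phi_bounded z(1)]) simp
    also have "l2inner (\<Phi> (mu x x0) v) z = l2inner v (\<xi> x)" unfolding \<xi>_def by (rule Phi_e_adj[OF v z(1)])
    finally show ?thesis .
  qed
  have "l2inner (\<xi> x) (\<xi> x') = (if x = x' then 1 else 0)" for x x'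
  proof (cases "x = x'")
    case True
    have "l2inner (\<xi> x) (\<xi> x) = l2inner z (\<Phi> (mu x x0) (\<xi> x))" using Phi_e_adj[OF z(1) xi] by (simp add: \<xi>_def)
    also have "\<Phi> (mu x x0) (\<xi> x) = z" using zz by (simp add: \<xi>_def Phi_e_e)
    finally show ?thesis using True z(2) by (simp add: l2inner_self)
  next
    case False
    have "op_mult (mu x' x') (mu x x) = op_zero"
    proof (rule bop_eqI)
      fix v :: "'a vec" assume "v \<in> l2"
      moreover have "delta x x' = 0" using False by (simp add: delta_def)
      ultimately show "op_mult (mu x' x') (mu x x) v = op_zero v"
        by (simp add: op_mult_def trans_op_single l2_scale op_zero_def)
    qed auto
    then have "op_mult (\<Phi> (mu x' x')) (\<Phi> (mu x x)) = op_zero" by (simp add: Phi_mult[symmetric] Phi_zero)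
    then have "\<Phi> (mu x' x') (\<Phi> (mu x x) (\<xi> x)) = (\<lambda>y. 0)" by (metis comp_apply op_mult_def op_zero_def)
    then have "\<Phi> (mu x' x') (\<xi> x) = (\<lambda>y. 0)" by (simp add: tr)
    then have "l2inner (\<Phi> (mu x' x') (\<xi> x)) (\<xi> x') = 0" by simp
    then have "l2inner (\<xi> x) (\<xi> x') = 0" using Phi_e_adj[OF xi xi, of x' x' x x'] by (simp add: tr)
    then show ?thesis using False by simp
  qed
  then have "orthonormal \<xi>" using xi by (simp add: orthonormal_def)
  then show ?thesis using that tr rk by blast
qed

definition \<xi> :: "'a \<Rightarrow> 'b vec" where
  "\<xi> = (SOME \<xi>. orthonormal \<xi> \<and> (\<forall>x x'. \<Phi> (mu x x') (\<xi> x) = \<xi> x') \<and>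
     (\<forall>x. \<forall>v\<in>l2. \<Phi> (mu x x) v = (\<lambda>y. l2inner v (\<xi> x) * \<xi> x y)))"

lemma xi_on: "orthonormal \<xi>" and xi_tr: "\<Phi> (mu x x') (\<xi> x) = \<xi> x'"
  and xi_rank: "v \<in> l2 \<Longrightarrow> \<Phi> (mu x x) v = (\<lambda>y. l2inner v (\<xi> x) * \<xi> x y)"
proof -
  have "\<exists>\<xi>. orthonormal \<xi> \<and> (\<forall>x x'. \<Phi> (mu x x') (\<xi> x) = \<xi> x') \<and>
     (\<forall>x. \<forall>v\<in>l2. \<Phi> (mu x x) v = (\<lambda>y. l2inner v (\<xi> x) * \<xi> x y))" using spatial by metis
  from someI_ex[OF this, folded \<xi>_def]
  show "orthonormal \<xi>" "\<Phi> (mu x x') (\<xi> x) = \<xi> x'"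
    "v \<in> l2 \<Longrightarrow> \<Phi> (mu x x) v = (\<lambda>y. l2inner v (\<xi> x) * \<xi> x y)" by auto
qed

lemma xi_l2: "\<xi> x \<in> l2" using xi_on by (simp add: orthonormal_def)

lemma xi_norm: "l2norm (\<xi> x) = 1"
proof -
  have "complex_of_real ((l2norm (\<xi> x))^2) = 1" using xi_on unfolding l2inner_self[symmetric] by (simp add: orthonormal_def)
  then have "(l2norm (\<xi> x))^2 = 1" by (metis of_real_eq_1_iff)
  then show ?thesis using l2norm_nonneg[of "\<xi> x"] by (simp add: power2_eq_1_iff)
qed

lemma p_xi: "p (\<xi> x) = \<xi> x" using p_Phi[of "mu x x" "\<xi> x"] by (simp add: xi_tr)

text \<open>The rank-one operator of \<open>v\<close> lies in \<open>A\<close>. Its expectation is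
  the image of a diagonal element whose entries are detected by the matrix units, and all of them
  vanish because \<open>v\<close> is orthogonal to each \<open>\<xi> x\<close>; faithfulness then
  kills the operator. This excludes a part of \<Phi> that the matrix units cannot see.\<close>

lemma xi_complete:
  assumes v: "v \<in> l2" and pv: "p v = v" and orth: "\<And>x. l2inner v (\<xi> x) = 0"
  shows "v = (\<lambda>y. 0)"
proof -
  obtain E where E: "faithful_cond_exp E A (\<Phi> ` linf_diag)" using cart by (auto simp: cartan_def)
  define a where "a = rank1 v"
  have "crn a = a"
  proof (rule bop_eqI)
    fix w :: "'b vec" assume w: "w \<in> l2"
    have "p (a (p w)) = (\<lambda>y. l2inner (p w) v * p v y)" unfolding a_def
      using p_bounded v by (simp add: rank1_apply bop_scale)
    also have "\<dots> = a w" using p_sa[OF w v] w by (simp add: pv a_def rank1_apply)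
    finally show "crn a w = a w" by (simp add: op_mult_def)
  qed (use v p_bounded in \<open>auto simp: a_def\<close>)
  moreover have "crn a \<in> A"
    unfolding a_def by (rule corner_selfadjoint[OF rank1_roe[OF v] rank1_adjoint])
  ultimately have aA: "a \<in> A" by simp
  then obtain g where g: "g \<in> linf_diag" "E a = \<Phi> g" using E by (auto simp: faithful_cond_exp_def)
  have gr: "g \<in> roe_alg" using g linf_subset_roe by blast
  have zA: "op_zero \<in> A" using A_cstar unfolding cstar_subalg_def by (elim conjE)
  have E0: "E op_zero = op_zero"
  proof -
    have "E (op_scale 0 op_zero) = op_scale 0 (E op_zero)" using E zA by (simp add: faithful_cond_exp_def)
    then show ?thesis by (simp add: op_scale_def op_zero_def)
  qed
  have ent: "entry g x x = 0" for x
  proof -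
    define q where "q = \<Phi> (mu x x)"
    have q0: "op_mult (op_mult q a) q = op_zero"
    proof
      fix w
      have qw: "q w \<in> l2" unfolding q_def by (rule bop_l2[OF Phi_bounded]) simp
      have "q (a (q w)) = (\<lambda>y. l2inner (q w) v * q v y)"
        unfolding a_def q_def rank1_apply[OF qw[unfolded q_def]] by (rule bop_scale[OF Phi_bounded v]) simp
      also have "q v = (\<lambda>y. 0)" unfolding q_def xi_rank[OF v] orth by simp
      finally show "op_mult (op_mult q a) q w = op_zero w" by (simp add: op_mult_def op_zero_def)
    qed
    have qB: "q \<in> \<Phi> ` linf_diag" unfolding q_def by (rule imageI[OF e_linf])
    have "\<forall>a\<in>A. \<forall>b1\<in>\<Phi> ` linf_diag. \<forall>b2\<in>\<Phi> ` linf_diag. E (op_mult (op_mult b1 a) b2) = op_mult (op_mult b1 (E a)) b2"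
      using E unfolding faithful_cond_exp_def by (elim conjE)
    then have "E (op_mult (op_mult q a) q) = op_mult (op_mult q (E a)) q" using aA qB by (meson bspec)
    then have "op_zero = op_mult (op_mult q (\<Phi> g)) q" using q0 E0 g(2) by simp
    also have "\<dots> = op_mult (op_scale (entry g x x) q) q" unfolding q_def Phi_e_scalar(2)[OF g(1)] ..
    also have "\<dots> = op_scale (entry g x x) q"
      by (rule ext) (simp add: op_mult_def op_scale_def q_def Phi_e_e)
    finally have z: "op_scale (entry g x x) q = op_zero" ..
    show ?thesis
    proof (rule ccontr)
      assume ne: "entry g x x \<noteq> 0"
      have "q w y = 0" for w y using z ne by (metis mult_eq_0_iff op_scale_def op_zero_def)
      then have "q = op_zero" by (simp add: op_zero_def fun_eq_iff)
      then show False using Phi_e_ne by (simp add: q_def)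
    qed
  qed
  obtain f where f: "\<And>v. v \<in> l2 \<Longrightarrow> g v = (\<lambda>x. f x * v x)" using g by (auto simp: linf_diag_def)
  have "f x = 0" for x using ent[of x] by (simp add: entry_eq f) (simp add: delta_def)
  then have "g = op_zero" using gr by (intro bop_eqI bounded_op_zero) (auto simp: f op_zero_def)
  then have "E a = op_zero" using g(2) Phi_zero by simp
  then have "a = op_zero" using E aA positive_rank1[OF v] by (simp add: faithful_cond_exp_def a_def)
  then have "l2inner (a v) v = 0" by (simp add: op_zero_def)
  then have "(cmod (l2inner v v))^2 = 0" unfolding a_def rank1_inner_self[OF v] by (metis of_real_eq_0_iff)
  then have "l2norm v = 0" by (simp add: l2inner_self)
  then show ?thesis by (rule l2norm_eq_0[OF v])
qed

lemma xi_inner: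
  assumes "u \<in> l2" "p u = u" "w \<in> l2"
  shows "l2inner u w = l2inner (\<lambda>x. l2inner u (\<xi> x)) (\<lambda>x. l2inner w (\<xi> x))"
  by (rule orthonormal_complete_inner[OF xi_on p_bounded p_sa p_xi xi_complete assms])

text \<open>Up to conjugation these are the coefficients of \<open>delta y\<close>, so Bessel's
  inequality applies: all basis vectors together carry mass at most 1 at any point.\<close>

lemma xi_col_l2: "(\<lambda>x. \<xi> x y) \<in> l2" "l2norm (\<lambda>x. \<xi> x y) \<le> 1"
  using l2_cnj[OF bessel(1)[OF xi_on delta_l2[of y]]] bessel(2)[OF xi_on delta_l2[of y]]
    l2norm_cnj[of "\<lambda>x. \<xi> x y"] by auto

text \<open>Parseval applies to the image of \<open>delta y\<close>: the coefficient at
  \<open>\<xi> x'\<close> is found by moving the converse translation onto \<open>\<xi> x'\<close>,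
  where a single matrix unit remains. Passing to a subset of \<open>G\<close> therefore just
  restricts the sum, although \<Phi> is not assumed to respect infinite sums.\<close>

lemma Phi_trans_entry:
  assumes G: "pinj G" and r: "\<And>x x'. (x, x') \<in> G \<Longrightarrow> dist x x' \<le> r"
  shows "entry (\<Phi> (trans_op G)) y y' = (\<Sum>\<^sub>\<infinity>z\<in>G. cnj (\<xi> (fst z) y) * \<xi> (snd z) y')"
proof -
  have GR: "trans_op G \<in> roe_alg" by (rule trans_op_roe[OF G r])
  have GR': "trans_op (G\<inverse>) \<in> roe_alg" by (rule trans_op_roe[OF pinj_converse[OF G], where r=r]) (metis converse_iff dist_commute r)
  define u where "u = \<Phi> (trans_op G) (delta y)"
  have u: "u \<in> l2" "p u = u" unfolding u_def using Phi_bounded[OF GR] p_Phi[OF GR] by auto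
  define c where "c = (\<lambda>x. cnj (\<xi> x y))"
  have c: "c \<in> l2" unfolding c_def by (rule l2_cnj[OF xi_col_l2(1)])
  have "l2inner u (\<xi> x') = trans_op G c x'" for x'
  proof -
    have *: "l2inner u (\<xi> x') = l2inner (delta y) (\<Phi> (trans_op (G\<inverse>)) (\<xi> x'))"
      unfolding u_def by (rule Phi_trans_adjoint[OF G GR delta_l2 xi_l2])
    have **: "\<Phi> (trans_op (G\<inverse>)) (\<xi> x') = \<Phi> (op_mult (trans_op (G\<inverse>)) (mu x' x')) (\<xi> x')"
      by (simp only: Phi_mult GR' trans_op_single_roe) (simp add: op_mult_def xi_tr)
    show ?thesis
    proof (cases "x' \<in> snd ` G")
      case True
      then obtain x where x: "(x, x') \<in> G" by auto
      have "z = x" if "(z, x') \<in> G" for z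
      proof -
        have "inj_on snd G" using G by (simp add: pinj_def)
        from inj_onD[OF this _ that x] show ?thesis by simp
      qed
      then have "{(x', x')} O G\<inverse> = {(x', x)}" using x by blast
      then have "op_mult (trans_op (G\<inverse>)) (mu x' x') = mu x' x" using trans_op_mult[OF pinj_single pinj_converse[OF G], of x' x'] by simp
      then show ?thesis using * ** trans_op_apply[OF G c x] by (simp add: xi_tr c_def)
    next
      case False
      then have "{(x', x')} O G\<inverse> = {}" by force
      then have "op_mult (trans_op (G\<inverse>)) (mu x' x') = trans_op {}" using trans_op_mult[OF pinj_single pinj_converse[OF G], of x' x'] by simp
      also have "\<dots> = op_zero" by (auto simp: trans_op_def op_zero_def)
      finally show ?thesis using * ** False by (simp add: Phi_zero trans_op_outside) (simp add: op_zero_def)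
    qed
  qed
  then have "l2inner u (delta y') = l2inner (trans_op G c) (\<lambda>x. cnj (\<xi> x y'))"
    using xi_inner[OF u delta_l2, of y'] by simp
  also have "\<dots> = (\<Sum>\<^sub>\<infinity>z\<in>G. cnj (\<xi> (fst z) y) * \<xi> (snd z) y')"
    using trans_op_inner[OF G c l2_cnj[OF xi_col_l2(1)], of y'] by (simp add: c_def)
  finally show ?thesis by (simp add: entry_eq u_def)
qed

lemma Phi_xi_coeff:
  assumes a: "a \<in> roe_alg" shows "l2inner (\<Phi> a (\<xi> x)) (\<xi> x') = entry a x x'"
proof -
  define u where "u = \<Phi> a (\<xi> x)"
  have u: "u \<in> l2" unfolding u_def by (rule bop_l2[OF Phi_bounded[OF a]])
  have "op_mult (op_mult (mu x' x') a) (mu x x) = op_scale (entry a x x') (mu x x')"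
    using sandwich_single[of a x' x' x x] a by simp
  then have "\<Phi> (op_mult (op_mult (mu x' x') a) (mu x x)) = op_scale (entry a x x') (\<Phi> (mu x x'))" by (simp add: Phi_scale)
  moreover have "\<Phi> (op_mult (op_mult (mu x' x') a) (mu x x)) (\<xi> x) = \<Phi> (mu x' x') u"
    by (simp only: Phi_mult roe_mult a trans_op_single_roe) (simp add: op_mult_def xi_tr u_def)
  ultimately have "\<Phi> (mu x' x') u = (\<lambda>y. entry a x x' * \<xi> x' y)" by (simp add: op_scale_def xi_tr)
  then have "(\<lambda>y. l2inner u (\<xi> x') * \<xi> x' y) = (\<lambda>y. entry a x x' * \<xi> x' y)" using xi_rank[OF u] by simp
  \<comment> \<open>A nonzero coordinate of the unit vector, by which the two proportional vectors
    can be compared.\<close>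
  moreover obtain y where "\<xi> x' y \<noteq> 0" using xi_norm[of x'] by (metis l2norm_zero zero_neq_one ext)
  ultimately show ?thesis by (metis mult_cancel_right u_def)
qed

lemma Phi_xi:
  assumes a: "a \<in> roe_alg" shows "\<Phi> a (\<xi> x) y = (\<Sum>\<^sub>\<infinity>x'. entry a x x' * \<xi> x' y)"
proof -
  have u: "\<Phi> a (\<xi> x) \<in> l2" "p (\<Phi> a (\<xi> x)) = \<Phi> a (\<xi> x)" using bop_l2[OF Phi_bounded[OF a]] p_Phi[OF a] by auto
  have "\<Phi> a (\<xi> x) y = l2inner (\<Phi> a (\<xi> x)) (delta y)" by simp
  also have "\<dots> = (\<Sum>\<^sub>\<infinity>x'. entry a x x' * \<xi> x' y)"
    unfolding xi_inner[OF u delta_l2] Phi_xi_coeff[OF a] by (simp add: l2inner_def[where v="entry a x"])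
  finally show ?thesis .
qed

end

section \<open>Concentration of the basis vectors\<close>

lemma l2_large_finite:
  assumes "v \<in> l2" "0 < d" shows "finite {y. d \<le> cmod (v y)}"
proof (rule ccontr)
  assume inf: "infinite {y. d \<le> cmod (v y)}"
  obtain k :: nat where k: "real k > (l2norm v)^2 / d^2" using reals_Archimedean2 by blast
  obtain F where F: "finite F" "card F = k" "F \<subseteq> {y. d \<le> cmod (v y)}"
    using infinite_arbitrarily_large[OF inf, of k] by blast
  have "real k * d^2 = (\<Sum>y\<in>F. d^2)" using F by simp
  also have "\<dots> \<le> mass F v" using F assms by (intro sum_mono power_mono) auto
  also have "\<dots> \<le> (l2norm v)^2" by (rule l2_sum_le[OF assms(1) F(1)])
  finally show False using k assms by (simp add: field_simps)
qed

lemma ulf_bound: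
  assumes "ulf (UNIV :: 'b::metric_space set)"
  obtains N :: nat where "\<And>y :: 'b. finite (cball y r)" "\<And>y :: 'b. card (cball y r) \<le> N"
proof -
  have "\<exists>N::nat. \<forall>x\<in>(UNIV :: 'b set). finite (cball x r \<inter> UNIV) \<and> card (cball x r \<inter> UNIV) \<le> N"
    using assms unfolding ulf_def by (rule spec)
  then show ?thesis using that by auto
qed

text \<open>Beyond distance \<open>2 * S n\<close> the kernel vanishes and the error matrix
  coincides with \<open>m\<close>, so approximability bounds the far part of each row.\<close>

lemma far_row_small:
  assumes "kernels \<eta> S" "mbd (ckern \<eta> n m) e" "finite D" "\<And>y'. y' \<in> D \<Longrightarrow> dist y y' > 2 * S n"
  shows "mass D (m y) \<le> e^2"
proof -
  have "mass D (m y) = (\<Sum>y'\<in>D. (cmod (ckern \<eta> n m y y'))^2)"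
    using kern_far[OF assms(1) assms(4)] by (intro sum.cong) (auto simp: ckern_def)
  then show ?thesis using mbd_entry_row[OF assms(2,3), of y] by simp
qed

locale roe_cartan_coarse = roe_cartan_embedding \<Phi> A
  for \<Phi> :: "('a::metric_space) op \<Rightarrow> ('b::metric_space) op" and A :: "'b op set" +
  fixes \<eta> :: "nat \<Rightarrow> 'b \<Rightarrow> 'b \<Rightarrow> real" and S :: "nat \<Rightarrow> real"
  assumes ulfX: "ulf (UNIV :: 'a set)" and ulfY: "ulf (UNIV :: 'b set)" and K: "kernels \<eta> S"
begin

text \<open>The contribution of the pair \<open>(s i, t i)\<close> to the matrix of the image of a
  translation. With both maps the identity, sums over \<open>M\<close> give the matrix of the
  projection onto the span of the \<open>\<xi> x\<close> with \<open>x\<close> in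
  \<open>M\<close>.\<close>

definition tcoeff :: "('i \<Rightarrow> 'a) \<Rightarrow> ('i \<Rightarrow> 'a) \<Rightarrow> 'i \<Rightarrow> 'b \<Rightarrow> 'b vec" where
  "tcoeff s t = (\<lambda>i y y'. cnj (\<xi> (s i) y) * \<xi> (t i) y')"

lemma equi_approximable_family:
  fixes s t :: "'i \<Rightarrow> 'a"
  assumes "inj s" "inj t" "\<And>i. dist (s i) (t i) \<le> r" "e > 0"
  shows "\<exists>n. \<forall>M. mbd (ckern \<eta> n (msum (tcoeff s t) M)) e"
proof (rule equi_approximable[OF _ _ assms(4)])
  define G where "G = (\<lambda>M. (\<lambda>i. (s i, t i)) ` M)"
  have pG: "pinj (G M)" for M using assms(1,2) by (auto simp: G_def pinj_def inj_on_def)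
  have inj: "inj_on (\<lambda>i. (s i, t i)) M" for M using assms(1) by (auto simp: inj_on_def)
  show "(\<lambda>i. cmod (tcoeff s t i y y')) summable_on UNIV" for y y'
  proof -
    have "(\<lambda>z. cmod (cnj (\<xi> (fst z) y) * \<xi> (snd z) y')) summable_on G UNIV"
      by (rule pinj_summable[OF pG l2_cnj[OF xi_col_l2(1)] xi_col_l2(1)])
    then show ?thesis unfolding G_def summable_on_reindex[OF inj] by (simp add: o_def tcoeff_def)
  qed
  fix M and e :: real assume e: "e > 0"
  have d: "dist x x' \<le> r" if "(x, x') \<in> G M" for x x' using that assms(3) by (auto simp: G_def)
  have "entry (\<Phi> (trans_op (G M))) = msum (tcoeff s t) M"
  proof (intro ext)
    fix y y'
    show "entry (\<Phi> (trans_op (G M))) y y' = msum (tcoeff s t) M y y'"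
      using Phi_trans_entry[OF pG d, where y=y and y'=y']
        infsum_reindex[OF inj, of "\<lambda>z. cnj (\<xi> (fst z) y) * \<xi> (snd z) y'" M]
      by (simp add: G_def msum_def tcoeff_def o_def)
  qed
  moreover have "trans_op (G M) \<in> roe_alg" by (rule trans_op_roe[OF pG d])
  ultimately show "\<exists>n0. \<forall>n\<ge>n0. mbd (ckern \<eta> n (msum (tcoeff s t) M)) e"
    using roe_schur_approx[OF ulfY K Phi_roe e, of "trans_op (G M)"] by simp
qed

lemma projections_equi_approximable:
  "e > 0 \<Longrightarrow> \<exists>n. \<forall>M. mbd (ckern \<eta> n (msum (tcoeff id id) M)) e"
  by (rule equi_approximable_family[where r=0]) auto

text \<open>Singleton index sets already suffice. The estimate is on a product because no centre of
  \<open>\<xi> x\<close> is known yet: once one factor is bounded below, the other is small far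
  away, uniformly in \<open>x\<close>.\<close>

lemma xi_localised:
  assumes e: "e > 0"
  obtains r where "\<And>x y y'. dist y y' > r \<Longrightarrow> cmod (\<xi> x y) * cmod (\<xi> x y') \<le> e"
proof -
  obtain n where n: "\<And>M. mbd (ckern \<eta> n (msum (tcoeff id id) M)) e" using projections_equi_approximable[OF e] by blast
  have "cmod (\<xi> x y) * cmod (\<xi> x y') \<le> e" if "dist y y' > 2 * S n" for x y y'
  proof -
    have "(\<Sum>z\<in>{y'}. (cmod (msum (tcoeff id id) {x} y z))^2) \<le> e^2"
      by (rule far_row_small[OF K n]) (use that in auto)
    then have "(cmod (\<xi> x y) * cmod (\<xi> x y'))^2 \<le> e^2" by (simp add: msum_def tcoeff_def norm_mult)
    then show ?thesis by (rule power2_le_imp_le) (use e in simp)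
  qed
  then show ?thesis using that by blast
qed

lemma xi_row_sum_le: "finite M \<Longrightarrow> (\<Sum>x\<in>M. (cmod (\<xi> x y))^2) \<le> 1"
  using l2_sum_le[OF xi_col_l2(1)[of y], of M] power_mono[OF xi_col_l2(2)[of y] l2norm_nonneg, of 2] by simp

text \<open>All partial sums of the projections onto the \<open>\<xi> x\<close> move \<open>delta y\<close> into a common ball up to a small error. If all
  coefficients at \<open>y\<close> were small, a sign average would put most of the mass outside that ball.\<close>

lemma small_coefficients:
  assumes c: "c > 0"
  obtains d where "d > 0" "\<And>M y. finite M \<Longrightarrow> (\<And>x. x \<in> M \<Longrightarrow> cmod (\<xi> x y) < d) \<Longrightarrow> (\<Sum>x\<in>M. (cmod (\<xi> x y))^2) \<le> c"
proof -
  \<comment> \<open>Chosen with \<open>(2*e)^2 = c/4\<close>; likewise \<open>d\<close> below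
    satisfies \<open>d^2 * real N \<le> c/4\<close>. These two quarters are the contributions from
    outside and inside the ball \<open>B\<close>.\<close>
  define e where "e = sqrt c / 4"
  have e: "e > 0" using c by (simp add: e_def)
  have e2: "(2*e)^2 = c/4" using c by (simp add: e_def power2_eq_square)
  obtain n where n: "\<And>M. mbd (ckern \<eta> n (msum (tcoeff id id) M)) e" using projections_equi_approximable[OF e] by blast
  obtain N :: nat where N: "\<And>y :: 'b. finite (cball y (2 * S n))" "\<And>y :: 'b. card (cball y (2 * S n)) \<le> N"
    using ulf_bound[OF ulfY, of "2 * S n"] by blast
  define d where "d = sqrt (c / (4 * (real N + 1)))"
  have d: "d > 0" using c by (simp add: d_def)
  have d2: "d^2 * real N \<le> c/4"
  proof -
    have "d^2 = c / (4 * (real N + 1))" using c by (simp add: d_def)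
    then have "4 * d^2 + 4 * (d^2 * real N) = c" by (simp add: field_simps)
    then show ?thesis using zero_le_power2[of d] by linarith
  qed
  have "(\<Sum>x\<in>M. (cmod (\<xi> x y))^2) \<le> c" if M: "finite M" and small: "\<And>x. x \<in> M \<Longrightarrow> cmod (\<xi> x y) < d" for M y
  proof -
    define B where "B = cball y (2 * S n)"
    have B: "finite B" "card B \<le> N" using N by (auto simp: B_def)
    have "\<exists>D. finite D \<and> (\<forall>D'. finite D' \<longrightarrow> D \<subseteq> D' \<longrightarrow> 1 - (mass D' (\<xi> x)) \<le> 1/2)" for x
      using l2_approx_sq[OF xi_l2[of x], of "1/2"] by (metis half_gt_zero_iff one_power2 xi_norm zero_less_one)
    then obtain D0 where D0: "\<And>x. finite (D0 x)"
      "\<And>x D'. finite D' \<Longrightarrow> D0 x \<subseteq> D' \<Longrightarrow> 1 - (mass D' (\<xi> x)) \<le> 1/2" by metis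
    \<comment> \<open>Each \<open>D0 x\<close> carries at least half of the mass of
      \<open>\<xi> x\<close>, so whatever \<open>B\<close> does not account for is found in
      \<open>D\<close>, where the uniform row estimate is available.\<close>
    define D where "D = (\<Union>x\<in>M. D0 x) - B"
    have D: "finite D" "D \<inter> B = {}" using M D0(1) by (auto simp: D_def)
    have mass: "1/2 - (mass B (\<xi> x)) \<le> mass D (\<xi> x)" if "x \<in> M" for x
    proof -
      have "D0 x \<subseteq> D \<union> B" using that by (auto simp: D_def)
      then have "1 - (\<Sum>z\<in>D \<union> B. (cmod (\<xi> x z))^2) \<le> 1/2" using D B by (intro D0(2)) auto
      then show ?thesis using sum.union_disjoint[OF D(1) B(1) D(2), of "\<lambda>z. (cmod (\<xi> x z))^2"] by linarith
    qed
    define w where "w = (\<lambda>x z. cnj (\<xi> x y) * \<xi> x z)"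
    obtain s where s: "\<forall>x\<in>M. s x = 1 \<or> s x = -1"
      "(\<Sum>x\<in>M. \<Sum>z\<in>D. (cmod (w x z))^2) \<le> (\<Sum>z\<in>D. (cmod (\<Sum>x\<in>M. s x * w x z))^2)"
      using exists_signs[OF M, of w D] by blast
    \<comment> \<open>The signed sum is a difference of two partial sums, and both obey the bound
      that holds for all index sets.\<close>
    define M1 M2 where "M1 = {x \<in> M. s x = 1}" and "M2 = {x \<in> M. s x \<noteq> 1}"
    define P where "P = (\<lambda>L z. \<Sum>x\<in>L. w x z)"
    have Pb: "mass D (P L) \<le> e^2" if "finite L" for L
    proof -
      have "(\<Sum>z\<in>D. (cmod (msum (tcoeff id id) L y z))^2) \<le> e^2"
        by (rule far_row_small[OF K n D(1)]) (use D(2) in \<open>auto simp: B_def\<close>)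
      then show ?thesis using that by (simp add: msum_def tcoeff_def P_def w_def)
    qed
    have "(\<Sum>x\<in>M. s x * w x z) = P M1 z + (- P M2 z)" for z
    proof -
      have "M = M1 \<union> M2" "M1 \<inter> M2 = {}" "finite M1" "finite M2" using M by (auto simp: M1_def M2_def)
      then have "(\<Sum>x\<in>M. s x * w x z) = (\<Sum>x\<in>M1. s x * w x z) + (\<Sum>x\<in>M2. s x * w x z)"
        by (metis sum.union_disjoint)
      also have "(\<Sum>x\<in>M1. s x * w x z) = P M1 z" unfolding P_def by (intro sum.cong) (auto simp: M1_def)
      also have "(\<Sum>x\<in>M2. s x * w x z) = - P M2 z"
        unfolding P_def sum_negf[symmetric] using s(1) by (intro sum.cong) (auto simp: M2_def)
      finally show ?thesis .
    qed
    then have "sqrt (\<Sum>z\<in>D. (cmod (\<Sum>x\<in>M. s x * w x z))^2) \<le> sqrt (mass D (P M1)) + sqrt (\<Sum>z\<in>D. (cmod (- P M2 z))^2)"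
      using sqrt_sum_add_le[of "P M1" "\<lambda>z. - P M2 z" D] by simp
    also have "\<dots> \<le> e + e"
      using Pb[of M1] Pb[of M2] M e by (intro add_mono real_le_lsqrt) (auto simp: M1_def M2_def sum_nonneg)
    finally have "(\<Sum>z\<in>D. (cmod (\<Sum>x\<in>M. s x * w x z))^2) \<le> (2*e)^2" by (intro sqrt_le_D) simp
    then have up: "(\<Sum>x\<in>M. \<Sum>z\<in>D. (cmod (w x z))^2) \<le> c/4" using s(2) e2 by linarith
    have "(\<Sum>x\<in>M. (cmod (\<xi> x y))^2 * (mass B (\<xi> x))) \<le> (\<Sum>x\<in>M. d^2 * (mass B (\<xi> x)))"
      using small by (intro sum_mono mult_right_mono power_mono) (auto simp: sum_nonneg less_imp_le)
    also have "\<dots> = d^2 * (\<Sum>z\<in>B. \<Sum>x\<in>M. (cmod (\<xi> x z))^2)"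
      unfolding sum_distrib_left[symmetric] by (subst sum.swap) simp
    also have "\<dots> \<le> d^2 * (\<Sum>z\<in>B. 1)" by (intro mult_left_mono sum_mono xi_row_sum_le M) auto
    also have "\<dots> \<le> d^2 * real N" using B by (intro mult_left_mono) auto
    finally have bB: "(\<Sum>x\<in>M. (cmod (\<xi> x y))^2 * (mass B (\<xi> x))) \<le> c/4" using d2 by linarith
    \<comment> \<open>The right-hand side below is at most \<open>c/4\<close>, as is the subtracted
      term, so half the sum is at most \<open>c/2\<close>.\<close>
    have "(\<Sum>x\<in>M. (cmod (\<xi> x y))^2) / 2 - (\<Sum>x\<in>M. (cmod (\<xi> x y))^2 * (mass B (\<xi> x)))
       = (\<Sum>x\<in>M. (cmod (\<xi> x y))^2 * (1/2 - (mass B (\<xi> x))))"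
      unfolding sum_divide_distrib sum_subtractf[symmetric] by (intro sum.cong) (auto simp: algebra_simps)
    also have "\<dots> \<le> (\<Sum>x\<in>M. (cmod (\<xi> x y))^2 * (mass D (\<xi> x)))"
      using mass by (intro sum_mono mult_left_mono) auto
    also have "\<dots> = (\<Sum>x\<in>M. \<Sum>z\<in>D. (cmod (w x z))^2)"
      by (simp add: w_def norm_mult power_mult_distrib sum_distrib_left)
    finally show ?thesis using up bB by linarith
  qed
  then show ?thesis using that d by blast
qed

text \<open>The quadratic form of the projection onto finitely many basis vectors is the sum of
  squared coefficients; in particular it is nonnegative.\<close>

lemma gram_form:
  assumes "finite F" "finite D"
  shows "mform (msum (tcoeff id id) F) D u u = of_real (\<Sum>x\<in>F. (cmod (\<Sum>y\<in>D. u y * cnj (\<xi> x y)))^2)"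
proof -
  have "mform (msum (tcoeff id id) F) D u u = (\<Sum>y\<in>D. \<Sum>y'\<in>D. \<Sum>x\<in>F. (u y * cnj (\<xi> x y)) * cnj (u y' * cnj (\<xi> x y')))"
    unfolding mform_def msum_def tcoeff_def using assms(1)
    by (intro sum.cong refl) (simp add: sum_distrib_left sum_distrib_right mult_ac)
  also have "\<dots> = (\<Sum>y\<in>D. \<Sum>x\<in>F. \<Sum>y'\<in>D. (u y * cnj (\<xi> x y)) * cnj (u y' * cnj (\<xi> x y')))"
    by (intro sum.cong refl sum.swap)
  also have "\<dots> = (\<Sum>x\<in>F. \<Sum>y\<in>D. \<Sum>y'\<in>D. (u y * cnj (\<xi> x y)) * cnj (u y' * cnj (\<xi> x y')))" by (rule sum.swap)
  also have "\<dots> = (\<Sum>x\<in>F. (\<Sum>y\<in>D. u y * cnj (\<xi> x y)) * cnj (\<Sum>y\<in>D. u y * cnj (\<xi> x y)))"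
    unfolding cnj_sum sum_product ..
  also have "\<dots> = of_real (\<Sum>x\<in>F. (cmod (\<Sum>y\<in>D. u y * cnj (\<xi> x y)))^2)"
    unfolding of_real_sum complex_norm_square ..
  finally show ?thesis .
qed

text \<open>If Hall's condition fails for \<open>F\<close>, some unit vector \<open>v\<close> in the
  span of the \<open>\<xi> x\<close>, \<open>x\<close> in \<open>F\<close>, vanishes at every point
  where one of them is large. The projection onto the span fixes \<open>v\<close>, yet after Schur
  multiplication its form splits over balls of bounded size meeting only points of small total mass,
  and is then at most 1/4.\<close>

lemma hall_condition:
  obtains d where "d > 0" "hall (\<lambda>x. {y. d \<le> cmod (\<xi> x y)})"
proof -
  obtain n where n: "\<And>M. mbd (ckern \<eta> n (msum (tcoeff id id) M)) (1/4)"
    using projections_equi_approximable[of "1/4"] by auto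
  define R where "R = S n"
  obtain N :: nat where N: "\<And>y :: 'b. finite (cball y R)" "\<And>y :: 'b. card (cball y R) \<le> N"
    using ulf_bound[OF ulfY, of R] by blast
  \<comment> \<open>With at most \<open>N\<close> points per ball, a mass of at most
    \<open>c\<close> per point makes every local piece at most a quarter of the mass it acts
    on.\<close>
  define c where "c = 1 / (4 * (real N + 1))"
  have c: "c > 0" "real N * c \<le> 1/4" by (auto simp: c_def field_simps)
  obtain d where d: "d > 0"
    "\<And>M y. finite M \<Longrightarrow> (\<And>x. x \<in> M \<Longrightarrow> cmod (\<xi> x y) < d) \<Longrightarrow> (\<Sum>x\<in>M. (cmod (\<xi> x y))^2) \<le> c"
    by (rule small_coefficients[OF c(1)]) blast
  define H where "H = (\<lambda>x. {y. d \<le> cmod (\<xi> x y)})"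
  have "card F \<le> card (\<Union>x\<in>F. H x)" if F: "finite F" for F
  proof (rule ccontr)
    assume "\<not> ?thesis"
    then have less: "card (\<Union>x\<in>F. H x) < card F" by simp
    define YF where "YF = (\<Union>x\<in>F. H x)"
    have YF: "finite YF" using F l2_large_finite[OF xi_l2 d(1)] by (auto simp: YF_def H_def)
    obtain b0 where b0: "\<exists>x\<in>F. b0 x \<noteq> 0" "\<forall>y\<in>YF. (\<Sum>x\<in>F. b0 x * \<xi> x y) = 0"
      using homogeneous_system_nontrivial[OF YF F, of \<xi>] less by (auto simp: YF_def)
    define T where "T = mass F b0"
    have T: "T > 0" unfolding T_def using b0(1) F by (auto intro!: sum_pos2)
    define b where "b = (\<lambda>x. of_real (1 / sqrt T) * b0 x)"
    have b: "mass F b = 1"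
      using T by (simp add: b_def norm_mult norm_divide power_mult_distrib power_divide sum_divide_distrib[symmetric] T_def[symmetric])
    define v where "v = (\<lambda>y. \<Sum>x\<in>F. b x * \<xi> x y)"
    have v: "v \<in> l2" "(l2norm v)^2 = 1" unfolding v_def using orthonormal_norm_sum[OF xi_on F, of b] b
      by (auto intro!: l2_sum l2_scale xi_l2)
    have v0: "v y = 0" if "y \<in> YF" for y
    proof -
      have "v y = complex_of_real (1 / sqrt T) * (\<Sum>x\<in>F. b0 x * \<xi> x y)"
        unfolding v_def b_def sum_distrib_left by (intro sum.cong refl mult.assoc)
      then show ?thesis using b0(2) that by simp
    qed
    obtain D0 where D0: "finite D0" "\<And>D'. finite D' \<Longrightarrow> D0 \<subseteq> D' \<Longrightarrow> (l2norm v)^2 - (mass D' v) \<le> 1/8"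
      using l2_approx_sq[OF v(1), of "1/8"] by auto
    \<comment> \<open>\<open>v\<close> vanishes on \<open>YF\<close>, so removing these points from
      the finite set \<open>D0\<close> loses no mass.\<close>
    define D where "D = D0 - YF"
    have D: "finite D" "D \<inter> YF = {}" using D0 by (auto simp: D_def)
    have eqD: "mass D v = mass D0 v"
      unfolding D_def using D0(1) v0 by (intro sum.mono_neutral_left) auto
    have "7/8 \<le> mass D v" using eqD D0(2)[OF D0(1) order_refl] v(2) by linarith
    moreover have "mass D v \<le> 1" using l2_sum_le[OF v(1) D(1)] v(2) by linarith
    ultimately have vD: "7/8 \<le> mass D v" "mass D v \<le> 1" .
    define a where "a = (\<lambda>x. \<Sum>y\<in>D. v y * cnj (\<xi> x y))"
    have "complex_of_real (mass D v) = (\<Sum>y\<in>D. v y * cnj (v y))" unfolding of_real_sum complex_norm_square ..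
    also have "\<dots> = (\<Sum>y\<in>D. \<Sum>x\<in>F. cnj (b x) * (v y * cnj (\<xi> x y)))"
      by (subst (2) v_def) (simp add: sum_distrib_left mult_ac)
    also have "\<dots> = (\<Sum>x\<in>F. cnj (b x) * a x)" unfolding a_def sum_distrib_left by (rule sum.swap)
    finally have eq: "complex_of_real (mass D v) = (\<Sum>x\<in>F. cnj (b x) * a x)" .
    have "mass D v = cmod (complex_of_real (mass D v))"
      unfolding norm_of_real by (simp add: sum_nonneg)
    also have "\<dots> = cmod (\<Sum>x\<in>F. cnj (b x) * a x)" unfolding eq ..
    also have "\<dots> \<le> sqrt (\<Sum>x\<in>F. (cmod (cnj (b x)))^2) * sqrt (mass F a)" by (rule norm_sum_mult_le)
    also have "\<dots> = sqrt (mass F a)" using b by simp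
    \<comment> \<open>Cauchy-Schwarz against the unit coefficient vector \<open>b\<close>. Squaring
      gives 49/64, which leaves more than 1/2 after the Schur error 1/4.\<close>
    finally have "7/8 \<le> sqrt (mass F a)" using vD(1) by linarith
    then have "(7/8)^2 \<le> (sqrt (mass F a))^2" by (rule power_mono) simp
    then have a: "49/64 \<le> mass F a" by (simp add: sum_nonneg power2_eq_square)
    define m where "m = msum (tcoeff id id) F"
    define mk where "mk = schur (\<eta> n) m"
    have mf: "mform m D v v = of_real (mass F a)" unfolding m_def a_def by (rule gram_form[OF F D(1)])
    have "ckern \<eta> n m = (\<lambda>y y'. m y y' - mk y y')" by (auto simp: ckern_def mk_def algebra_simps)
    then have "mbd (\<lambda>y y'. m y y' - mk y y') (1/4)" using n[of F] by (simp add: m_def)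
    then have "cmod (mform m D v v - mform mk D v v) \<le> 1/4"
      unfolding mbd_def mform_diff using D(1) vD(2) by blast
    moreover have "cmod (mform m D v v) = mass F a" unfolding mf norm_of_real by (simp add: sum_nonneg)
    ultimately have big: "1/2 \<le> cmod (mform mk D v v)"
      using norm_triangle_sub[of "mform m D v v" "mform mk D v v"] a by linarith
    have "unit_rows (\<eta> n)" using K by (simp add: kernels_def)
    from schur_decompose[OF this D(1)] obtain Z where Z: "finite Z"
      "\<And>m v w. mform (schur (\<eta> n) m) D v w =
       (\<Sum>z\<in>Z. mform m D (cut (\<eta> n) z v) (cut (\<eta> n) z w))"
      "\<And>v. (\<Sum>z\<in>Z. mass D (cut (\<eta> n) z v)) = mass D v"
      by (elim exE conjE) simp
    have one: "cmod (mform m D (cut (\<eta> n) z v) (cut (\<eta> n) z v))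
       \<le> mass D (cut (\<eta> n) z v) * (1/4)" for z
    proof -
      define u where "u = (cut (\<eta> n) z v)"
      define D' where "D' = D \<inter> cball z R"
      have D': "finite D'" "card D' \<le> N" using D(1) order_trans[OF card_mono[OF N(1) Int_lower2] N(2)] by (auto simp: D'_def)
      have u0: "u y = 0" if "y \<in> D - D'" for y
        using that K by (auto simp: u_def D'_def R_def kernels_def dist_commute)
      have "(cmod (\<Sum>y\<in>D. u y * cnj (\<xi> x y)))^2 \<le> mass D u * mass D' (\<xi> x)" for x
      proof -
        have "(\<Sum>y\<in>D. u y * cnj (\<xi> x y)) = (\<Sum>y\<in>D'. u y * cnj (\<xi> x y))"
          using u0 D(1) by (intro sum.mono_neutral_right) (auto simp: D'_def)
        then have "cmod (\<Sum>y\<in>D. u y * cnj (\<xi> x y)) \<le> sqrt (mass D' u) * sqrt (mass D' (\<xi> x))"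
          using norm_sum_mult_le[of u "\<lambda>y. cnj (\<xi> x y)" D'] by simp
        then have "(cmod (\<Sum>y\<in>D. u y * cnj (\<xi> x y)))^2 \<le> (sqrt (mass D' u) * sqrt (mass D' (\<xi> x)))^2"
          by (intro power_mono) auto
        also have "\<dots> = mass D' u * mass D' (\<xi> x)"
          by (simp add: power_mult_distrib sum_nonneg)
        also have "\<dots> \<le> mass D u * mass D' (\<xi> x)"
          using D(1) by (intro mult_right_mono sum_mono2) (auto simp: D'_def sum_nonneg)
        finally show ?thesis .
      qed
      then have "(\<Sum>x\<in>F. (cmod (\<Sum>y\<in>D. u y * cnj (\<xi> x y)))^2) \<le> (\<Sum>x\<in>F. (mass D u) * (mass D' (\<xi> x)))"
        by (intro sum_mono)
      also have "\<dots> = mass D u * (\<Sum>y\<in>D'. \<Sum>x\<in>F. (cmod (\<xi> x y))^2)"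
        unfolding sum_distrib_left[symmetric] by (subst sum.swap) simp
      also have "\<dots> \<le> mass D u * (\<Sum>y\<in>D'. c)"
      proof (intro mult_left_mono sum_mono)
        fix y assume "y \<in> D'"
        then have "y \<notin> YF" using D(2) by (auto simp: D'_def)
        then show "(\<Sum>x\<in>F. (cmod (\<xi> x y))^2) \<le> c" by (intro d(2) F) (auto simp: YF_def H_def not_le)
      qed (simp add: sum_nonneg)
      also have "\<dots> \<le> mass D u * (real N * c)"
        using D' c by (intro mult_left_mono) (auto simp: sum_nonneg mult_right_mono)
      also have "\<dots> \<le> mass D u * (1/4)" using c by (intro mult_left_mono) (auto simp: sum_nonneg)
      finally have "(\<Sum>x\<in>F. (cmod (\<Sum>y\<in>D. u y * cnj (\<xi> x y)))^2) \<le> mass D u * (1/4)" .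
      moreover have "cmod (mform m D u u) = (\<Sum>x\<in>F. (cmod (\<Sum>y\<in>D. u y * cnj (\<xi> x y)))^2)"
        unfolding m_def gram_form[OF F D(1)] norm_of_real by (simp add: sum_nonneg)
      ultimately show ?thesis unfolding u_def by simp
    qed
    have "cmod (mform mk D v v) \<le> (\<Sum>z\<in>Z. mass D (cut (\<eta> n) z v) * (1/4))"
      unfolding mk_def Z(2) by (intro order_trans[OF norm_sum] sum_mono one)
    also have "\<dots> = mass D v * (1/4)" unfolding sum_distrib_right[symmetric] Z(3) ..
    finally show False using big vD(2) by linarith
  qed
  moreover have "finite (H x)" for x unfolding H_def by (rule l2_large_finite[OF xi_l2 d(1)])
  ultimately have "hall H" by (simp add: hall_def)
  then show ?thesis using that[OF d(1)] by (simp add: H_def)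
qed

section \<open>The coarse quotient map\<close>

text \<open>If nearby points had images arbitrarily far apart, the bad pairs would form a partial
  translation of \<open>X\<close> of bounded displacement. Each pair alone contributes a matrix
  entry of size at least \<open>d^2\<close> at the two image points, whereas uniform approximability
  forces entries beyond a fixed distance below \<open>d^2/2\<close>.\<close>

lemma concentrated_coarse:
  assumes f: "inj f" and d: "d > 0" "\<And>x. d \<le> cmod (\<xi> x (f x))"
  shows "coarse_map f"
proof (rule ccontr)
  assume "\<not> ?thesis"
  then obtain r where r: "\<And>s. \<exists>x x'. dist x x' \<le> r \<and> dist (f x) (f x') > s" unfolding coarse_map_def by (auto simp: not_le)
  obtain N :: nat where N: "\<And>x :: 'a. finite (cball x r)" using ulf_bound[OF ulfX, of r] by blast
  define Q where "Q = (\<lambda>(n::nat) x x'. dist x x' \<le> r \<and> dist (f x) (f x') > real n)"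
  obtain s t where st: "\<And>n. Q n (s n) (t n)" "inj s" "inj t"
  proof (rule injective_bad_sequence[of Q])
    show "\<exists>x x'. Q n x x'" for n using r[of "real n"] by (simp add: Q_def)
    show "finite {x'. \<exists>n. Q n x x'}" for x by (rule finite_subset[OF _ N[of x]]) (auto simp: Q_def)
    show "finite {x. \<exists>n. Q n x x'}" for x' by (rule finite_subset[OF _ N[of x']]) (auto simp: Q_def dist_commute)
    show "\<exists>N. \<forall>n. Q n x x' \<longrightarrow> n \<le> N" for x x'
      by (rule exI[of _ "nat \<lceil>dist (f x) (f x')\<rceil>"]) (auto simp: Q_def le_nat_iff, linarith)
    show "Q m x x'" if "m \<le> n" "Q n x x'" for m n x x' using that by (auto simp: Q_def)
  qed blast
  have e: "d^2/2 > 0" using d by simp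
  obtain n where n: "\<And>M. mbd (ckern \<eta> n (msum (tcoeff s t) M)) (d^2/2)"
    using equi_approximable_family[OF st(2,3), of r, OF _ e] st(1) by (auto simp: Q_def)
  obtain i :: nat where i: "real i > 2 * S n" using reals_Archimedean2 by blast
  have "(\<Sum>z\<in>{f (t i)}. (cmod (msum (tcoeff s t) {i} (f (s i)) z))^2) \<le> (d^2/2)^2"
    by (rule far_row_small[OF K n]) (use st(1)[of i] i in \<open>auto simp: Q_def\<close>)
  then have "(cmod (\<xi> (s i) (f (s i))) * cmod (\<xi> (t i) (f (t i))))^2 \<le> (d^2/2)^2" by (simp add: msum_def tcoeff_def norm_mult)
  then have "cmod (\<xi> (s i) (f (s i))) * cmod (\<xi> (t i) (f (t i))) \<le> d^2/2" by (rule power2_le_imp_le) simp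
  moreover have "d * d \<le> cmod (\<xi> (s i) (f (s i))) * cmod (\<xi> (t i) (f (t i)))" using d by (intro mult_mono) auto
  ultimately show False using mult_pos_pos[OF d(1) d(1)] unfolding power2_eq_square by linarith
qed

text \<open>The row of \<open>a\<close> at \<open>x\<close> is split at radius \<open>s\<close>. The
  near part is paired with the values of nearby basis vectors at \<open>y\<close>, of total mass at
  most \<open>c\<close>; the far part is dominated by the row of \<open>a - a'\<close>, since
  \<open>a'\<close> has no entries there.\<close>

lemma Phi_xi_bound:
  assumes a: "a \<in> roe_alg" and k: "opnorm (\<Phi> a) \<le> k"
    and a': "bounded_op a'" "propg_le a' s" "opnorm (op_minus a a') \<le> \<tau>"
    and c: "(\<Sum>x'\<in>cball x s. (cmod (\<xi> x' y))^2) \<le> c"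
  shows "cmod (\<Phi> a (\<xi> x) y) \<le> k * sqrt c + \<tau>"
proof -
  define B where "B = cball x s"
  obtain N :: nat where "\<And>x :: 'a. finite (cball x s)" using ulf_bound[OF ulfX, of s] by blast
  then have B: "finite B" by (simp add: B_def)
  define w where "w = (\<lambda>x'. cnj (\<xi> x' y))"
  have w: "w \<in> l2" "l2norm w \<le> 1" unfolding w_def using l2_cnj[OF xi_col_l2(1)] xi_col_l2(2) by auto
  define g where "g = (\<lambda>x'. if x' \<in> B then entry a x x' else 0)"
  define h where "h = (\<lambda>x'. if x' \<in> B then 0 else entry a x x')"
  define e where "e = op_minus a a' (delta x)"
  have bo: "bounded_op (op_minus a a')" using a a' by simp
  have e: "e \<in> l2" "l2norm e \<le> \<tau>"
    unfolding e_def using bop_l2[OF bo] opnorm_ge[OF bo delta_l2] a'(3) by (auto intro: order_trans)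
  have "cmod (h x') \<le> cmod (e x')" for x'
  proof (cases "x' \<in> B")
    case False
    then have "entry a' x x' = 0" using a'(2) by (auto simp: B_def propg_le_def)
    then show ?thesis by (simp add: h_def e_def op_minus_def entry_eq)
  qed (simp add: h_def)
  then have h: "h \<in> l2" "l2norm h \<le> \<tau>" using l2_mono[OF e(1)] e(2) by (auto intro: order_trans)
  have g: "g \<in> l2" by (rule l2_finite_support(1)[OF B]) (simp add: g_def)
  have "\<Phi> a (\<xi> x) y = l2inner (\<lambda>x'. g x' + h x') w"
    unfolding Phi_xi[OF a] l2inner_def w_def by (intro infsum_cong) (simp add: g_def h_def)
  also have "\<dots> = l2inner g w + l2inner h w" by (rule l2inner_add_left[OF g h(1) w(1)])
  finally have eq: "\<Phi> a (\<xi> x) y = l2inner g w + l2inner h w" .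
  have "l2inner g w = (\<Sum>x'\<in>B. entry a x x' * \<xi> x' y)"
    using l2_finite_support(3)[OF B, of g w] by (simp add: g_def w_def)
  then have "cmod (l2inner g w) \<le> sqrt (mass B (entry a x)) * sqrt (\<Sum>x'\<in>B. (cmod (\<xi> x' y))^2)"
    by (simp add: norm_sum_mult_le)
  also have "\<dots> \<le> k * sqrt c"
  proof (intro mult_mono)
    have ba: "bounded_op (\<Phi> a)" by (rule Phi_bounded[OF a])
    have "l2norm (\<Phi> a (\<xi> x)) \<le> k" using opnorm_ge[OF ba xi_l2] xi_norm k by (metis order_refl order_trans)
    then have "(l2norm (\<Phi> a (\<xi> x)))^2 \<le> k^2" by (rule power_mono) simp
    then have "mass B (entry a x) \<le> k^2"
      using bessel_finite[OF xi_on bop_l2[OF ba] B, of "\<xi> x"] unfolding Phi_xi_coeff[OF a] by linarith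
    then show "sqrt (mass B (entry a x)) \<le> k"
      using k opnorm_nonneg[OF ba] by (intro real_le_lsqrt) (auto simp: sum_nonneg)
    show "0 \<le> k" using k opnorm_nonneg[OF ba] by simp
    show "sqrt (\<Sum>x'\<in>B. (cmod (\<xi> x' y))^2) \<le> sqrt c" using c by (simp add: B_def)
  qed (simp add: sum_nonneg)
  finally have "cmod (l2inner g w) \<le> k * sqrt c" .
  moreover have "cmod (l2inner h w) \<le> \<tau>"
  proof -
    have "cmod (l2inner h w) \<le> l2norm h * l2norm w" by (rule l2_CS[OF h(1) w(1)])
    also have "\<dots> \<le> l2norm h * 1" using w by (intro mult_left_mono) auto
    finally show ?thesis using h by simp
  qed
  ultimately show ?thesis unfolding eq by (rule norm_triangle_mono)
qed

end

section \<open>Strong coboundedness and the quotient property\<close>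

lemma bounded_op_sum:
  assumes "\<And>i. i \<in> F \<Longrightarrow> bounded_op (g i)" "finite F" shows "bounded_op (\<lambda>v y. \<Sum>i\<in>F. g i v y)"
  using assms(2,1)
proof (induction F)
  case empty then show ?case using bounded_op_zero by (simp add: op_zero_def)
next
  case (insert i F)
  then have "bounded_op (op_add (g i) (\<lambda>v y. \<Sum>i\<in>F. g i v y))" by (intro bounded_op_add) auto
  then show ?case using insert.hyps by (simp add: op_add_def)
qed

text \<open>The value at \<open>y\<close> only sees \<open>u\<close> on the ball of radius
  \<open>r\<close>, hence at most \<open>N\<close> terms of size at most
  \<open>q * k\<close>.\<close>

lemma propg_apply_bound:
  assumes c: "bounded_op c" "propg_le c r" "opnorm c \<le> k" and B: "finite (cball y r)" "card (cball y r) \<le> N"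
    and u: "u \<in> l2" "\<And>z. z \<in> cball y r \<Longrightarrow> cmod (u z) \<le> q" "0 \<le> q"
  shows "cmod (c u y) \<le> real N * (q * k)"
proof -
  have k: "0 \<le> k" using opnorm_nonneg[OF c(1)] c(3) by linarith
  have "c u y = (\<Sum>\<^sub>\<infinity>z\<in>cball y r. u z * entry c z y)"
    unfolding bop_expand(1)[OF c(1) u(1)]
    by (rule infsum_cong_neutral) (use c(2) in \<open>auto simp: propg_le_def dist_commute\<close>)
  then have eq: "c u y = (\<Sum>z\<in>cball y r. u z * entry c z y)" using B by simp
  have "cmod (u z * entry c z y) \<le> q * k" if "z \<in> cball y r" for z
    unfolding norm_mult using u(2)[OF that] u(3) order_trans[OF entry_le_opnorm[OF c(1)] c(3)] by (intro mult_mono) auto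
  then have "cmod (c u y) \<le> (\<Sum>z\<in>cball y r. q * k)"
    unfolding eq by (intro order_trans[OF norm_sum] sum_mono)
  moreover have "(\<Sum>z\<in>cball y r. q * k) \<le> real N * (q * k)" using B u(3) k by (simp add: mult_right_mono)
  ultimately show ?thesis by (rule order_trans)
qed

context roe_cartan_coarse
begin

text \<open>The diagonal entry of a projection is the squared norm of its column, and pairing that
  column with the unit vector \<open>\<xi> x\<close> recovers the conjugate of
  \<open>\<xi> x y\<close>.\<close>

lemma p_diag_ge: "(cmod (\<xi> x y))^2 \<le> cmod (p (delta y) y)"
proof -
  have pl: "p (delta y) \<in> l2" by (rule bop_l2[OF p_bounded])
  have "cnj (\<xi> x y) = l2inner (p (delta y)) (\<xi> x)" using p_sa[OF delta_l2 xi_l2, of y x] by (simp add: p_xi)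
  then have "cmod (\<xi> x y) = cmod (l2inner (p (delta y)) (\<xi> x))" by (metis complex_mod_cnj)
  also have "\<dots> \<le> l2norm (p (delta y)) * l2norm (\<xi> x)" by (rule l2_CS[OF pl xi_l2])
  finally have "cmod (\<xi> x y) \<le> l2norm (p (delta y))" by (simp add: xi_norm)
  then have "(cmod (\<xi> x y))^2 \<le> (l2norm (p (delta y)))^2" by (rule power_mono) simp
  also have "\<dots> = cmod (p (delta y) y)"
  proof -
    have "p (delta y) y = l2inner (p (p (delta y))) (delta y)" by (simp add: p_idem)
    also have "\<dots> = l2inner (p (delta y)) (p (delta y))" by (rule p_sa[OF pl delta_l2])
    also have "\<dots> = of_real ((l2norm (p (delta y)))^2)" by (rule l2inner_self)
    finally show ?thesis by (simp add: norm_power)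
  qed
  finally show ?thesis .
qed

lemma corner_trans_op:
  assumes G: "pinj G" and r: "\<And>y y'. (y, y') \<in> G \<Longrightarrow> dist y y' \<le> r"
  shows "crn (trans_op G) \<in> A" "opnorm (crn (trans_op G)) \<le> 1"
    "crn (trans_op G) (\<xi> x) y = (\<Sum>\<^sub>\<infinity>z\<in>G. \<xi> x (fst z) * cnj (p (delta y) (snd z)))"
proof -
  have bG: "bounded_op (trans_op G)" using G by simp
  have GR: "trans_op G \<in> roe_alg" by (rule trans_op_roe[OF G r])
  have GR': "trans_op (G\<inverse>) \<in> roe_alg"
    by (rule trans_op_roe[OF pinj_converse[OF G], where r=r]) (metis converse_iff dist_commute r)
  show "crn (trans_op G) \<in> A"
    by (rule corner[OF GR GR' trans_op_adjoint[OF G]])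
  show "opnorm (crn (trans_op G)) \<le> 1"
  proof (rule opnorm_leI)
    fix v :: "'b vec" assume v: "v \<in> l2"
    have "l2norm (p (trans_op G (p v))) \<le> l2norm (trans_op G (p v))" by (rule p_norm[OF bop_l2[OF bG]])
    also have "\<dots> \<le> l2norm (p v)" by (rule trans_op_norm[OF G bop_l2[OF p_bounded]])
    also have "\<dots> \<le> l2norm v" by (rule p_norm[OF v])
    finally show "l2norm (crn (trans_op G) v) \<le> 1 * l2norm v" by (simp add: op_mult_def)
  qed simp
  have "crn (trans_op G) (\<xi> x) y = l2inner (p (trans_op G (\<xi> x))) (delta y)"
    by (simp add: op_mult_def p_xi)
  also have "\<dots> = l2inner (trans_op G (\<xi> x)) (p (delta y))" by (rule p_sa[OF bop_l2[OF bG] delta_l2])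
  also have "\<dots> = (\<Sum>\<^sub>\<infinity>z\<in>G. \<xi> x (fst z) * cnj (p (delta y) (snd z)))"
    by (rule trans_op_inner[OF G xi_l2 bop_l2[OF p_bounded]])
  finally show "crn (trans_op G) (\<xi> x) y = (\<Sum>\<^sub>\<infinity>z\<in>G. \<xi> x (fst z) * cnj (p (delta y) (snd z)))" .
qed

end

text \<open>A large diagonal term could be cancelled by the others. Adding or omitting the index
  \<open>n\<close> changes the sum by \<open>g n n\<close>, so one of the two choices leaves it
  large; Baire arranges this for infinitely many \<open>n\<close> with one set.\<close>

lemma exists_subset_large_sums:
  fixes g :: "nat \<Rightarrow> nat \<Rightarrow> complex"
  assumes g: "\<And>n. (\<lambda>m. cmod (g n m)) summable_on UNIV" and \<mu>: "\<mu> > 0" "\<And>n. \<mu> \<le> cmod (g n n)"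
  shows "\<exists>M. \<forall>j::nat. \<exists>n\<ge>j. cmod (\<Sum>\<^sub>\<infinity>m\<in>M. g n m) > \<mu>/3"
proof (rule baire_subsets)
  fix j :: nat and F S :: "nat set" assume F: "finite F" and SF: "S \<subseteq> F"
  obtain n where n: "n \<notin> F \<union> {..<j}" using ex_new_if_finite[OF infinite_UNIV_nat, of "F \<union> {..<j}"] F by auto
  then have nj: "j \<le> n" "n \<notin> F" by auto
  have S: "finite S" "n \<notin> S" using F SF nj finite_subset by auto
  have "cmod (g n n) \<le> cmod (\<Sum>m\<in>insert n S. g n m) + cmod (\<Sum>m\<in>S. g n m)"
    using S norm_triangle_ineq4[of "\<Sum>m\<in>insert n S. g n m" "\<Sum>m\<in>S. g n m"] by simp
  then have "\<mu>/2 \<le> cmod (\<Sum>m\<in>insert n S. g n m) \<or> \<mu>/2 \<le> cmod (\<Sum>m\<in>S. g n m)" using \<mu>(2)[of n] by linarith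
  then obtain S1 where S1: "S1 = insert n S \<or> S1 = S" "\<mu>/2 \<le> cmod (\<Sum>m\<in>S1. g n m)" by blast
  have S1f: "finite S1" "S1 \<subseteq> insert n F" "S1 \<inter> F = S" using S1(1) S SF nj by auto
  \<comment> \<open>Beyond the window at most \<mu>\<open>/12\<close> is lost, and
    \<open>5*\<mu>/12\<close> still exceeds \<mu>\<open>/3\<close>.\<close>
  have pos: "\<mu>/12 > 0" using \<mu> by simp
  obtain F0 where F0: "finite F0"
    "\<And>F' M M'. F0 \<subseteq> F' \<Longrightarrow> M \<inter> F' = M' \<inter> F' \<Longrightarrow> cmod ((\<Sum>\<^sub>\<infinity>i\<in>M. g n i) - (\<Sum>\<^sub>\<infinity>i\<in>M'. g n i)) \<le> \<mu>/12"
    using abs_summable_tail[OF g pos, of n] by metis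
  define F' where "F' = insert n F \<union> F0"
  have F': "finite F'" "F \<subseteq> F'" "S1 \<subseteq> F'" using F F0 S1f by (auto simp: F'_def)
  have "\<exists>n\<ge>j. cmod (\<Sum>\<^sub>\<infinity>m\<in>M. g n m) > \<mu>/3" if M: "M \<inter> F' = S1" for M
  proof -
    have "cmod ((\<Sum>\<^sub>\<infinity>i\<in>S1. g n i) - (\<Sum>\<^sub>\<infinity>i\<in>M. g n i)) \<le> \<mu>/12"
      by (rule F0(2)[of F']) (use M in \<open>auto simp: F'_def\<close>)
    then have "cmod (\<Sum>\<^sub>\<infinity>i\<in>M. g n i) > \<mu>/3"
      using S1(2) S1f(1) \<mu>(1) norm_triangle_sub[of "\<Sum>\<^sub>\<infinity>i\<in>S1. g n i" "\<Sum>\<^sub>\<infinity>i\<in>M. g n i"] by simp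
    then show ?thesis using nj(1) by blast
  qed
  then show "\<exists>F' S'. finite F' \<and> F \<subseteq> F' \<and> S' \<subseteq> F' \<and> S' \<inter> F = S \<and>
      (\<forall>M. M \<inter> F' = S' \<longrightarrow> (\<exists>n\<ge>j. cmod (\<Sum>\<^sub>\<infinity>m\<in>M. g n m) > \<mu>/3))"
    using F' S1f(3) by (intro exI[of _ F'] exI[of _ S1]) simp
qed

context roe_cartan_coarse
begin

text \<open>For a bad pair, \<open>f (t n)\<close> is far from \<open>f x'\<close> for every
  \<open>x'\<close> near \<open>s n\<close>. Hence all these \<open>\<xi> x'\<close> are small on
  the ball of radius \<open>k\<close> about \<open>f (t n)\<close>, and each \<open>a i\<close> maps
  \<open>\<xi> (s n)\<close> nearly into their span, with small values on that ball. The operators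
  \<open>c i\<close> see only this ball, so the approximating sum is too small at
  \<open>f (t n)\<close>.\<close>

lemma concentrated_quotient:
  assumes f: "inj f" and d: "d > 0" "\<And>x. d \<le> cmod (\<xi> x (f x))"
    and cob: "strongly_cobounded (\<Phi> ` (roe_alg :: 'a op set)) A"
  shows "\<exists>K>0. \<forall>\<epsilon>>0. \<exists>\<delta>>0. \<forall>x x''. dist (f x'') (f x) \<le> \<epsilon> \<longrightarrow> (\<exists>x'. dist x' x \<le> \<delta> \<and> dist (f x'') (f x') \<le> K)"
proof -
  obtain k :: nat where k: "\<forall>\<epsilon>>0. \<forall>b\<in>A. opnorm b \<le> 1 \<longrightarrow>
     (\<exists>a c. (\<forall>i<k. a i \<in> \<Phi> ` roe_alg \<and> opnorm (a i) \<le> real k \<and>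
                   c i \<in> A \<and> propg_le (c i) (real k) \<and> opnorm (c i) \<le> real k) \<and>
            opnorm (op_minus b (\<lambda>v y. \<Sum>i<k. c i (a i v) y)) \<le> \<epsilon>)"
    using cob unfolding strongly_cobounded_def by blast
  obtain N :: nat where N: "\<And>y :: 'b. finite (cball y (real k))" "\<And>y :: 'b. card (cball y (real k)) \<le> N"
    using ulf_bound[OF ulfY, of "real k"] by blast
  \<comment> \<open>A factor \<open>d\<close> comes from \<open>\<xi> (s n)\<close> at
    \<open>f (s n)\<close> and a factor \<open>d^2\<close> from the diagonal of \<open>p\<close> at
    \<open>f (t n)\<close>.\<close>
  define \<mu> where "\<mu> = d^3"
  have \<mu>: "\<mu> > 0" using d by (simp add: \<mu>_def)
  define L where "L = real k * (real N * real k) + 1"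
  have L: "L > 0" unfolding L_def by (simp add: add_nonneg_pos)
  \<comment> \<open>Chosen so that \<open>k\<close> terms of size at most
    \<open>real N * (2 * \<kappa> * real k)\<close> sum to at most \<mu>\<open>/6\<close>; one
    \<kappa> pays for nearby small coefficients, the other for the finite propagation
    approximation.\<close>
  define \<kappa> where "\<kappa> = \<mu> / (12 * L)"
  have \<kappa>: "\<kappa> > 0" using \<mu> L by (simp add: \<kappa>_def)
  define c1 where "c1 = (\<kappa> / (real k + 1))^2"
  have c1: "c1 > 0" using \<kappa> by (simp add: c1_def)
  have "sqrt c1 = \<kappa> / (real k + 1)" unfolding c1_def real_sqrt_abs using \<kappa> by simp
  then have "sqrt c1 + real k * sqrt c1 = \<kappa>" by (simp add: field_simps)
  then have kc1: "real k * sqrt c1 \<le> \<kappa>" using c1 real_sqrt_gt_zero[of c1] by linarith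
  obtain d2 where d2: "d2 > 0"
    "\<And>M y. finite M \<Longrightarrow> (\<And>x. x \<in> M \<Longrightarrow> cmod (\<xi> x y) < d2) \<Longrightarrow> (\<Sum>x\<in>M. (cmod (\<xi> x y))^2) \<le> c1"
    by (rule small_coefficients[OF c1]) blast
  have dd: "d * d2 / 2 > 0" using d d2 by simp
  obtain r where r: "\<And>x y y'. dist y y' > r \<Longrightarrow> cmod (\<xi> x y) * cmod (\<xi> x y') \<le> d * d2 / 2"
    by (rule xi_localised[OF dd]) blast
  have far: "cmod (\<xi> x y) < d2" if "dist (f x) y > r" for x y
  proof (rule ccontr)
    assume "\<not> ?thesis"
    then have "d * d2 \<le> cmod (\<xi> x (f x)) * cmod (\<xi> x y)" using d d2 by (intro mult_mono) auto
    then show False using r[OF that, of x] dd by linarith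
  qed
  \<comment> \<open>The propagation bound of the \<open>c i\<close> plus the localisation radius: a
    point within \<open>k\<close> of \<open>f (t n)\<close> is then still farther than
    \<open>r\<close> from \<open>f x'\<close>. It depends on neither \<epsilon> nor the operator
    being approximated. The maximum and the 1 make it positive.\<close>
  define K0 where "K0 = real k + max r 0 + 1"
  have K0: "K0 > 0" by (simp add: K0_def add_nonneg_pos)
  have "\<exists>\<delta>>0. \<forall>x x''. dist (f x'') (f x) \<le> \<epsilon> \<longrightarrow> (\<exists>x'. dist x' x \<le> \<delta> \<and> dist (f x'') (f x') \<le> K0)" if \<epsilon>: "\<epsilon> > 0" for \<epsilon>
  proof (rule ccontr)
    assume neg: "\<not> ?thesis"
    define Q where "Q = (\<lambda>(n::nat) x x''. dist (f x'') (f x) \<le> \<epsilon> \<and> (\<forall>x'. dist x' x \<le> real n \<longrightarrow> dist (f x'') (f x') > K0))"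
    obtain N1 :: nat where N1: "\<And>y :: 'b. finite (cball y \<epsilon>)" using ulf_bound[OF ulfY, of \<epsilon>] by blast
    have dec: "Q m x x''" if "m \<le> n" "Q n x x''" for m n x x''
    proof -
      have "real m \<le> real n" using that by simp
      then show ?thesis using that(2) unfolding Q_def by (meson order_trans)
    qed
    obtain s t where st: "\<And>n. Q n (s n) (t n)" "inj s" "inj t"
    proof (rule injective_bad_sequence[of Q])
      show "\<exists>x x''. Q n x x''" for n
      proof -
        have "real n + 1 > 0" by simp
        then obtain x x'' where "dist (f x'') (f x) \<le> \<epsilon>" "\<And>x'. dist x' x \<le> real n + 1 \<Longrightarrow> dist (f x'') (f x') > K0"
          using neg by (meson not_le)
        then have "Q n x x''" by (auto simp: Q_def)
        then show ?thesis by blast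
      qed
      show "finite {x''. \<exists>n. Q n x x''}" for x
        by (rule finite_subset[OF _ finite_vimageI[OF N1[of "f x"] f]]) (auto simp: Q_def dist_commute)
      show "finite {x. \<exists>n. Q n x x''}" for x''
        by (rule finite_subset[OF _ finite_vimageI[OF N1[of "f x''"] f]]) (auto simp: Q_def)
      show "\<exists>N. \<forall>n. Q n x x'' \<longrightarrow> n \<le> N" for x x''
      proof (rule exI[of _ "nat \<lceil>dist x'' x\<rceil>"], intro allI impI)
        fix n assume "Q n x x''"
        then have "\<not> dist x'' x \<le> real n" using K0 by (auto simp: Q_def)
        then show "n \<le> nat \<lceil>dist x'' x\<rceil>" by linarith
      qed
      show "Q m x x''" if "m \<le> n" "Q n x x''" for m n x x'' by (rule dec[OF that])
    qed blast
    \<comment> \<open>The candidate translation of \<open>Y\<close>, with displacement at most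
      \<epsilon>; the subset \<open>M\<close> is left open so that cancellation between the pairs
      can be avoided.\<close>
    define G where "G = (\<lambda>M. (\<lambda>m. (f (s m), f (t m))) ` M)"
    have fs: "f (s m) = f (s m') \<longleftrightarrow> m = m'" "f (t m) = f (t m') \<longleftrightarrow> m = m'" for m m'
      using f st(2,3) by (auto simp: inj_eq)
    have pG: "pinj (G M)" for M by (auto simp: G_def pinj_def inj_on_def fs)
    have injG: "inj_on (\<lambda>m. (f (s m), f (t m))) M" for M by (auto simp: inj_on_def fs)
    have dG: "dist y y' \<le> \<epsilon>" if "(y, y') \<in> G M" for y y' M
      using that st(1) by (auto simp: G_def Q_def dist_commute)
    define b where "b = (\<lambda>M. crn (trans_op (G M)))"
    define g where "g = (\<lambda>n m. \<xi> (s n) (f (s m)) * cnj (p (delta (f (t n))) (f (t m))))"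
    have bg: "b M (\<xi> (s n)) (f (t n)) = (\<Sum>\<^sub>\<infinity>m\<in>M. g n m)" for M n
    proof -
      have "b M (\<xi> (s n)) (f (t n)) = (\<Sum>\<^sub>\<infinity>z\<in>G M. \<xi> (s n) (fst z) * cnj (p (delta (f (t n))) (snd z)))"
        unfolding b_def by (rule corner_trans_op(3)[OF pG dG])
      also have "\<dots> = (\<Sum>\<^sub>\<infinity>m\<in>M. g n m)"
        unfolding G_def infsum_reindex[OF injG] by (simp add: o_def g_def)
      finally show ?thesis .
    qed
    have gs: "(\<lambda>m. cmod (g n m)) summable_on UNIV" for n
    proof -
      have "(\<lambda>z. cmod (\<xi> (s n) (fst z) * cnj (p (delta (f (t n))) (snd z)))) summable_on G UNIV"
        by (rule pinj_summable[OF pG xi_l2 l2_cnj[OF bop_l2[OF p_bounded]]])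
      then show ?thesis unfolding G_def summable_on_reindex[OF injG] by (simp add: o_def g_def)
    qed
    have gd: "\<mu> \<le> cmod (g n n)" for n
    proof -
      have "d^2 \<le> (cmod (\<xi> (t n) (f (t n))))^2" using d by (intro power_mono) auto
      then have "d^2 \<le> cmod (p (delta (f (t n))) (f (t n)))" using p_diag_ge by (rule order_trans)
      then have "d * d^2 \<le> cmod (\<xi> (s n) (f (s n))) * cmod (p (delta (f (t n))) (f (t n)))" using d by (intro mult_mono) auto
      then show ?thesis by (simp add: \<mu>_def g_def norm_mult power3_eq_cube power2_eq_square mult.assoc)
    qed
    obtain M where M: "\<And>j::nat. \<exists>n\<ge>j. cmod (\<Sum>\<^sub>\<infinity>m\<in>M. g n m) > \<mu>/3"
      using exists_subset_large_sums[OF gs \<mu> gd] by blast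
    have bA: "b M \<in> A" unfolding b_def by (rule corner_trans_op(1)[OF pG dG])
    have b1: "opnorm (b M) \<le> 1" unfolding b_def by (rule corner_trans_op(2)[OF pG dG])
    have "\<mu>/6 > 0" using \<mu> by simp
    with k bA b1 obtain a c where ac: "\<forall>i<k. a i \<in> \<Phi> ` roe_alg \<and> opnorm (a i) \<le> real k \<and>
                   c i \<in> A \<and> propg_le (c i) (real k) \<and> opnorm (c i) \<le> real k"
      and approx: "opnorm (op_minus (b M) (\<lambda>v y. \<Sum>i<k. c i (a i v) y)) \<le> \<mu>/6" by blast
    have "\<forall>i. \<exists>\<alpha>. i < k \<longrightarrow> \<alpha> \<in> roe_alg \<and> a i = \<Phi> \<alpha>" using ac by blast
    then obtain \<alpha> where \<alpha>: "\<And>i. i < k \<Longrightarrow> \<alpha> i \<in> roe_alg" "\<And>i. i < k \<Longrightarrow> a i = \<Phi> (\<alpha> i)" by metis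
    have "\<forall>i. \<exists>a' q. i < k \<longrightarrow> bounded_op a' \<and> propg_le a' q \<and> opnorm (op_minus (\<alpha> i) a') \<le> \<kappa>"
    proof
      fix i show "\<exists>a' q. i < k \<longrightarrow> bounded_op a' \<and> propg_le a' q \<and> opnorm (op_minus (\<alpha> i) a') \<le> \<kappa>"
      proof (cases "i < k")
        case True
        obtain a' where "bounded_op a'" "finite_prop a'" "opnorm (op_minus (\<alpha> i) a') \<le> \<kappa>"
          using roe_approx[OF \<alpha>(1)[OF True] \<kappa>] by blast
        then show ?thesis by (auto simp: finite_prop_def)
      qed simp
    qed
    then obtain a' q where a': "\<And>i. i < k \<Longrightarrow> bounded_op (a' i)" "\<And>i. i < k \<Longrightarrow> propg_le (a' i) (q i)"
      "\<And>i. i < k \<Longrightarrow> opnorm (op_minus (\<alpha> i) (a' i)) \<le> \<kappa>" by metis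
    \<comment> \<open>Only now, with \<open>M\<close> and the approximants fixed, is their
      propagation known; since \<open>M\<close> yields large sums at arbitrarily late indices, a
      pair that is bad at a radius beyond all \<open>q i\<close> is available.\<close>
    obtain j :: nat where j: "real j > Max (insert 0 (q ` {..<k}))" using reals_Archimedean2 by blast
    have qj: "q i \<le> real j" if "i < k" for i
    proof -
      have "q i \<le> Max (insert 0 (q ` {..<k}))" using that by (intro Max_ge) auto
      then show ?thesis using j by linarith
    qed
    obtain n where n: "n \<ge> j" "cmod (\<Sum>\<^sub>\<infinity>m\<in>M. g n m) > \<mu>/3" using M by blast
    define x y'' where "x = s n" and "y'' = f (t n)"
    have bnd: "cmod (c i (a i (\<xi> x)) y'') \<le> real N * (2 * \<kappa> * real k)" if i: "i < k" for i
    proof (rule propg_apply_bound[where c="c i" and u="a i (\<xi> x)", OF _ _ _ N])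
      show "bounded_op (c i)" "propg_le (c i) (real k)" "opnorm (c i) \<le> real k" using ac i A_roe by auto
      show "a i (\<xi> x) \<in> l2" using \<alpha> i by (simp add: bop_l2[OF Phi_bounded])
      show "0 \<le> 2 * \<kappa>" using \<kappa> by simp
      fix y assume y: "y \<in> cball y'' (real k)"
      have "cmod (\<xi> x' y) < d2" if "x' \<in> cball x (q i)" for x'
      proof (rule far)
        have "dist x' x \<le> real n" using that qj[OF i] n(1) by (simp add: dist_commute)
        then have "dist y'' (f x') > K0" using st(1)[of n] by (auto simp: Q_def x_def y''_def)
        then show "dist (f x') y > r" using y dist_triangle[of y'' "f x'" y] by (auto simp: K0_def dist_commute)
      qed
      moreover have "finite (cball x (q i))" by (rule ulf_bound[OF ulfX, of "q i"]) auto
      ultimately have "(\<Sum>x'\<in>cball x (q i). (cmod (\<xi> x' y))^2) \<le> c1" by (intro d2(2))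
      moreover have "opnorm (\<Phi> (\<alpha> i)) \<le> real k" using ac \<alpha> i by auto
      ultimately have "cmod (\<Phi> (\<alpha> i) (\<xi> x) y) \<le> real k * sqrt c1 + \<kappa>"
        using Phi_xi_bound[OF \<alpha>(1)[OF i] _ a'(1)[OF i] a'(2)[OF i] a'(3)[OF i]] by blast
      then show "cmod (a i (\<xi> x) y) \<le> 2 * \<kappa>" using kc1 \<alpha>(2)[OF i] by simp
    qed
    define C where "C = (\<lambda>v y. \<Sum>i<k. c i (a i v) y)"
    have "bounded_op (\<lambda>v y. \<Sum>i\<in>{..<k}. op_mult (c i) (a i) v y)"
      using ac A_roe \<alpha> Phi_bounded by (intro bounded_op_sum bounded_op_mult) auto
    then have C: "bounded_op C" by (simp add: C_def op_mult_def)
    have bb: "bounded_op (b M)" using bA A_roe by auto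
    have "cmod (op_minus (b M) C (\<xi> x) y'') \<le> l2norm (op_minus (b M) C (\<xi> x))"
      using bb C by (intro l2_norm_coord_le bop_l2) auto
    also have "\<dots> \<le> \<mu>/6"
      using opnorm_ge[of "op_minus (b M) C" "\<xi> x"] approx bb C xi_l2 xi_norm by (simp add: C_def)
    finally have "cmod (b M (\<xi> x) y'' - C (\<xi> x) y'') \<le> \<mu>/6" by (simp add: op_minus_def)
    moreover have "cmod (b M (\<xi> x) y'') > \<mu>/3" using n(2) bg by (simp add: x_def y''_def)
    moreover have "cmod (b M (\<xi> x) y'') \<le> cmod (C (\<xi> x) y'') + cmod (b M (\<xi> x) y'' - C (\<xi> x) y'')"
      by (rule norm_triangle_sub)
    \<comment> \<open>More than \<mu>\<open>/3\<close> in the corner operator, less the error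
      \<mu>\<open>/6\<close>, contradicts the bound by \<mu>\<open>/6\<close> coming from the values
      \<open>bnd\<close>.\<close>
    ultimately have "\<mu>/6 < cmod (C (\<xi> x) y'')" by linarith
    also have "\<dots> \<le> (\<Sum>i<k. real N * (2 * \<kappa> * real k))"
      unfolding C_def by (intro order_trans[OF norm_sum] sum_mono bnd) simp
    also have "\<dots> = (L - 1) * (2 * \<kappa>)" by (simp add: L_def)
    also have "\<dots> \<le> L * (2 * \<kappa>)" using \<kappa> by (intro mult_right_mono) auto
    also have "\<dots> = \<mu>/6" using L by (simp add: \<kappa>_def)
    finally show False by simp
  qed
  then show ?thesis using K0 by blast
qed

end

theorem theorem4p8:
  fixes \<Phi> :: "('a::metric_space) op \<Rightarrow> ('b::metric_space) op"
    and A :: "'b op set"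
  assumes "ulf (UNIV :: 'a set)"
    and "ulf (UNIV :: 'b set)"
    and "property_A (UNIV :: 'b set)"
    and "embedding \<Phi> (roe_alg :: 'a op set) (roe_alg :: 'b op set)"
    and "hereditary A (roe_alg :: 'b op set)"
    and "roe_cartan A (\<Phi> ` (linf_diag :: 'a op set))"
    and "strongly_cobounded (\<Phi> ` (roe_alg :: 'a op set)) A"
  shows "\<exists>(Z :: 'b set) (f :: 'a \<Rightarrow> 'b). bij_betw f UNIV Z \<and> coarse_quotient f Z"
proof -
  obtain \<eta> :: "nat \<Rightarrow> 'b \<Rightarrow> 'b \<Rightarrow> real" and S where K: "kernels \<eta> S"
    by (rule property_A_kernels[OF assms(3)])
  interpret roe_cartan_coarse \<Phi> A \<eta> S
    by unfold_locales (fact assms K)+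
  obtain d where d: "d > 0" and hall: "hall (\<lambda>x. {y. d \<le> cmod (\<xi> x y)})" by (rule hall_condition)
  obtain f where f: "inj f" "\<And>x. f x \<in> {y. d \<le> cmod (\<xi> x y)}" using hall_marriage[OF hall] by blast
  then have fd: "d \<le> cmod (\<xi> x (f x))" for x by simp
  have "coarse_map f" by (rule concentrated_coarse[OF f(1) d fd])
  moreover have "\<exists>K>0. \<forall>\<epsilon>>0. \<exists>\<delta>>0. \<forall>x x''. dist (f x'') (f x) \<le> \<epsilon> \<longrightarrow>
      (\<exists>x'. dist x' x \<le> \<delta> \<and> dist (f x'') (f x') \<le> K)"
    by (rule concentrated_quotient[OF f(1) d fd assms(7)])
  ultimately have "coarse_quotient f (range f)" unfolding coarse_quotient_def by auto
  moreover have "bij_betw f UNIV (range f)" using f(1) by (simp add: bij_betw_def)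
  ultimately show ?thesis by blast
qed

end
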